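(* Let $s>\frac32$. For every $\omega^0\in H^s_{df}(\mathbb{R}^3)$ there exists a unique strong solution $\omega\in C^1\left([0,T_{max});H^s_{df}(\mathbb{R}^3)\right)$ of the inviscid vortex stretching equation with $\omega(\cdot,0)=\omega^0$, where $$T_{max}\geq \frac{1}{2C_s\|\omega^0\|_{H^s}}.$$ Furthermore, if $T_{max}<+\infty$, then for all $0\leq t<T_{max}$, $$\|\omega(\cdot,t)\|_{H^s}\geq \frac{1}{2C_s(T_{max}-t)}.$$
   Context: $H^s(\mathbb{R}^3)$ has norm $\|f\|_{H^s}=\left(\int_{\mathbb{R}^3}(1+4\pi^2|\xi|^2)^s|\hat f(\xi)|^2\,d\xi\right)^{1/2}$ (for vector- or matrix-valued $f$, $|\hat f|$ is the Euclidean norm of the components). $H^s_{df}(\mathbb{R}^3)=\{v\in H^s(\mathbb{R}^3;\mathbb{R}^3): \xi\cdot\hat v(\xi)=0\}$ is the space of divergence free fields, and $P_{df}:H^s(\mathbb{R}^3;\mathbb{R}^3)\to H^s_{df}(\mathbb{R}^3)$ is the Helmholtz (orthogonal) projection onto it. The inviscid vortex stretching equation is $$\partial_t\omega=P_{df}\left((\omega\cdot\nabla)u\right),\qquad u=\nabla\times(-\Delta)^{-1}\omega,$$ where $u$ is determined from $\omega$ as the Fourier multiplier $\nabla\times(-\Delta)^{-1}$. A strong solution on a time interval is a function in $C^1$ in time with values in $H^s_{df}$ satisfying this equation in $H^s$; $C^1([0,T_{max});X)$ means belonging to $C^1([0,T];X)$ for every $0<T<T_{max}$. $T_{max}\in(0,+\infty]$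 denotes the maximal time of existence of the solution in this class. $C_s>0$ denotes a constant depending only on $s>\frac32$ such that $\|fg\|_{H^s}\leq C_s\|f\|_{H^s}\|g\|_{H^s}$ for all (scalar) $f,g\in H^s(\mathbb{R}^3)$. When $\omega^0=0$ the quantity $1/\|\omega^0\|_{H^s}$ is read as $+\infty$. *)

theory Defs
  imports "HOL-Analysis.Analysis"
begin

(* Elements of L^2 and H^s are represented by Borel functions; equality in these spaces is
   equality almost everywhere. *)

definition square_integrable :: "(real^3 \<Rightarrow> 'a::euclidean_space) \<Rightarrow> bool" where
  "square_integrable f \<longleftrightarrow>
     f \<in> borel_measurable lborel \<and> integrable lborel (\<lambda>x. (norm (f x))\<^sup>2)"

(* Convention: hat f(\<xi>) = integral of exp(-2 pi i x.\<xi>) f(x) dx, over the ball of radius R. *)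

definition fourier_trunc :: "real \<Rightarrow> (real^3 \<Rightarrow> complex) \<Rightarrow> real^3 \<Rightarrow> complex" where
  "fourier_trunc R f \<xi> = (LINT x:cball 0 R|lborel. cis (- 2 * pi * (x \<bullet> \<xi>)) * f x)"

(* The Fourier transform on L^2, as the limit in mean of the truncated Fourier integrals.  It is
   determined up to a null set, and a representative is chosen. *)

definition fourier :: "(real^3 \<Rightarrow> complex) \<Rightarrow> real^3 \<Rightarrow> complex" where
  "fourier f = (SOME g. square_integrable g \<and>
     (\<lambda>n::nat. \<integral>\<^sup>+ \<xi>. ennreal ((cmod (fourier_trunc (real n) f \<xi> - g \<xi>))\<^sup>2) \<partial>lborel)
       \<longlonglongrightarrow> 0)"

(* The Fourier transform of the b-component (b a basis vector) of a real scalar, vector or matrix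
   valued function; for scalars the only basis vector is 1. *)

definition fourier_comp ::
    "(real^3 \<Rightarrow> 'a::euclidean_space) \<Rightarrow> 'a \<Rightarrow> real^3 \<Rightarrow> complex" where
  "fourier_comp f b = fourier (\<lambda>x. complex_of_real (f x \<bullet> b))"

definition sobolev_weight :: "real \<Rightarrow> real^3 \<Rightarrow> real" where
  "sobolev_weight s \<xi> = (1 + 4 * pi\<^sup>2 * (norm \<xi>)\<^sup>2) powr s"

(* H^s for s \<ge> 0, where it is a subspace of L^2. *)

definition sobolev :: "real \<Rightarrow> (real^3 \<Rightarrow> 'a::euclidean_space) set" where
  "sobolev s = {f. square_integrable f \<and>
     integrable lborel
       (\<lambda>\<xi>. sobolev_weight s \<xi> * (\<Sum>b\<in>Basis. (cmod (fourier_comp f b \<xi>))\<^sup>2))}"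

definition sobolev_norm :: "real \<Rightarrow> (real^3 \<Rightarrow> 'a::euclidean_space) \<Rightarrow> real" where
  "sobolev_norm s f =
     sqrt (LINT \<xi>|lborel. sobolev_weight s \<xi> * (\<Sum>b\<in>Basis. (cmod (fourier_comp f b \<xi>))\<^sup>2))"

(* The inner product of two complex numbers z, w is Re (z * cnj w), so this is the real inner
   product that induces sobolev_norm. *)

definition sobolev_inner ::
    "real \<Rightarrow> (real^3 \<Rightarrow> 'a::euclidean_space) \<Rightarrow> (real^3 \<Rightarrow> 'a) \<Rightarrow> real" where
  "sobolev_inner s f g =
     (LINT \<xi>|lborel. sobolev_weight s \<xi> *
        (\<Sum>b\<in>Basis. fourier_comp f b \<xi> \<bullet> fourier_comp g b \<xi>))"

definition fourier_vec :: "(real^3 \<Rightarrow> real^3) \<Rightarrow> real^3 \<Rightarrow> complex^3" where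
  "fourier_vec v \<xi> = (\<chi> i. fourier_comp v (axis i 1) \<xi>)"

definition sobolev_df :: "real \<Rightarrow> (real^3 \<Rightarrow> real^3) set" where
  "sobolev_df s = {v \<in> sobolev s.
     AE \<xi> in lborel. (\<Sum>i\<in>UNIV. complex_of_real (\<xi> $ i) * fourier_vec v \<xi> $ i) = 0}"

(* P_df f is the element w of H^s_df with f - w orthogonal to H^s_df (unique almost everywhere). *)

definition helmholtz :: "real \<Rightarrow> (real^3 \<Rightarrow> real^3) \<Rightarrow> real^3 \<Rightarrow> real^3" where
  "helmholtz s f = (SOME w. w \<in> sobolev_df s \<and>
     (\<forall>v\<in>sobolev_df s. sobolev_inner s (\<lambda>x. f x - w x) v = 0))"

(* Cross3 provides the cross product on real^3 only. *)

definition ccross3 :: "complex^3 \<Rightarrow> complex^3 \<Rightarrow> complex^3" where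
  "ccross3 a b = vector [a$2 * b$3 - a$3 * b$2, a$3 * b$1 - a$1 * b$3, a$1 * b$2 - a$2 * b$1]"

(* The symbols of curl and -Laplacian are (2 pi i \<xi>) \<times> _ and 4 pi^2 |\<xi>|^2. *)

definition velocity_hat :: "(real^3 \<Rightarrow> real^3) \<Rightarrow> real^3 \<Rightarrow> complex^3" where
  "velocity_hat \<omega> \<xi> = (1 / (4 * pi\<^sup>2 * (norm \<xi>)\<^sup>2)) *\<^sub>R
     ccross3 (\<chi> j. 2 * complex_of_real pi * \<i> * complex_of_real (\<xi> $ j)) (fourier_vec \<omega> \<xi>)"

(* u = curl (-Laplacian)^(-1) \<omega>.  This u need not be in L^2, but for \<omega> in H^s with s > 3/2
   its transform velocity_hat \<omega> is integrable, so u is given by the inverse Fourier integral;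
   that integral is real because \<omega> is.  Moreover \<xi> velocity_hat \<omega> is integrable, so u is C^1
   and its gradient is the classical one. *)

definition velocity :: "(real^3 \<Rightarrow> real^3) \<Rightarrow> real^3 \<Rightarrow> real^3" where
  "velocity \<omega> x =
     (\<chi> i. Re (LINT \<xi>|lborel. cis (2 * pi * (x \<bullet> \<xi>)) * velocity_hat \<omega> \<xi> $ i))"

(* (\<omega> . \<nabla>) u at x is the derivative of u at x in the direction \<omega>(x). *)

definition stretching :: "(real^3 \<Rightarrow> real^3) \<Rightarrow> real^3 \<Rightarrow> real^3" where
  "stretching \<omega> x = frechet_derivative (velocity \<omega>) (at x) (\<omega> x)"

(* \<omega> is in C^1([0,T]; H^s_df) with time derivative d (one-sided at the endpoints). *)

definition C1_sobolev_df ::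
    "real \<Rightarrow> real \<Rightarrow> (real \<Rightarrow> real^3 \<Rightarrow> real^3) \<Rightarrow> (real \<Rightarrow> real^3 \<Rightarrow> real^3) \<Rightarrow> bool" where
  "C1_sobolev_df s T \<omega> d \<longleftrightarrow>
     (\<forall>t\<in>{0..T}. \<omega> t \<in> sobolev_df s \<and> d t \<in> sobolev_df s \<and>
        ((\<lambda>\<tau>. sobolev_norm s (\<lambda>x. (1 / (\<tau> - t)) *\<^sub>R (\<omega> \<tau> x - \<omega> t x) - d t x)) \<longlongrightarrow> 0)
          (at t within {0..T}) \<and>
        ((\<lambda>\<tau>. sobolev_norm s (\<lambda>x. d \<tau> x - d t x)) \<longlongrightarrow> 0) (at t within {0..T}))"

definition strong_solution_upto :: "real \<Rightarrow> real \<Rightarrow> (real \<Rightarrow> real^3 \<Rightarrow> real^3) \<Rightarrow> bool" where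
  "strong_solution_upto s T \<omega> \<longleftrightarrow>
     (\<exists>d. C1_sobolev_df s T \<omega> d \<and>
       (\<forall>t\<in>{0..T}. stretching (\<omega> t) \<in> sobolev s \<and>
          (AE x in lborel. d t x = helmholtz s (stretching (\<omega> t)) x)))"

(* Strong solution on [0,T) with 0 < T \<le> \<infinity> and initial datum \<omega>0. *)

definition strong_solution ::
    "real \<Rightarrow> ereal \<Rightarrow> (real^3 \<Rightarrow> real^3) \<Rightarrow> (real \<Rightarrow> real^3 \<Rightarrow> real^3) \<Rightarrow> bool" where
  "strong_solution s T \<omega>0 \<omega> \<longleftrightarrow>
     0 < T \<and> (AE x in lborel. \<omega> 0 x = \<omega>0 x) \<and>
     (\<forall>T'. 0 < T' \<and> ereal T' < T \<longrightarrow> strong_solution_upto s T' \<omega>)"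

definition max_time :: "real \<Rightarrow> (real^3 \<Rightarrow> real^3) \<Rightarrow> ereal" where
  "max_time s \<omega>0 = Sup {T. \<exists>\<omega>. strong_solution s T \<omega>0 \<omega>}"

end

theory Submission
  imports Defs "HOL-Probability.Characteristic_Functions"
begin

text \<open>
  The equation is an ordinary differential equation \<open>y' = Q(y, y)\<close> with a bounded bilinear form
  \<open>Q(v, w) = P\<^sub>d\<^sub>f ((v \<cdot> \<nabla>) u\<^sub>w)\<close>, \<open>u\<^sub>w = \<nabla> \<times> (-\<Delta>)\<^sup>-\<^sup>1 w\<close>, on the space of divergence free
  fields, and everything follows from the bound \<open>\<parallel>Q(v, w)\<parallel> \<le> C \<parallel>v\<parallel> \<parallel>w\<parallel>\<close>.

  The bound. The map from \<open>w\<close> to \<open>\<nabla> u\<^sub>w\<close> is a Fourier multiplier of degree 0, and by Lagrange's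
  identity the matrix that it makes of the transform of \<open>w\<close> has pointwise at most the length of
  that transform (\<open>norm_velocity_hat\<close>).  Hence \<open>\<parallel>\<nabla> u\<^sub>w\<parallel> \<le> \<parallel>w\<parallel>\<close>.  The algebra hypothesis, applied
  to each product \<open>v\<^sub>j \<partial>\<^sub>j u\<^sub>i\<close>, and the Cauchy-Schwarz inequality for the sum over \<open>j\<close> then give the
  bound with the same constant \<open>C\<close> (\<open>stretch_bound\<close>), and an orthogonal projection does not
  increase norms (\<open>norm_helmholtz_le\<close>).

  The differential equation.  For a bounded quadratic nonlinearity the Taylor coefficients of a
  solution are determined recursively and satisfy \<open>\<parallel>a\<^sub>n\<parallel> \<le> \<parallel>y\<^sub>0\<parallel> (C \<parallel>y\<^sub>0\<parallel>)\<^sup>n\<close>, so that the Taylor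
  series is a solution for \<open>t < 1 / (C \<parallel>y\<^sub>0\<parallel>)\<close> (\<open>local_existence\<close>), twice the time claimed.
  Solutions are unique (\<open>solves_unique\<close>).  If at some time \<open>t\<close> before a finite maximal time \<open>T\<close> the
  norm were below \<open>1 / (2 C (T - t))\<close>, then the solution could be restarted at \<open>t\<close> and would live
  for a time \<open>2 (T - t)\<close>, past \<open>T\<close> (\<open>maximal_solution\<close>).

  The Fourier transform.  The transform and the projection are choices of representatives, which
  three facts about \<open>L\<^sup>2\<close> bring under control: Plancherel's identity, proved
  for functions that are also integrable by damping with a Gaussian (\<open>plancherel_integrable\<close>) and extended by
  completeness (\<open>fourier_spec\<close>); surjectivity, which follows from Plancherel's identity for the
  transform and its adjoint (\<open>fourier_inverse_fourier\<close>); and Hermitian symmetry as the criterion for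
  a transform to come from a real function (\<open>inverse_fourier_real\<close>).  With them a divergence free
  real field becomes a weighted square integrable transform, Hermitian and orthogonal to the
  frequency; such classes form a closed subspace of a Hilbert space (\<open>closed_df_space\<close>), on which
  the abstract theory of the differential equation applies.
\<close>

section \<open>Quadratic differential equations in a Banach space\<close>

text \<open>The form is bilinear on the closed subspace \<open>X\<close> only, because the stretching form makes sense
  only for classes that come from divergence free real fields.\<close>

locale quadratic_ode =
  fixes X :: "'a::banach set" and B :: "'a \<Rightarrow> 'a \<Rightarrow> 'a" and K :: real
  assumes subspace_X: "subspace X" and closed_X: "closed X" and K_pos: "0 < K"
    and B_in: "\<And>x y. x \<in> X \<Longrightarrow> y \<in> X \<Longrightarrow> B x y \<in> X"
    and B_add_left: "\<And>x y z. x \<in> X \<Longrightarrow> y \<in> X \<Longrightarrow> z \<in> X \<Longrightarrow> B (x + y) z = B x z + B y z"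
    and B_add_right: "\<And>x y z. x \<in> X \<Longrightarrow> y \<in> X \<Longrightarrow> z \<in> X \<Longrightarrow> B z (x + y) = B z x + B z y"
    and B_scale_left: "\<And>x y c. x \<in> X \<Longrightarrow> y \<in> X \<Longrightarrow> B (c *\<^sub>R x) y = c *\<^sub>R B x y"
    and B_scale_right: "\<And>x y c. x \<in> X \<Longrightarrow> y \<in> X \<Longrightarrow> B x (c *\<^sub>R y) = c *\<^sub>R B x y"
    and B_bound: "\<And>x y. x \<in> X \<Longrightarrow> y \<in> X \<Longrightarrow> norm (B x y) \<le> K * norm x * norm y"
begin

lemmas X_closure = subspace_0[OF subspace_X] subspace_add[OF subspace_X]
  subspace_scale[OF subspace_X] subspace_diff[OF subspace_X] subspace_sum[OF subspace_X]

lemma B_zero_left: "x \<in> X \<Longrightarrow> B 0 x = 0"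
  using B_scale_left[of x x 0] by simp

lemma B_zero_right: "x \<in> X \<Longrightarrow> B x 0 = 0"
  using B_scale_right[of x x 0] by simp

lemma B_sum_left: "finite I \<Longrightarrow> (\<And>i. i \<in> I \<Longrightarrow> f i \<in> X) \<Longrightarrow> z \<in> X \<Longrightarrow> B (sum f I) z = (\<Sum>i\<in>I. B (f i) z)"
  by (induction I rule: finite_induct) (simp_all add: B_zero_left B_add_left X_closure)

lemma B_sum_right: "finite I \<Longrightarrow> (\<And>i. i \<in> I \<Longrightarrow> f i \<in> X) \<Longrightarrow> z \<in> X \<Longrightarrow> B z (sum f I) = (\<Sum>i\<in>I. B z (f i))"
  by (induction I rule: finite_induct) (simp_all add: B_zero_right B_add_right X_closure)

lemma B_diff_self:
  assumes "x \<in> X" "y \<in> X"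
  shows "B x x - B y y = B (x - y) x + B y (x - y)"
proof -
  have "B x x = B (x - y) x + B y x"
    using B_add_left[of "x - y" y x] assms by (simp add: X_closure)
  moreover have "B y x = B y (x - y) + B y y"
    using B_add_right[of "x - y" y y] assms by (simp add: X_closure)
  ultimately show ?thesis by simp
qed

text \<open>The two terms obtained by telescoping show that the nonlinearity is Lipschitz on bounded sets.\<close>

lemma norm_B_diff_self:
  assumes "x \<in> X" "y \<in> X"
  shows "norm (B x x - B y y) \<le> K * (norm x + norm y) * norm (x - y)"
proof -
  have "norm (B x x - B y y) \<le> norm (B (x - y) x) + norm (B y (x - y))"
    unfolding B_diff_self[OF assms] by (rule norm_triangle_ineq)
  also have "\<dots> \<le> K * norm (x - y) * norm x + K * norm y * norm (x - y)"
    by (intro add_mono B_bound) (use assms in \<open>auto simp: X_closure\<close>)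
  finally show ?thesis by (simp add: algebra_simps)
qed

definition solves :: "(real \<Rightarrow> 'a) \<Rightarrow> real \<Rightarrow> bool" where
  "solves y T \<longleftrightarrow> (\<forall>t\<in>{0..T}. y t \<in> X \<and>
     (y has_vector_derivative B (y t) (y t)) (at t within {0..T}))"

lemma solves_mono: "solves y T \<Longrightarrow> T' \<le> T \<Longrightarrow> solves y T'"
  unfolding solves_def by (fastforce elim!: has_vector_derivative_within_subset)

lemma solves_continuous: "solves y T \<Longrightarrow> continuous_on {0..T} y"
  unfolding solves_def
  by (meson continuous_on_eq_continuous_within has_vector_derivative_continuous)

lemma solves_cong:
  assumes "solves y T" "\<And>t. t \<in> {0..T} \<Longrightarrow> z t = y t"
  shows "solves z T"
  unfolding solves_def
proof
  fix t assume t: "t \<in> {0..T}"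
  then have "(y has_vector_derivative B (y t) (y t)) (at t within {0..T})" "y t \<in> X"
    using assms(1) by (auto simp: solves_def)
  then show "z t \<in> X \<and> (z has_vector_derivative B (z t) (z t)) (at t within {0..T})"
    using has_vector_derivative_transform[OF t assms(2)] assms(2)[OF t] by auto
qed

subsection \<open>Uniqueness\<close>

text \<open>Integrating the Lipschitz bound \<open>\<parallel>D'\<parallel> \<le> L \<parallel>D\<parallel>\<close> for the difference \<open>D\<close> repeatedly, starting from
  \<open>\<parallel>D\<parallel> \<le> M\<close>, gives \<open>\<parallel>D(t)\<parallel> \<le> M (L t)\<^sup>n / n!\<close> for every \<open>n\<close>.\<close>

theorem solves_unique:
  assumes y: "solves y T" and z: "solves z T" and init: "y 0 = z 0" and t: "t \<in> {0..T}"
  shows "y t = z t"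
proof -
  have cy: "continuous_on {0..T} y" and cz: "continuous_on {0..T} z"
    using y z by (auto intro: solves_continuous)
  have "bounded (y ` {0..T})" "bounded (z ` {0..T})"
    using cy cz by (auto intro!: compact_imp_bounded compact_continuous_image)
  then obtain My Mz where My: "\<And>t. t \<in> {0..T} \<Longrightarrow> norm (y t) \<le> My" and Mz: "\<And>t. t \<in> {0..T} \<Longrightarrow> norm (z t) \<le> Mz"
    unfolding bounded_iff by fastforce
  define M where "M = My + Mz"
  define L where "L = K * M"
  have M0: "0 \<le> M"
    using My[OF t] Mz[OF t] norm_ge_zero[of "y t"] norm_ge_zero[of "z t"] unfolding M_def by linarith
  then have L0: "0 \<le> L" using K_pos by (simp add: L_def)
  define D where "D = (\<lambda>t. y t - z t)"
  have Dbound: "norm (D t) \<le> M" if "t \<in> {0..T}" for t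
    using My[OF that] Mz[OF that] norm_triangle_ineq4[of "y t" "z t"] unfolding D_def M_def by linarith
  have D': "(D has_vector_derivative (B (y t) (y t) - B (z t) (z t))) (at t)" if "t \<in> {0<..<T}" for t
  proof -
    have "at t within {0..T} = at t"
      using that by (intro at_within_interior) auto
    then show ?thesis
      using y z that unfolding solves_def D_def
      by (metis greaterThanLessThan_subseteq_atLeastAtMost_iff has_vector_derivative_diff order_refl subsetD)
  qed
  have D'bound: "norm (B (y t) (y t) - B (z t) (z t)) \<le> L * norm (D t)" if "t \<in> {0..T}" for t
  proof -
    have "norm (B (y t) (y t) - B (z t) (z t)) \<le> K * (norm (y t) + norm (z t)) * norm (D t)"
      unfolding D_def using that y z by (intro norm_B_diff_self) (auto simp: solves_def)
    also have "\<dots> \<le> L * norm (D t)"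
      unfolding L_def M_def using My[OF that] Mz[OF that] K_pos by (intro mult_right_mono mult_left_mono add_mono) auto
    finally show ?thesis .
  qed
  have iter: "\<forall>t\<in>{0..T}. norm (D t) \<le> M * (L * t) ^ n / fact n" for n
  proof (induction n)
    case 0 then show ?case using Dbound by simp
  next
    case (Suc n)
    show ?case
    proof
      fix b assume b: "b \<in> {0..T}"
      show "norm (D b) \<le> M * (L * b) ^ Suc n / fact (Suc n)"
      proof (cases "b = 0")
        case True then show ?thesis using init by (simp add: D_def)
      next
        case False
        then have b0: "0 < b" using b by simp
        have "norm (D b - D 0) \<le> M * (L * b) ^ Suc n / fact (Suc n) - M * (L * 0) ^ Suc n / fact (Suc n)"
        proof (rule differentiable_bound_general[OF b0, where f' = "\<lambda>t. B (y t) (y t) - B (z t) (z t)"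
              and \<phi>' = "\<lambda>t. L * (M * (L * t) ^ n / fact n)"])
          show "continuous_on {0..b} D"
            unfolding D_def using b
            by (intro continuous_intros continuous_on_subset[OF cy] continuous_on_subset[OF cz]) auto
          show "continuous_on {0..b} (\<lambda>t. M * (L * t) ^ Suc n / fact (Suc n))"
            by (intro continuous_intros) auto
        next
          fix x assume x: "0 < x" "x < b"
          show "(D has_vector_derivative B (y x) (y x) - B (z x) (z x)) (at x)"
            using x b by (intro D') auto
          have "((\<lambda>t. M * (L * t) ^ Suc n / fact (Suc n)) has_real_derivative
             M * ((1 + real n) * (L * x) ^ n * L) / fact (Suc n)) (at x)"
            by (auto intro!: derivative_eq_intros simp del: power_Suc)
          moreover have "M * ((1 + real n) * (L * x) ^ n * L) / fact (Suc n) = L * (M * (L * x) ^ n / fact n)"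
          proof -
            have "M * ((1 + real n) * (L * x) ^ n * L) / fact (Suc n) =
                ((1 + real n) / (1 + real n)) * (L * (M * (L * x) ^ n / fact n))"
              unfolding fact_Suc of_nat_Suc times_divide_times_eq times_divide_eq_right by (simp only: times_divide_eq_right divide_divide_eq_left ac_simps)
            then show ?thesis by simp
          qed
          ultimately show "((\<lambda>t. M * (L * t) ^ Suc n / fact (Suc n)) has_vector_derivative
              L * (M * (L * x) ^ n / fact n)) (at x)"
            by (simp only: has_real_derivative_iff_has_vector_derivative)
          have "norm (B (y x) (y x) - B (z x) (z x)) \<le> L * norm (D x)"
            using x b by (intro D'bound) auto
          also have "\<dots> \<le> L * (M * (L * x) ^ n / fact n)"
            using Suc.IH x b L0 by (intro mult_left_mono) auto
          finally show "norm (B (y x) (y x) - B (z x) (z x)) \<le> L * (M * (L * x) ^ n / fact n)" .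
        qed
        then show ?thesis using init by (simp add: D_def)
      qed
    qed
  qed
  have "(\<lambda>n. M * ((L * t) ^ n / fact n)) \<longlonglongrightarrow> M * 0"
    using summable_LIMSEQ_zero[OF summable_exp_generic[of "L * t"]]
    by (intro tendsto_intros) (simp add: divide_inverse mult.commute)
  then have "norm (D t) \<le> 0"
    using iter t by (intro LIMSEQ_le_const) auto
  then show ?thesis by (simp add: D_def)
qed

subsection \<open>Local existence\<close>

text \<open>The Taylor coefficients that the equation forces, found by comparing the coefficients of \<open>t\<^sup>n\<close>.\<close>

fun coeff :: "'a \<Rightarrow> nat \<Rightarrow> 'a" where
  "coeff y0 0 = y0"
| "coeff y0 (Suc n) = (1 / real (Suc n)) *\<^sub>R (\<Sum>k\<le>n. B (coeff y0 k) (coeff y0 (n - k)))"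

lemma coeff_in: "y0 \<in> X \<Longrightarrow> coeff y0 n \<in> X"
proof (induction n rule: less_induct)
  case (less n)
  then show ?case
    by (cases n) (auto intro!: X_closure B_in)
qed

text \<open>The bounds are the Taylor coefficients of \<open>R / (1 - K R t)\<close>, \<open>R = \<parallel>y\<^sub>0\<parallel>\<close>, which solves the scalar
  majorant equation \<open>r' = K r\<^sup>2\<close>.\<close>

lemma norm_coeff:
  assumes "y0 \<in> X"
  shows "norm (coeff y0 n) \<le> norm y0 * (K * norm y0) ^ n"
proof (induction n rule: less_induct)
  case (less n)
  show ?case
  proof (cases n)
    case 0 then show ?thesis by simp
  next
    case (Suc m)
    let ?R = "norm y0"
    have "norm (\<Sum>k\<le>m. B (coeff y0 k) (coeff y0 (m - k))) \<le> (\<Sum>k\<le>m. K * ?R ^ 2 * (K * ?R) ^ m)"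
    proof (intro sum_norm_le)
      fix k assume k: "k \<in> {..m}"
      have "norm (B (coeff y0 k) (coeff y0 (m - k))) \<le> K * norm (coeff y0 k) * norm (coeff y0 (m - k))"
        using assms by (intro B_bound coeff_in)
      also have "\<dots> \<le> K * (?R * (K * ?R) ^ k) * (?R * (K * ?R) ^ (m - k))"
        using K_pos k Suc by (intro mult_mono less.IH) auto
      also have "\<dots> = K * ?R ^ 2 * ((K * ?R) ^ k * (K * ?R) ^ (m - k))"
        by (simp add: power2_eq_square)
      also have "(K * ?R) ^ k * (K * ?R) ^ (m - k) = (K * ?R) ^ m"
        using k by (simp flip: power_add)
      finally show "norm (B (coeff y0 k) (coeff y0 (m - k))) \<le> K * ?R ^ 2 * (K * ?R) ^ m" .
    qed
    also have "\<dots> = real (Suc m) * (?R * (K * ?R) ^ n)"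
      using Suc by (simp add: power2_eq_square)
    finally show ?thesis
      using Suc by (simp add: field_simps)
  qed
qed

text \<open>The Taylor series converges up to the blow-up time \<open>1 / (K \<parallel>y\<^sub>0\<parallel>)\<close> of the scalar majorant, whereas a
  contraction argument reaches only a fraction of it.  Its termwise derivative is the Cauchy product
  of the series with itself under the bilinear form.\<close>

theorem local_existence:
  assumes y0: "y0 \<in> X" and T: "0 < T" and small: "T * K * norm y0 < 1"
  shows "\<exists>y. y 0 = y0 \<and> solves y T"
proof -
  let ?R = "norm y0"
  define a where "a = coeff y0"
  have aX: "a n \<in> X" for n using y0 by (simp add: a_def coeff_in)
  define q where "q = T * K * ?R"
  have q: "0 \<le> q" "q < 1" using small T K_pos by (auto simp: q_def)
  define f' where "f' = (\<lambda>n t. (if n = 0 then 0 else (real n * t ^ (n - 1)) *\<^sub>R a n))"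
  define c where "c = (\<lambda>n. \<Sum>k\<le>n. B (a k) (a (n - k)))"
  have ac: "a (Suc n) = (1 / real (Suc n)) *\<^sub>R c n" for n by (simp add: a_def c_def)
  have f'_Suc: "f' (Suc n) t = t ^ n *\<^sub>R c n" for n t by (simp add: f'_def ac)
  have normct: "norm (t ^ n *\<^sub>R c n) \<le> K * ?R ^ 2 * (real (Suc n) * q ^ n)" if "t \<in> {0..T}" for n t
  proof -
    have "norm (t ^ n *\<^sub>R c n) = t ^ n * (real (Suc n) * norm (a (Suc n)))"
      using that by (simp add: ac)
    also have "\<dots> \<le> T ^ n * (real (Suc n) * (?R * (K * ?R) ^ Suc n))"
      using that T unfolding a_def by (intro mult_mono power_mono norm_coeff[OF y0]) auto
    also have "\<dots> = K * ?R ^ 2 * (real (Suc n) * q ^ n)"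
      by (simp add: q_def power_mult_distrib power2_eq_square algebra_simps)
    finally show ?thesis .
  qed
  have normat: "norm (t ^ n *\<^sub>R a n) \<le> ?R * q ^ n" if "t \<in> {0..T}" for n t
  proof -
    have "norm (t ^ n *\<^sub>R a n) = t ^ n * norm (a n)" using that by simp
    also have "\<dots> \<le> T ^ n * (?R * (K * ?R) ^ n)"
      using that T unfolding a_def by (intro mult_mono power_mono norm_coeff[OF y0]) auto
    finally show ?thesis by (simp add: q_def power_mult_distrib algebra_simps)
  qed
  have sum_at: "summable (\<lambda>n. norm (t ^ n *\<^sub>R a n))" if "t \<in> {0..T}" for t
    using q by (intro summable_comparison_test'[OF summable_mult[OF summable_geometric, of q ?R]])
       (auto intro: order_trans[OF _ normat[OF that]])
  define y where "y = (\<lambda>t. \<Sum>n. t ^ n *\<^sub>R a n)"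
  have y_sums: "(\<lambda>n. t ^ n *\<^sub>R a n) sums y t" if "t \<in> {0..T}" for t
    unfolding y_def by (rule summable_sums[OF summable_norm_cancel[OF sum_at[OF that]]])
  have partial_in: "(\<Sum>n<N. t ^ n *\<^sub>R a n) \<in> X" for N t
    by (intro X_closure aX)
  have yX: "y t \<in> X" if "t \<in> {0..T}" for t
    using y_sums[OF that] unfolding sums_def
    by (rule Lim_in_closed_set[OF closed_X, rotated 2]) (auto simp: partial_in)
  \<comment> \<open>The partial sums of the Cauchy product differ from \<open>B (p N) (p N)\<close> by the terms with
      \<open>i, j < N \<le> i + j\<close>, whose norms sum to a quantity that tends to 0 by the scalar Cauchy product.\<close>
  have lim_c: "(\<lambda>N. \<Sum>n<N. t ^ n *\<^sub>R c n) \<longlonglongrightarrow> B (y t) (y t)" if t: "t \<in> {0..T}" for t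
  proof -
    define p where "p = (\<lambda>N. \<Sum>n<N. t ^ n *\<^sub>R a n)"
    have p: "p \<longlonglongrightarrow> y t" using y_sums[OF t] by (simp add: p_def sums_def)
    have pX: "p N \<in> X" for N by (simp add: p_def partial_in)
    have "(\<lambda>N. K * (norm (p N) + norm (y t)) * norm (p N - y t)) \<longlonglongrightarrow> K * (norm (y t) + norm (y t)) * norm (y t - y t)"
      by (intro tendsto_intros p)
    then have "(\<lambda>N. K * (norm (p N) + norm (y t)) * norm (p N - y t)) \<longlonglongrightarrow> 0" by simp
    then have "(\<lambda>N. B (p N) (p N) - B (y t) (y t)) \<longlonglongrightarrow> 0"
      by (rule Lim_null_comparison[rotated]) (intro always_eventually allI norm_B_diff_self pX yX t)
    then have 1: "(\<lambda>N. B (p N) (p N)) \<longlonglongrightarrow> B (y t) (y t)"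
      by (simp add: LIM_zero_iff)
    define \<alpha> where "\<alpha> = (\<lambda>n. norm (t ^ n *\<^sub>R a n))"
    have \<alpha>s: "summable \<alpha>" using sum_at[OF t] by (simp add: \<alpha>_def)
    have Bp: "B (p N) (p N) = (\<Sum>(i,j)\<in>{..<N} \<times> {..<N}. t ^ (i + j) *\<^sub>R B (a i) (a j))" for N
    proof -
      have "B (p N) (p N) = (\<Sum>i<N. \<Sum>j<N. t ^ (i + j) *\<^sub>R B (a i) (a j))"
      proof -
        have "B (p N) (p N) = (\<Sum>i<N. B (t ^ i *\<^sub>R a i) (p N))"
          by (subst (1) p_def, rule B_sum_left) (auto intro: X_closure aX pX)
        also have "\<dots> = (\<Sum>i<N. \<Sum>j<N. B (t ^ i *\<^sub>R a i) (t ^ j *\<^sub>R a j))"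
          unfolding p_def by (intro sum.cong refl B_sum_right) (auto intro: X_closure aX)
        finally show ?thesis
          by (simp only: B_scale_left[OF aX X_closure(3)[OF aX]] B_scale_right[OF aX aX] scaleR_scaleR power_add)
      qed
      then show ?thesis by (simp add: sum.cartesian_product)
    qed
    have ct: "(\<Sum>n<N. t ^ n *\<^sub>R c n) = (\<Sum>(i,j)\<in>{(i,j). i + j < N}. t ^ (i + j) *\<^sub>R B (a i) (a j))" for N
      unfolding sum.triangle_reindex c_def by (simp add: scaleR_sum_right)
    have \<alpha>p: "(\<Sum>n<N. \<alpha> n) * (\<Sum>n<N. \<alpha> n) = (\<Sum>(i,j)\<in>{..<N} \<times> {..<N}. \<alpha> i * \<alpha> j)" for N
      by (simp add: sum_product sum.cartesian_product)
    have \<alpha>c: "(\<Sum>n<N. \<Sum>k\<le>n. \<alpha> k * \<alpha> (n - k)) = (\<Sum>(i,j)\<in>{(i,j). i + j < N}. \<alpha> i * \<alpha> j)" for N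
      unfolding sum.triangle_reindex ..
    have sub: "{(i,j). i + j < N} \<subseteq> {..<N} \<times> {..<N}" for N :: nat by auto
    have est: "norm (B (p N) (p N) - (\<Sum>n<N. t ^ n *\<^sub>R c n)) \<le>
        K * ((\<Sum>n<N. \<alpha> n) * (\<Sum>n<N. \<alpha> n) - (\<Sum>n<N. \<Sum>k\<le>n. \<alpha> k * \<alpha> (n - k)))" for N
    proof -
      let ?Q = "{..<N} \<times> {..<N} - {(i,j). i + j < N}"
      have "B (p N) (p N) - (\<Sum>n<N. t ^ n *\<^sub>R c n) = (\<Sum>(i,j)\<in>?Q. t ^ (i + j) *\<^sub>R B (a i) (a j))"
        unfolding Bp ct using sub by (subst sum_diff) auto
      also have "norm \<dots> \<le> (\<Sum>(i,j)\<in>?Q. K * (\<alpha> i * \<alpha> j))"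
      proof (rule sum_norm_le)
        fix x assume "x \<in> ?Q"
        obtain i j where x: "x = (i, j)" by (cases x)
        have "norm (B (t ^ i *\<^sub>R a i) (t ^ j *\<^sub>R a j)) \<le> K * \<alpha> i * \<alpha> j"
          unfolding \<alpha>_def by (intro B_bound X_closure aX)
        then show "norm (case x of (i, j) \<Rightarrow> t ^ (i + j) *\<^sub>R B (a i) (a j)) \<le> (case x of (i, j) \<Rightarrow> K * (\<alpha> i * \<alpha> j))"
          by (simp add: x B_scale_left B_scale_right X_closure aX power_add mult.assoc mult.commute[of "t ^ j"])
      qed
      also have "\<dots> = K * (\<Sum>(i,j)\<in>?Q. \<alpha> i * \<alpha> j)"
        by (simp add: sum_distrib_left case_prod_unfold)
      also have "(\<Sum>(i,j)\<in>?Q. \<alpha> i * \<alpha> j) = (\<Sum>n<N. \<alpha> n) * (\<Sum>n<N. \<alpha> n) - (\<Sum>n<N. \<Sum>k\<le>n. \<alpha> k * \<alpha> (n - k))"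
        unfolding \<alpha>p \<alpha>c using sub by (subst sum_diff) auto
      finally show ?thesis .
    qed
    have "(\<lambda>N. \<Sum>n<N. \<Sum>k\<le>n. \<alpha> k * \<alpha> (n - k)) \<longlonglongrightarrow> (\<Sum>n. \<alpha> n) * (\<Sum>n. \<alpha> n)"
      using Cauchy_product_sums[of \<alpha> \<alpha>] \<alpha>s by (simp add: sums_def \<alpha>_def)
    moreover have "(\<lambda>N. \<Sum>n<N. \<alpha> n) \<longlonglongrightarrow> (\<Sum>n. \<alpha> n)"
      using \<alpha>s by (rule summable_LIMSEQ)
    ultimately have "(\<lambda>N. K * ((\<Sum>n<N. \<alpha> n) * (\<Sum>n<N. \<alpha> n) - (\<Sum>n<N. \<Sum>k\<le>n. \<alpha> k * \<alpha> (n - k)))) \<longlonglongrightarrow>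
        K * ((\<Sum>n. \<alpha> n) * (\<Sum>n. \<alpha> n) - (\<Sum>n. \<alpha> n) * (\<Sum>n. \<alpha> n))"
      by (intro tendsto_intros)
    then have "(\<lambda>N. K * ((\<Sum>n<N. \<alpha> n) * (\<Sum>n<N. \<alpha> n) - (\<Sum>n<N. \<Sum>k\<le>n. \<alpha> k * \<alpha> (n - k)))) \<longlonglongrightarrow> 0" by simp
    then have "(\<lambda>N. B (p N) (p N) - (\<Sum>n<N. t ^ n *\<^sub>R c n)) \<longlonglongrightarrow> 0"
      by (rule Lim_null_comparison[rotated]) (intro always_eventually allI est)
    from tendsto_diff[OF 1 this] show ?thesis by simp
  qed
  have "uniform_limit {0..T} (\<lambda>N t. \<Sum>n<N. t ^ n *\<^sub>R c n) (\<lambda>t. \<Sum>n. t ^ n *\<^sub>R c n) sequentially"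
  proof (rule Weierstrass_m_test[where M = "\<lambda>n. K * ?R ^ 2 * (real (Suc n) * q ^ n)"])
    show "summable (\<lambda>n. K * ?R ^ 2 * (real (Suc n) * q ^ n))"
    proof (intro summable_mult)
      have "(\<lambda>n. of_nat (Suc n) * q ^ n) sums (1 / (1 - q)\<^sup>2)"
        using q by (intro geometric_deriv_sums) simp
      then show "summable (\<lambda>n. real (Suc n) * q ^ n)" by (simp add: sums_iff)
    qed
  qed (rule normct)
  moreover have "(\<Sum>n. t ^ n *\<^sub>R c n) = B (y t) (y t)" if "t \<in> {0..T}" for t
    using lim_c[OF that] by (simp add: sums_def[symmetric] sums_iff)
  ultimately have ul: "uniform_limit {0..T} (\<lambda>N t. \<Sum>n<N. t ^ n *\<^sub>R c n) (\<lambda>t. B (y t) (y t)) sequentially"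
    by (subst (asm) uniform_limit_cong'[where g = "\<lambda>N t. \<Sum>n<N. t ^ n *\<^sub>R c n" and i = "\<lambda>t. B (y t) (y t)"]) auto
  have sum_f': "(\<Sum>n<Suc N. f' n t) = (\<Sum>n<N. t ^ n *\<^sub>R c n)" for N t
    unfolding sum.lessThan_Suc_shift f'_Suc by (simp add: f'_def)
  have "\<exists>g. \<forall>t\<in>{0..T}. (\<lambda>n. t ^ n *\<^sub>R a n) sums g t \<and> (g has_derivative (\<lambda>h. h *\<^sub>R B (y t) (y t))) (at t within {0..T})"
  proof (rule has_derivative_series[where f' = "\<lambda>n t h. h *\<^sub>R f' n t"])
    show "((\<lambda>t. t ^ n *\<^sub>R a n) has_derivative (\<lambda>h. h *\<^sub>R f' n t)) (at t within {0..T})" for n t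
      unfolding f'_def by (cases n) (auto intro!: derivative_eq_intros simp: algebra_simps simp del: power_Suc)
    show "0 \<in> {0..T}" using T by simp
    show "(\<lambda>n. 0 ^ n *\<^sub>R a n) sums y 0" using y_sums[of 0] T by simp
    fix e :: real assume "e > 0"
    then have "\<forall>\<^sub>F N in sequentially. \<forall>t\<in>{0..T}. norm ((\<Sum>n<N. t ^ n *\<^sub>R c n) - B (y t) (y t)) < e"
      using ul unfolding uniform_limit_iff dist_norm by auto
    then have "\<forall>\<^sub>F N in sequentially. \<forall>t\<in>{0..T}. norm ((\<Sum>n<Suc N. f' n t) - B (y t) (y t)) < e"
      by (simp only: sum_f')
    then have "\<forall>\<^sub>F N in sequentially. \<forall>t\<in>{0..T}. norm ((\<Sum>n<N. f' n t) - B (y t) (y t)) < e"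
      by (subst (asm) eventually_sequentially_Suc)
    then show "\<forall>\<^sub>F N in sequentially. \<forall>t\<in>{0..T}. \<forall>h. norm ((\<Sum>n<N. h *\<^sub>R f' n t) - h *\<^sub>R B (y t) (y t)) \<le> e * norm h"
    proof eventually_elim
      case (elim N)
      show ?case
      proof (intro ballI allI)
        fix t h assume t: "t \<in> {0..T}"
        have "norm ((\<Sum>n<N. h *\<^sub>R f' n t) - h *\<^sub>R B (y t) (y t)) = \<bar>h\<bar> * norm ((\<Sum>n<N. f' n t) - B (y t) (y t))"
          by (simp flip: scaleR_sum_right scaleR_diff_right)
        also have "\<dots> \<le> \<bar>h\<bar> * e" using elim t by (intro mult_left_mono) (auto intro: less_imp_le)
        finally show "norm ((\<Sum>n<N. h *\<^sub>R f' n t) - h *\<^sub>R B (y t) (y t)) \<le> e * norm h" by (simp add: mult.commute)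
      qed
    qed
  qed auto
  then obtain g where g: "\<And>t. t \<in> {0..T} \<Longrightarrow> (\<lambda>n. t ^ n *\<^sub>R a n) sums g t"
    "\<And>t. t \<in> {0..T} \<Longrightarrow> (g has_vector_derivative B (y t) (y t)) (at t within {0..T})"
    unfolding has_vector_derivative_def by blast
  have gy: "g t = y t" if "t \<in> {0..T}" for t
    using g(1)[OF that] y_sums[OF that] by (rule sums_unique2)
  have "solves g T" unfolding solves_def using g(2) gy yX by auto
  moreover have "g 0 = y0"
  proof -
    have "(\<lambda>n. 0 ^ n *\<^sub>R a n) sums a 0"
      using powser_sums_zero[of "\<lambda>n. 1::real"] sums_single[of 0 "\<lambda>n. a n"]
      by (rule_tac sums_cong[THEN iffD1, of "\<lambda>n. if n = 0 then a n else 0"]) auto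
    with g(1)[of 0] T have "g 0 = a 0" by (auto intro: sums_unique2)
    then show ?thesis by (simp add: a_def)
  qed
  ultimately show ?thesis by blast
qed


subsection \<open>Maximal solutions\<close>

definition solves_below :: "(real \<Rightarrow> 'a) \<Rightarrow> ereal \<Rightarrow> bool" where
  "solves_below y T \<longleftrightarrow> (\<forall>T'. 0 < T' \<and> ereal T' < T \<longrightarrow> solves y T')"

text \<open>The supremum is formed exactly like the maximal time of the stretching equation, so that the two
  coincide once their solutions are identified.\<close>

definition lifespan :: "'a \<Rightarrow> ereal" where
  "lifespan y0 = Sup {T. 0 < T \<and> (\<exists>y. y 0 = y0 \<and> solves_below y T)}"

lemma solves_imp_below: "solves y T \<Longrightarrow> solves_below y (ereal T)"
  unfolding solves_below_def by (auto intro: solves_mono)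

lemma solves_le_lifespan:
  assumes "0 < T" "solves y T"
  shows "ereal T \<le> lifespan (y 0)"
  unfolding lifespan_def using assms by (intro Sup_upper) (auto intro: solves_imp_below)

lemma lifespan_lower:
  assumes "y0 \<in> X" "0 < T" "T * K * norm y0 < 1"
  shows "ereal T \<le> lifespan y0"
  using local_existence[OF assms] solves_le_lifespan[OF assms(2)] by metis

lemma lifespan_ge:
  assumes "y0 \<in> X"
  shows "1 / ereal (2 * K * norm y0) \<le> lifespan y0"
proof (cases "norm y0 = 0")
  case True
  have "ereal (max 1 B) \<le> lifespan y0" for B
    using assms True by (intro lifespan_lower) auto
  then have "ereal B \<le> lifespan y0" for B
    by (metis ereal_less_eq(3) max.cobounded2 order_trans)
  then have "lifespan y0 = \<infinity>" by (rule ereal_top)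
  then show ?thesis by simp
next
  case False
  then have pos: "0 < 2 * K * norm y0" using K_pos by simp
  have "ereal (1 / (2 * K * norm y0)) \<le> lifespan y0"
    using pos False K_pos assms by (intro lifespan_lower) auto
  then show ?thesis using pos False K_pos by (auto simp: one_ereal_def)
qed

lemma lifespan_pos:
  assumes "y0 \<in> X"
  shows "0 < lifespan y0"
proof -
  have "0 < 1 / (K * (norm y0 + 1))" using K_pos by (simp add: add_nonneg_pos)
  moreover have "1 / (K * (norm y0 + 1)) * K * norm y0 < 1"
    using K_pos norm_ge_zero[of y0] by (simp add: divide_simps add_nonneg_pos)
  ultimately have "ereal (1 / (K * (norm y0 + 1))) \<le> lifespan y0"
    by (rule lifespan_lower[OF assms])
  with \<open>0 < 1 / (K * (norm y0 + 1))\<close> show ?thesis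
    by (metis ereal_less(2) less_le_trans)
qed

lemma solves_shift:
  assumes y: "solves y T" and t: "0 \<le> t" "t \<le> T"
  shows "solves (\<lambda>\<tau>. y (t + \<tau>)) (T - t)"
  unfolding solves_def
proof (intro ballI conjI)
  fix \<tau> assume \<tau>: "\<tau> \<in> {0..T - t}"
  then have *: "t + \<tau> \<in> {0..T}" using t by auto
  then show "y (t + \<tau>) \<in> X" using y by (auto simp: solves_def)
  have "(y has_vector_derivative B (y (t + \<tau>)) (y (t + \<tau>))) (at (t + \<tau>) within {0..T})"
    using y * by (auto simp: solves_def)
  then have "(y has_vector_derivative B (y (t + \<tau>)) (y (t + \<tau>))) (at (t + \<tau>) within ((+) t) ` {0..T - t})"
    by (rule has_vector_derivative_within_subset) (use t in auto)
  moreover have "((+) t has_vector_derivative 1) (at \<tau> within {0..T - t})"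
    by (auto intro!: derivative_eq_intros)
  ultimately have "(y \<circ> (+) t has_vector_derivative 1 *\<^sub>R B (y (t + \<tau>)) (y (t + \<tau>))) (at \<tau> within {0..T - t})"
    by (intro vector_diff_chain_within)
  then show "((\<lambda>\<tau>. y (t + \<tau>)) has_vector_derivative B (y (t + \<tau>)) (y (t + \<tau>))) (at \<tau> within {0..T - t})"
    by (simp add: o_def)
qed

text \<open>By uniqueness the two pieces agree on their overlap, which has positive length because \<open>t < T\<close>.  So
  near every time the glued curve coincides with one piece, and no one-sided derivatives have to be
  matched at \<open>t\<close>.\<close>

lemma solves_glue:
  assumes y: "solves y T" and z: "solves z d" and t: "0 \<le> t" "t < T"
    and init: "z 0 = y t"
  shows "\<exists>w. w 0 = y 0 \<and> solves w (t + d)"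
proof (cases "t + d \<le> T")
  case True
  then show ?thesis using solves_mono[OF y] by blast
next
  case False
  have agree: "z \<tau> = y (t + \<tau>)" if "\<tau> \<in> {0..T - t}" for \<tau>
    using solves_unique[OF solves_mono[OF z, of "T - t"] solves_shift[OF y t(1)]] that t init False by auto
  define w where "w = (\<lambda>\<tau>. if \<tau> \<le> t then y \<tau> else z (\<tau> - t))"
  have wy: "w \<tau> = y \<tau>" if "\<tau> \<in> {0..T}" for \<tau>
    using agree[of "\<tau> - t"] that by (auto simp: w_def)
  have wz: "w \<tau> = z (\<tau> - t)" if "\<tau> \<in> {t..t+d}" for \<tau>
    using that init by (auto simp: w_def)
  have "solves w (t + d)"
    unfolding solves_def
  proof
    fix \<tau> assume \<tau>: "\<tau> \<in> {0..t+d}"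
    show "w \<tau> \<in> X \<and> (w has_vector_derivative B (w \<tau>) (w \<tau>)) (at \<tau> within {0..t+d})"
    proof (cases "\<tau> < T")
      case True
      have "at \<tau> within {0..t+d} = at \<tau> within {0..T}"
        using True False by (intro at_within_nhd[where S = "{..<T}"]) auto
      then show ?thesis
        using solves_cong[OF y wy] \<tau> True by (auto simp: solves_def)
    next
      case ge: False
      have eq: "at \<tau> within {0..t+d} = at \<tau> within {t..t+d}"
        using ge t by (intro at_within_nhd[where S = "{t<..}"]) auto
      have tt: "\<tau> - t \<in> {0..d}" "\<tau> \<in> {t..t+d}" using \<tau> ge t by auto
      then have "(z has_vector_derivative B (z (\<tau> - t)) (z (\<tau> - t))) (at (\<tau> - t) within {0..d})" "z (\<tau> - t) \<in> X"
        using z by (auto simp: solves_def)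
      moreover have "(\<lambda>x. x - t) ` {t..t+d} = {0..d}"
        using False t by (auto simp: image_iff intro!: bexI[of _ "t + x" for x])
      moreover have "((\<lambda>x. x - t) has_vector_derivative 1) (at \<tau> within {t..t+d})"
        by (auto intro!: derivative_eq_intros)
      ultimately have "(z \<circ> (\<lambda>x. x - t) has_vector_derivative 1 *\<^sub>R B (z (\<tau> - t)) (z (\<tau> - t))) (at \<tau> within {t..t+d})"
        by (intro vector_diff_chain_within) auto
      then have "(w has_vector_derivative B (z (\<tau> - t)) (z (\<tau> - t))) (at \<tau> within {t..t+d})"
        by (intro has_vector_derivative_transform[OF tt(2) wz]) (auto simp: o_def)
      then show ?thesis
        using eq wz[OF tt(2)] \<open>z (\<tau> - t) \<in> X\<close> by auto
    qed
  qed
  then show ?thesis using wy[of 0] t by auto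
qed

text \<open>Local solutions on different intervals agree by uniqueness, so evaluating at each time any solution
  that reaches it defines a maximal one.  It cannot have a small norm shortly before a finite lifespan,
  because restarting would prolong it.\<close>

theorem maximal_solution:
  assumes y0: "y0 \<in> X"
  shows "\<exists>y. y 0 = y0 \<and> solves_below y (lifespan y0) \<and>
    (lifespan y0 < \<infinity> \<longrightarrow> (\<forall>t. 0 \<le> t \<and> ereal t < lifespan y0 \<longrightarrow>
       1 / (2 * K * (real_of_ereal (lifespan y0) - t)) \<le> norm (y t)))"
proof -
  have ex: "\<exists>z. z 0 = y0 \<and> solves z T" if T: "0 < T" "ereal T < lifespan y0" for T
    using T(2) T(1) unfolding lifespan_def less_Sup_iff solves_below_def by blast
  define y where "y = (\<lambda>t. if t = 0 then y0 else (SOME z. z 0 = y0 \<and> solves z t) t)"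
  have y_eq: "y t = z t" if "solves z T" "z 0 = y0" "t \<in> {0..T}" for z T t
  proof (cases "t = 0")
    case False
    define z' where "z' = (SOME z. z 0 = y0 \<and> solves z t)"
    have st: "solves z t" using that solves_mono by auto
    then have "z' 0 = y0 \<and> solves z' t"
      unfolding z'_def using that by (intro someI[of "\<lambda>z. z 0 = y0 \<and> solves z t" z] conjI)
    then have "z' t = z t"
      using solves_unique[OF _ st, of z' t] that by simp
    then show ?thesis using False by (simp add: y_def z'_def)
  qed (use that in \<open>auto simp: y_def\<close>)
  have y: "solves y T" if T: "0 < T" "ereal T < lifespan y0" for T
  proof -
    obtain z where z: "z 0 = y0" "solves z T" using ex[OF T] by blast
    show ?thesis by (rule solves_cong[OF z(2) y_eq[OF z(2) z(1)]])
  qed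
  have "1 / (2 * K * (real_of_ereal (lifespan y0) - t)) \<le> norm (y t)"
    if fin: "lifespan y0 < \<infinity>" and t: "0 \<le> t" "ereal t < lifespan y0" for t
  proof (rule ccontr)
    assume neg: "\<not> ?thesis"
    obtain L where L: "lifespan y0 = ereal L"
      using fin lifespan_pos[OF y0] by (cases "lifespan y0") auto
    have tL: "t < L" using t L by simp
    define T where "T = (t + L) / 2"
    have T: "0 < T" "t < T" "ereal T < lifespan y0" using t tL L by (auto simp: T_def)
    have yT: "solves y T" using y T by simp
    have yt: "y t \<in> X" using yT t T by (auto simp: solves_def)
    \<comment> \<open>Exactly twice the remaining time: the negated bound makes \<open>d * K * norm (y t) < 1\<close>.\<close>
    define d where "d = 2 * (L - t)"
    have d: "0 < d" using tL by (simp add: d_def)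
    have "norm (y t) < 1 / (K * d)" using neg by (simp add: L d_def mult.assoc mult.left_commute)
    then have "d * K * norm (y t) < 1" using d K_pos by (simp add: field_simps)
    then obtain z where z: "z 0 = y t" "solves z d" using local_existence[OF yt d] by blast
    from solves_glue[OF yT z(2) t(1) T(2) z(1)] obtain w where "w 0 = y 0" "solves w (t + d)" by blast
    then have "ereal (t + d) \<le> lifespan y0"
      using solves_le_lifespan[of "t + d" w] d t by (simp add: y_def)
    then show False using tL by (simp add: L d_def)
  qed
  moreover have "y 0 = y0" by (simp add: y_def)
  ultimately show ?thesis using y unfolding solves_below_def by blast
qed

end

section \<open>The Hilbert space of square integrable functions\<close>

lemma square_integrableI:
  "f \<in> borel_measurable borel \<Longrightarrow> integrable lborel (\<lambda>x. (norm (f x))\<^sup>2) \<Longrightarrow> square_integrable f"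
  by (simp add: square_integrable_def)

lemma square_integrable_measurable: "square_integrable f \<Longrightarrow> f \<in> borel_measurable borel"
  by (simp add: square_integrable_def)

lemma square_integrable_norm2: "square_integrable f \<Longrightarrow> integrable lborel (\<lambda>x. (norm (f x))\<^sup>2)"
  by (simp add: square_integrable_def)

lemma square_integrable_bound:
  assumes f: "square_integrable f" and g: "g \<in> borel_measurable borel"
    and le: "AE x in lborel. norm (g x) \<le> c * norm (f x)"
  shows "square_integrable g"
proof (rule square_integrableI[OF g])
  have "AE x in lborel. norm ((norm (g x))\<^sup>2) \<le> norm (c\<^sup>2 * (norm (f x))\<^sup>2)"
    using le
  proof eventually_elim
    case (elim x)
    then have "(norm (g x))\<^sup>2 \<le> (c * norm (f x))\<^sup>2" by (intro power_mono) auto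
    then show ?case by (simp add: power_mult_distrib)
  qed
  then show "integrable lborel (\<lambda>x. (norm (g x))\<^sup>2)"
    using g by (intro Bochner_Integration.integrable_bound[OF integrable_mult_right[OF square_integrable_norm2[OF f], of "c\<^sup>2"]]) auto
qed

lemma square_integrable_norm_mult:
  assumes f: "square_integrable f" and g: "square_integrable g"
  shows "integrable lborel (\<lambda>x. norm (f x) * norm (g x))"
proof (rule Bochner_Integration.integrable_bound)
  show "integrable lborel (\<lambda>x. (norm (f x))\<^sup>2 + (norm (g x))\<^sup>2)"
    using f g by (intro Bochner_Integration.integrable_add square_integrable_norm2)
  show "(\<lambda>x. norm (f x) * norm (g x)) \<in> borel_measurable lborel"
    using f g by (auto dest!: square_integrable_measurable)
  have "a * b \<le> a\<^sup>2 + b\<^sup>2" for a b :: real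
    using sum_squares_bound[of a b] zero_le_power2[of a] zero_le_power2[of b] by linarith
  then show "AE x in lborel. norm (norm (f x) * norm (g x)) \<le> norm ((norm (f x))\<^sup>2 + (norm (g x))\<^sup>2)"
    by (simp add: abs_mult)
qed

lemma square_integrable_inner:
  assumes f: "square_integrable f" and g: "square_integrable g"
  shows "integrable lborel (\<lambda>x. f x \<bullet> g x)"
  by (rule Bochner_Integration.integrable_bound[OF square_integrable_norm_mult[OF f g]])
     (use f g in \<open>auto dest!: square_integrable_measurable simp: Cauchy_Schwarz_ineq2\<close>)

lemma square_integrable_zero [simp]: "square_integrable (\<lambda>x. 0)"
  by (simp add: square_integrable_def)

lemma square_integrable_add:
  assumes f: "square_integrable f" and g: "square_integrable g"
  shows "square_integrable (\<lambda>x. f x + g x)"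
proof (rule square_integrableI)
  show "(\<lambda>x. f x + g x) \<in> borel_measurable borel"
    using f g by (auto dest!: square_integrable_measurable)
  have "integrable lborel (\<lambda>x. (norm (f x))\<^sup>2 + 2 * (f x \<bullet> g x) + (norm (g x))\<^sup>2)"
    by (intro Bochner_Integration.integrable_add integrable_mult_right square_integrable_norm2
        square_integrable_inner f g)
  then show "integrable lborel (\<lambda>x. (norm (f x + g x))\<^sup>2)"
    by (simp add: power2_norm_eq_inner inner_add inner_commute algebra_simps)
qed

lemma square_integrable_scaleR:
  "square_integrable f \<Longrightarrow> square_integrable (\<lambda>x. c *\<^sub>R f x)"
  by (rule square_integrable_bound[where c = "\<bar>c\<bar>"]) (auto dest: square_integrable_measurable)

lemma square_integrable_minus: "square_integrable f \<Longrightarrow> square_integrable (\<lambda>x. - f x)"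
  using square_integrable_scaleR[of f "-1"] by simp

lemma square_integrable_diff:
  "square_integrable f \<Longrightarrow> square_integrable g \<Longrightarrow> square_integrable (\<lambda>x. f x - g x)"
  using square_integrable_add[OF _ square_integrable_minus, of f g] by simp

lemma square_integrable_cong_AE:
  assumes "square_integrable f" "g \<in> borel_measurable borel" "AE x in lborel. f x = g x"
  shows "square_integrable g"
  by (rule square_integrable_bound[OF assms(1,2), of 1]) (use assms(3) in auto)

text \<open>Functions modulo equality almost everywhere are turned into a type, so that the theory of curves
  in Banach spaces becomes available for them.\<close>

definition l2rel :: "(real^3 \<Rightarrow> 'b::euclidean_space) \<Rightarrow> (real^3 \<Rightarrow> 'b) \<Rightarrow> bool" where
  "l2rel f g \<longleftrightarrow> square_integrable f \<and> square_integrable g \<and> (AE x in lborel. f x = g x)"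

quotient_type (overloaded) 'b l2 = "real^3 \<Rightarrow> 'b::euclidean_space" / partial: l2rel
proof (rule part_equivpI)
  show "\<exists>x. l2rel x x" by (rule exI[of _ "\<lambda>x. 0"]) (simp add: l2rel_def)
  show "symp l2rel" by (auto simp: symp_def l2rel_def elim: eventually_mono)
  show "transp l2rel" unfolding transp_def l2rel_def by (auto elim: eventually_elim2)
qed

lemma l2rel_self: "l2rel f f \<longleftrightarrow> square_integrable f"
  by (simp add: l2rel_def)

instantiation l2 :: (euclidean_space) real_vector
begin

lift_definition zero_l2 :: "'a l2" is "\<lambda>x. 0" by (simp add: l2rel_def)
lift_definition plus_l2 :: "'a l2 \<Rightarrow> 'a l2 \<Rightarrow> 'a l2" is "\<lambda>f g x. f x + g x"
  unfolding l2rel_def by (auto intro: square_integrable_add elim: eventually_elim2)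
lift_definition minus_l2 :: "'a l2 \<Rightarrow> 'a l2 \<Rightarrow> 'a l2" is "\<lambda>f g x. f x - g x"
  unfolding l2rel_def by (auto intro: square_integrable_diff elim: eventually_elim2)
lift_definition uminus_l2 :: "'a l2 \<Rightarrow> 'a l2" is "\<lambda>f x. - f x"
  unfolding l2rel_def by (auto intro: square_integrable_minus elim: eventually_mono)
lift_definition scaleR_l2 :: "real \<Rightarrow> 'a l2 \<Rightarrow> 'a l2" is "\<lambda>c f x. c *\<^sub>R f x"
  unfolding l2rel_def by (auto intro: square_integrable_scaleR elim: eventually_mono)

instance
proof
  fix a b c :: "'a l2" and x y :: real
  note sq = square_integrable_add square_integrable_diff square_integrable_minus square_integrable_scaleR
  show "a + b + c = a + (b + c)"
    by transfer (auto simp: l2rel_def add.assoc intro!: sq)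
  show "a + b = b + a"
    by transfer (auto simp: l2rel_def add.commute intro!: sq)
  show "0 + a = a" by transfer (auto simp: l2rel_def)
  show "- a + a = 0" by transfer (auto simp: l2rel_def)
  show "a - b = a + - b" by transfer (auto simp: l2rel_def intro!: sq)
  show "x *\<^sub>R (a + b) = x *\<^sub>R a + x *\<^sub>R b"
    by transfer (auto simp: l2rel_def scaleR_add_right intro!: sq)
  show "(x + y) *\<^sub>R a = x *\<^sub>R a + y *\<^sub>R a"
    by transfer (auto simp: l2rel_def scaleR_add_left intro!: sq)
  show "x *\<^sub>R y *\<^sub>R a = (x * y) *\<^sub>R a" by transfer (auto simp: l2rel_def intro!: sq)
  show "1 *\<^sub>R a = a" by transfer (auto simp: l2rel_def)
qed

end

instantiation l2 :: (euclidean_space) real_inner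
begin

lift_definition inner_l2 :: "'a l2 \<Rightarrow> 'a l2 \<Rightarrow> real" is "\<lambda>f g. LINT x|lborel. f x \<bullet> g x"
proof -
  fix f f' g g' :: "real^3 \<Rightarrow> 'a" assume "l2rel f f'" "l2rel g g'"
  then show "(LINT x|lborel. f x \<bullet> g x) = (LINT x|lborel. f' x \<bullet> g' x)"
    unfolding l2rel_def
    by (intro integral_cong_AE) (auto dest!: square_integrable_measurable elim: eventually_elim2)
qed

definition norm_l2 :: "'a l2 \<Rightarrow> real" where "norm_l2 x = sqrt (inner x x)"
definition dist_l2 :: "'a l2 \<Rightarrow> 'a l2 \<Rightarrow> real" where "dist_l2 x y = norm (x - y)"
definition sgn_l2 :: "'a l2 \<Rightarrow> 'a l2" where "sgn_l2 x = inverse (norm x) *\<^sub>R x"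
definition [code del]: "(uniformity :: ('a l2 \<times> 'a l2) filter) = (INF e\<in>{0 <..}. principal {(x, y). dist x y < e})"
definition open_l2 :: "'a l2 set \<Rightarrow> bool" where
  "open_l2 U = (\<forall>x\<in>U. eventually (\<lambda>(x', y). x' = x \<longrightarrow> y \<in> U) uniformity)"

instance
proof
  fix a b c :: "'a l2" and r :: real
  show "dist a b = norm (a - b)" by (simp add: dist_l2_def)
  show "sgn a = a /\<^sub>R norm a" by (simp add: sgn_l2_def)
  show "(uniformity :: ('a l2 \<times> 'a l2) filter) = (INF e\<in>{0 <..}. principal {(x, y). dist x y < e})"
    by (rule uniformity_l2_def)
  show "open U \<longleftrightarrow> (\<forall>x\<in>U. eventually (\<lambda>(x', y). x' = x \<longrightarrow> y \<in> U) uniformity)" for U :: "'a l2 set"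
    by (rule open_l2_def)
  show "norm a = sqrt (inner a a)" by (simp add: norm_l2_def)
  show "inner a b = inner b a" by transfer (simp add: inner_commute)
  show "inner (a + b) c = inner a c + inner b c"
    by transfer (simp add: inner_add_left l2rel_self square_integrable_inner)
  show "inner (r *\<^sub>R a) b = r * inner a b"
    by transfer (simp add: l2rel_self)
  show "0 \<le> inner a a" by transfer simp
  show "inner a a = 0 \<longleftrightarrow> a = 0"
  proof (transfer, unfold l2rel_self)
    fix f :: "real^3 \<Rightarrow> 'a" assume f: "square_integrable f"
    show "(LINT x|lborel. f x \<bullet> f x) = 0 \<longleftrightarrow> l2rel f (\<lambda>x. 0)"
      using f square_integrable_inner[OF f f]
      by (subst integral_nonneg_eq_0_iff_AE) (auto simp: l2rel_def)
  qed
qed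

end

text \<open>The value is arbitrary if the function is not square integrable.\<close>

definition cls :: "(real^3 \<Rightarrow> 'b::euclidean_space) \<Rightarrow> 'b l2" where "cls f = abs_l2 f"

lemma cls_cases:
  obtains f where "square_integrable f" "x = cls f"
proof -
  have "l2rel (rep_l2 x) (rep_l2 x)" by (metis Quotient3_def Quotient3_l2)
  moreover have "abs_l2 (rep_l2 x) = x" by (metis Quotient3_def Quotient3_l2)
  ultimately show ?thesis by (intro that[of "rep_l2 x"]) (auto simp: l2rel_self cls_def)
qed

lemma cls_eq_iff:
  assumes "square_integrable f" "square_integrable g"
  shows "cls f = cls g \<longleftrightarrow> (AE x in lborel. f x = g x)"
  using Quotient3_rel[OF Quotient3_l2, of f g] assms by (auto simp: l2rel_def cls_def)

lemma cls_zero: "cls (\<lambda>x. 0) = 0"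
  by (simp add: cls_def zero_l2.abs_eq)

lemma cls_add: "square_integrable f \<Longrightarrow> square_integrable g \<Longrightarrow> cls (\<lambda>x. f x + g x) = cls f + cls g"
  by (simp add: cls_def plus_l2.abs_eq l2rel_self)

lemma cls_diff: "square_integrable f \<Longrightarrow> square_integrable g \<Longrightarrow> cls (\<lambda>x. f x - g x) = cls f - cls g"
  by (simp add: cls_def minus_l2.abs_eq l2rel_self)

lemma cls_scaleR: "square_integrable f \<Longrightarrow> cls (\<lambda>x. c *\<^sub>R f x) = c *\<^sub>R cls f"
  by (simp add: cls_def scaleR_l2.abs_eq l2rel_self)

lemma inner_cls: "square_integrable f \<Longrightarrow> square_integrable g \<Longrightarrow> cls f \<bullet> cls g = (LINT x|lborel. f x \<bullet> g x)"
  by (simp add: cls_def inner_l2.abs_eq l2rel_self)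

lemma norm_cls2: "square_integrable f \<Longrightarrow> (norm (cls f))\<^sup>2 = (LINT x|lborel. (norm (f x))\<^sup>2)"
  by (simp add: power2_norm_eq_inner inner_cls)

lemma nn_integral_norm_cls:
  "square_integrable f \<Longrightarrow> (\<integral>\<^sup>+x. ennreal ((norm (f x))\<^sup>2) \<partial>lborel) = ennreal ((norm (cls f))\<^sup>2)"
  by (simp add: norm_cls2 nn_integral_eq_integral square_integrable_norm2)

lemma norm_cls_le:
  assumes f: "square_integrable f" and g: "square_integrable g" and c: "0 \<le> c"
    and le: "AE x in lborel. norm (f x) \<le> c * norm (g x)"
  shows "norm (cls f) \<le> c * norm (cls g)"
proof -
  have "(norm (cls f))\<^sup>2 \<le> (LINT x|lborel. c\<^sup>2 * (norm (g x))\<^sup>2)"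
    unfolding norm_cls2[OF f]
  proof (rule integral_mono_AE)
    show "AE x in lborel. (norm (f x))\<^sup>2 \<le> c\<^sup>2 * (norm (g x))\<^sup>2"
      using le by eventually_elim (metis norm_ge_zero power_mono power_mult_distrib)
    show "integrable lborel (\<lambda>x. c\<^sup>2 * (norm (g x))\<^sup>2)"
      by (intro integrable_mult_right square_integrable_norm2 g)
  qed (rule square_integrable_norm2[OF f])
  also have "\<dots> = (c * norm (cls g))\<^sup>2"
    by (simp add: norm_cls2[OF g] power_mult_distrib)
  finally show ?thesis by (rule power2_le_imp_le) (intro mult_nonneg_nonneg c norm_ge_zero)
qed

lemma norm_cls_mono:
  assumes "square_integrable f" "square_integrable g"
    and "AE x in lborel. norm (f x) \<le> norm (g x)"
  shows "norm (cls f) \<le> norm (cls g)"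
  using norm_cls_le[OF assms(1,2), of 1] assms(3) by simp

lemma norm_cls_cong:
  assumes "square_integrable f" "square_integrable g"
    and "AE x in lborel. norm (f x) = norm (g x)"
  shows "norm (cls f) = norm (cls g)"
proof (rule antisym)
  have le: "AE x in lborel. norm (f x) \<le> norm (g x)" "AE x in lborel. norm (g x) \<le> norm (f x)"
    using assms(3) by (eventually_elim, simp)+
  show "norm (cls f) \<le> norm (cls g)"
    by (rule norm_cls_mono[OF assms(1,2) le(1)])
  show "norm (cls g) \<le> norm (cls f)"
    by (rule norm_cls_mono[OF assms(2,1) le(2)])
qed

text \<open>The function \<open>G = \<Sum>\<^sub>k 4\<^sup>k |f\<^sub>k\<^sub>+\<^sub>1 - f\<^sub>k|\<^sup>2\<close> has integral at most \<open>\<Sum>\<^sub>k (1/2)\<^sup>k\<close>, so it is finite almost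
  everywhere, and where it is finite the increments are at most \<open>sqrt G (1/2)\<^sup>k\<close>.\<close>

lemma fast_Cauchy_AE_convergent:
  fixes f :: "nat \<Rightarrow> real^3 \<Rightarrow> 'b::euclidean_space"
  assumes f: "\<And>n. square_integrable (f n)"
    and fast: "\<And>k. (norm (cls (f (Suc k)) - cls (f k)))\<^sup>2 \<le> (1/8)^k"
  shows "AE x in lborel. convergent (\<lambda>n. f n x)"
proof -
  have [measurable]: "f n \<in> borel_measurable borel" for n
    using f by (rule square_integrable_measurable)
  let ?h = "\<lambda>k x. ennreal (4^k * (norm (f (Suc k) x - f k x))\<^sup>2)"
  have "(\<integral>\<^sup>+x. (\<Sum>k. ?h k x) \<partial>lborel) = (\<Sum>k. \<integral>\<^sup>+x. ?h k x \<partial>lborel)"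
    by (rule nn_integral_suminf) measurable
  also have "\<dots> \<le> (\<Sum>k. ennreal ((1/2)^k))"
  proof (intro suminf_le)
    fix k
    have "(\<integral>\<^sup>+x. ?h k x \<partial>lborel) = ennreal (4^k) * (\<integral>\<^sup>+x. ennreal ((norm (f (Suc k) x - f k x))\<^sup>2) \<partial>lborel)"
      by (simp add: ennreal_mult nn_integral_cmult)
    also have "\<dots> = ennreal (4^k) * ennreal ((norm (cls (f (Suc k)) - cls (f k)))\<^sup>2)"
      by (subst nn_integral_norm_cls) (auto intro: square_integrable_diff f simp: cls_diff f)
    also have "\<dots> = ennreal (4^k * (norm (cls (f (Suc k)) - cls (f k)))\<^sup>2)"
      by (simp add: ennreal_mult)
    also have "\<dots> \<le> ennreal (4^k * (1/8)^k)"
      by (intro ennreal_leI mult_left_mono fast) auto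
    finally show "(\<integral>\<^sup>+x. ?h k x \<partial>lborel) \<le> ennreal ((1/2)^k)"
      using power_mult_distrib[of "4::real" "1/8" k] by simp
  qed auto
  also have "\<dots> < \<infinity>"
    by (subst suminf_ennreal2) (auto simp: summable_geometric)
  finally have fin: "(\<integral>\<^sup>+x. (\<Sum>k. ?h k x) \<partial>lborel) < \<infinity>" .
  have meas: "(\<lambda>x. \<Sum>k. ?h k x) \<in> borel_measurable lborel"
    by (rule borel_measurable_suminf_order) measurable
  note nn_integral_PInf_AE[OF meas less_imp_neq[OF fin]]
  then show ?thesis
  proof eventually_elim
    case (elim x)
    define G where "G = enn2real (\<Sum>k. ?h k x)"
    have G: "(\<Sum>k. ?h k x) = ennreal G" "0 \<le> G"
      using elim by (simp_all add: G_def ennreal_enn2real_if)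
    have "norm (f (Suc k) x - f k x) \<le> sqrt G * (1/2)^k" for k
    proof -
      have "sum (\<lambda>k. ?h k x) {k} \<le> (\<Sum>k. ?h k x)"
        by (rule sum_le_suminf) auto
      then have "ennreal (4^k * (norm (f (Suc k) x - f k x))\<^sup>2) \<le> ennreal G"
        unfolding G(1) by (simp only: sum.insert sum.empty finite.emptyI empty_iff not_False_eq_True add_0_right)
      then have "4^k * (norm (f (Suc k) x - f k x))\<^sup>2 \<le> G"
        using G(2) by (simp only: ennreal_le_iff)
      then have "(norm (f (Suc k) x - f k x))\<^sup>2 \<le> G * (1/4)^k"
        by (simp add: power_divide field_simps)
      also have "\<dots> = (sqrt G * (1/2)^k)\<^sup>2"
        using power_mult_distrib[of "1/2::real" "1/2" k]
        by (simp only: power_mult_distrib[of "sqrt G"] real_sqrt_pow2[OF G(2)] power2_eq_square) (simp add: G(2))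
      finally show ?thesis
        by (rule power2_le_imp_le) (simp add: G(2))
    qed
    then have "summable (\<lambda>k. norm (f (Suc k) x - f k x))"
      by (intro summable_comparison_test'[OF summable_mult[OF summable_geometric, of "1/2" "sqrt G"]]) auto
    then have "summable (\<lambda>k. f (Suc k) x - f k x)" by (rule summable_norm_cancel)
    then have "convergent (\<lambda>n. f n x - f 0 x)"
      by (simp add: summable_iff_convergent sum_lessThan_telescope[of "\<lambda>n. f n x"])
    then have "convergent (\<lambda>n. f n x - f 0 x + f 0 x)"
      by (intro convergent_add convergent_const)
    then show ?case by simp
  qed
qed

text \<open>A fast Cauchy subsequence converges almost everywhere, and Fatou's lemma shows that the pointwise
  limit is also the limit in mean.\<close>

instance l2 :: (euclidean_space) banach
proof
  fix X :: "nat \<Rightarrow> 'a l2" assume C: "Cauchy X"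
  have "\<exists>r. \<forall>k. (\<forall>m\<ge>r k. \<forall>n\<ge>r k. (norm (X m - X n))\<^sup>2 \<le> (1/8)^k) \<and> r k < r (Suc k)"
  proof (rule dependent_nat_choice)
    fix r k
    obtain N where N: "\<forall>m\<ge>N. \<forall>n\<ge>N. norm (X m - X n) < sqrt ((1/8)^Suc k)"
      using C unfolding Cauchy_iff by (metis real_sqrt_gt_0_iff zero_less_divide_1_iff zero_less_numeral zero_less_power)
    show "\<exists>r'. (\<forall>m\<ge>r'. \<forall>n\<ge>r'. (norm (X m - X n))\<^sup>2 \<le> (1/8)^Suc k) \<and> r < r'"
    proof (intro exI[of _ "max N (Suc r)"] conjI allI impI)
      fix m n assume "max N (Suc r) \<le> m" "max N (Suc r) \<le> n"
      then have "norm (X m - X n) < sqrt ((1/8)^Suc k)" using N by simp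
      then have "(norm (X m - X n))\<^sup>2 \<le> (sqrt ((1/8)^Suc k))\<^sup>2" by (intro power_mono) auto
      then show "(norm (X m - X n))\<^sup>2 \<le> (1/8)^Suc k" by simp
    qed auto
  next
    obtain N where N: "\<forall>m\<ge>N. \<forall>n\<ge>N. norm (X m - X n) < 1"
      using C unfolding Cauchy_iff by (metis zero_less_one)
    show "\<exists>r. \<forall>m\<ge>r. \<forall>n\<ge>r. (norm (X m - X n))\<^sup>2 \<le> (1/8)^0"
    proof (intro exI[of _ N] allI impI)
      fix m n assume "N \<le> m" "N \<le> n"
      then have "norm (X m - X n) < 1" using N by simp
      then show "(norm (X m - X n))\<^sup>2 \<le> (1/8)^0" by (simp add: power_le_one)
    qed
  qed
  then obtain r where r: "\<And>k m n. m \<ge> r k \<Longrightarrow> n \<ge> r k \<Longrightarrow> (norm (X m - X n))\<^sup>2 \<le> (1/8)^k"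
    and r_less: "\<And>k. r k < r (Suc k)" by blast
  have mono: "strict_mono r" using r_less by (simp add: strict_mono_Suc_iff)
  have "\<exists>f. \<forall>n. square_integrable (f n) \<and> X (r n) = cls (f n)"
    by (rule choice) (metis cls_cases)
  then obtain f where f: "\<And>n. square_integrable (f n)" and Xf: "\<And>n. X (r n) = cls (f n)" by blast
  have [measurable]: "f n \<in> borel_measurable borel" for n
    using f by (rule square_integrable_measurable)
  have rbound: "(norm (cls (f m) - cls (f k)))\<^sup>2 \<le> (1/8)^k" if "k \<le> m" for k m
    unfolding Xf[symmetric] using that mono by (intro r) (auto simp: strict_mono_less_eq)
  define g where "g = (\<lambda>x. lim (\<lambda>n. f n x))"
  have g[measurable]: "g \<in> borel_measurable borel" unfolding g_def by measurable
  have conv: "AE x in lborel. (\<lambda>n. f n x) \<longlonglongrightarrow> g x"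
    using fast_Cauchy_AE_convergent[OF f rbound] by (simp add: g_def convergent_LIMSEQ_iff)
  have est: "(\<integral>\<^sup>+x. ennreal ((norm (f k x - g x))\<^sup>2) \<partial>lborel) \<le> ennreal ((1/8)^k)" for k
  proof -
    have "(\<integral>\<^sup>+x. ennreal ((norm (f k x - g x))\<^sup>2) \<partial>lborel)
        = (\<integral>\<^sup>+x. liminf (\<lambda>m. ennreal ((norm (f k x - f m x))\<^sup>2)) \<partial>lborel)"
    proof (rule nn_integral_cong_AE)
      show "AE x in lborel. ennreal ((norm (f k x - g x))\<^sup>2) = liminf (\<lambda>m. ennreal ((norm (f k x - f m x))\<^sup>2))"
        using conv
      proof eventually_elim
        case (elim x)
        then have "(\<lambda>m. ennreal ((norm (f k x - f m x))\<^sup>2)) \<longlonglongrightarrow> ennreal ((norm (f k x - g x))\<^sup>2)"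
          by (intro tendsto_intros)
        from lim_imp_Liminf[OF sequentially_bot this] show ?case ..
      qed
    qed
    also have "\<dots> \<le> liminf (\<lambda>m. \<integral>\<^sup>+x. ennreal ((norm (f k x - f m x))\<^sup>2) \<partial>lborel)"
      by (rule nn_integral_liminf) measurable
    also have "\<dots> \<le> ennreal ((1/8)^k)"
    proof (rule Liminf_le)
      show "\<forall>\<^sub>F m in sequentially. (\<integral>\<^sup>+x. ennreal ((norm (f k x - f m x))\<^sup>2) \<partial>lborel) \<le> ennreal ((1/8)^k)"
        using eventually_ge_at_top[of k]
      proof eventually_elim
        case (elim m)
        then show ?case
          using rbound[of k m]
          by (subst nn_integral_norm_cls) (auto intro: square_integrable_diff f simp: cls_diff f norm_minus_commute)
      qed
    qed simp
    finally show ?thesis .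
  qed
  have "square_integrable (\<lambda>x. f 0 x - g x)"
  proof (rule square_integrableI)
    have "(\<integral>\<^sup>+x. ennreal ((norm (f 0 x - g x))\<^sup>2) \<partial>lborel) < \<infinity>"
      using est[of 0] by (rule le_less_trans) auto
    then show "integrable lborel (\<lambda>x. (norm (f 0 x - g x))\<^sup>2)"
      by (intro integrableI_nonneg) auto
  qed auto
  from square_integrable_diff[OF f[of 0] this] have gsq: "square_integrable g" by simp
  have "(norm (X (r k) - cls g))\<^sup>2 \<le> (1/8)^k" for k
    using est[of k] by (subst (asm) nn_integral_norm_cls) (auto intro: square_integrable_diff f gsq simp: cls_diff f gsq Xf)
  moreover have "(\<lambda>k. (1/8::real)^k) \<longlonglongrightarrow> 0" by (rule LIMSEQ_realpow_zero) auto
  ultimately have "(\<lambda>k. (norm (X (r k) - cls g))\<^sup>2) \<longlonglongrightarrow> 0"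
    by (rule_tac tendsto_sandwich[of "\<lambda>_. 0" _ _ "\<lambda>k. (1/8::real)^k"]) auto
  then have "(\<lambda>k. sqrt ((norm (X (r k) - cls g))\<^sup>2)) \<longlonglongrightarrow> sqrt 0"
    by (rule tendsto_real_sqrt)
  then have "(\<lambda>k. norm (X (r k) - cls g)) \<longlonglongrightarrow> 0" by simp
  then have "(X \<circ> r) \<longlonglongrightarrow> cls g"
    by (simp add: tendsto_norm_zero_iff LIM_zero_iff o_def)
  then show "convergent X"
    using Cauchy_converges_subseq[OF C mono] by (auto simp: convergent_def)
qed

text \<open>This is for passing pointwise conditions to limits in mean.\<close>

lemma cls_tendsto_AE_subseq:
  assumes f: "\<And>n. square_integrable (f n)" and g: "square_integrable g"
    and lim: "(\<lambda>n. cls (f n)) \<longlonglongrightarrow> cls g"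
  shows "\<exists>r. strict_mono r \<and> (AE x in lborel. (\<lambda>n. f (r n) x) \<longlonglongrightarrow> g x)"
proof -
  let ?h = "\<lambda>n x. (norm (f n x - g x))\<^sup>2"
  have d: "square_integrable (\<lambda>x. f n x - g x)" for n by (intro square_integrable_diff f g)
  have "(\<lambda>n. (norm (cls (f n) - cls g))\<^sup>2) \<longlonglongrightarrow> (norm (cls g - cls g))\<^sup>2"
    by (intro tendsto_intros lim)
  then have "(\<lambda>n. LINT x|lborel. norm (?h n x)) \<longlonglongrightarrow> 0"
    by (simp add: norm_cls2[OF d, symmetric] cls_diff f g)
  then have "\<exists>r. strict_mono r \<and> (AE x in lborel. (\<lambda>n. ?h (r n) x) \<longlonglongrightarrow> 0)"
    using tendsto_L1_AE_subseq[of lborel ?h] square_integrable_norm2[OF d] by blast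
  then obtain r where r: "strict_mono r" "AE x in lborel. (\<lambda>n. ?h (r n) x) \<longlonglongrightarrow> 0" by blast
  from r(2) have "AE x in lborel. (\<lambda>n. f (r n) x) \<longlonglongrightarrow> g x"
  proof eventually_elim
    case (elim x)
    then have "(\<lambda>n. sqrt (?h (r n) x)) \<longlonglongrightarrow> sqrt 0" by (rule tendsto_real_sqrt)
    then show ?case by (simp add: tendsto_norm_zero_iff LIM_zero_iff)
  qed
  with r(1) show ?thesis by blast
qed

section \<open>Translations, reflections and dilations\<close>

lemma lborel_distr_uminus3: "distr lborel borel uminus = (lborel :: (real^3) measure)"
  by (subst lborel_affine[of "-1" 0], auto simp: density_1 fun_Compl_def)

lemma integral_lborel_translate:
  fixes f :: "real^3 \<Rightarrow> 'b::{banach, second_countable_topology}"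
  assumes [measurable]: "f \<in> borel_measurable borel"
  shows "(LINT x|lborel. f (t + x)) = (LINT x|lborel. f x)"
  by (subst (2) lborel_distr_plus[of t, symmetric], subst integral_distr) auto

lemma integrable_lborel_translate:
  fixes f :: "real^3 \<Rightarrow> 'b::{banach, second_countable_topology}"
  assumes [measurable]: "f \<in> borel_measurable borel"
  shows "integrable lborel (\<lambda>x. f (t + x)) \<longleftrightarrow> integrable lborel f"
  by (subst (2) lborel_distr_plus[of t, symmetric], subst integrable_distr_eq) auto

lemma integral_lborel_reflect:
  fixes f :: "real^3 \<Rightarrow> 'b::{banach, second_countable_topology}"
  assumes [measurable]: "f \<in> borel_measurable borel"
  shows "(LINT x|lborel. f (- x)) = (LINT x|lborel. f x)"
  by (subst (2) lborel_distr_uminus3[symmetric], subst integral_distr) auto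

lemma integrable_lborel_reflect:
  fixes f :: "real^3 \<Rightarrow> 'b::{banach, second_countable_topology}"
  assumes [measurable]: "f \<in> borel_measurable borel"
  shows "integrable lborel (\<lambda>x. f (- x)) \<longleftrightarrow> integrable lborel f"
  by (subst (2) lborel_distr_uminus3[symmetric], subst integrable_distr_eq) auto

lemma AE_lborel_reflect:
  assumes "AE x in lborel. P (x :: real^3)"
  shows "AE x in lborel. P (- x)"
proof -
  obtain N where N: "{x. \<not> P x} \<subseteq> N" "N \<in> null_sets lborel"
    using assms by (auto simp: eventually_ae_filter)
  have "uminus -` N \<in> null_sets (lborel :: (real^3) measure)"
  proof (rule null_setsI)
    have "emeasure lborel (uminus -` N) = emeasure (distr lborel borel uminus) N"
      using N by (subst emeasure_distr) auto
    then show "emeasure lborel (uminus -` N) = 0"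
      using N by (simp add: lborel_distr_uminus3 null_setsD1)
    show "uminus -` N \<in> sets lborel"
      using N measurable_sets[of uminus borel borel N] by auto
  qed
  then show ?thesis
    unfolding eventually_ae_filter using N(1) by (intro bexI[of _ "uminus -` N"]) auto
qed

lemma integral_lborel_dilate:
  fixes f :: "real^3 \<Rightarrow> 'b::{banach, second_countable_topology}"
  assumes [measurable]: "f \<in> borel_measurable borel" and c: "0 < c"
  shows "(LINT x|lborel. f (c *\<^sub>R x)) = (1 / c^3) *\<^sub>R (LINT x|lborel. f x)"
proof -
  have "(LINT x|lborel. f x) = (LINT x|density (distr lborel borel (\<lambda>x. 0 + c *\<^sub>R x)) (\<lambda>_. \<bar>c\<bar>^DIM(real^3)). f x)"
    using c by (subst lborel_affine[of c "0::real^3"]) auto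
  also have "\<dots> = c^3 *\<^sub>R (LINT x|lborel. f (c *\<^sub>R x))"
    using c by (subst integral_density) (auto simp: integral_distr)
  finally show ?thesis using c by simp
qed

lemma integrable_lborel_dilate:
  fixes f :: "real^3 \<Rightarrow> 'b::{banach, second_countable_topology}"
  assumes [measurable]: "f \<in> borel_measurable borel" and c: "0 < c" and f: "integrable lborel f"
  shows "integrable lborel (\<lambda>x. f (c *\<^sub>R x))"
proof -
  have "integrable (density (distr lborel borel (\<lambda>x. 0 + c *\<^sub>R x)) (\<lambda>_. \<bar>c\<bar>^DIM(real^3))) f"
    using c f by (subst (asm) lborel_affine[of c "0::real^3"]) auto
  then have "integrable lborel (\<lambda>x. c^3 *\<^sub>R f (c *\<^sub>R x))"
    using c by (subst (asm) integrable_density) (auto simp: integrable_distr_eq)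
  from integrable_scaleR_right[OF this, of "1 / c^3"] show ?thesis
    using c by simp
qed

lemma square_integrable_translate: "square_integrable f \<Longrightarrow> square_integrable (\<lambda>x. f (t + x))"
  unfolding square_integrable_def
  using integrable_lborel_translate[of "\<lambda>x. (norm (f x))\<^sup>2" t] by auto

lemma square_integrable_reflect: "square_integrable f \<Longrightarrow> square_integrable (\<lambda>x. f (- x))"
  unfolding square_integrable_def
  using integrable_lborel_reflect[of "\<lambda>x. (norm (f x))\<^sup>2"] by auto

lemma norm_cls_translate: "square_integrable f \<Longrightarrow> norm (cls (\<lambda>x. f (t + x))) = norm (cls f)"
  using integral_lborel_translate[of "\<lambda>x. (norm (f x))\<^sup>2" t] square_integrable_translate[of f t]
    square_integrable_measurable[of f]
  by (intro power2_eq_imp_eq[OF trans[OF norm_cls2 trans[OF _ norm_cls2[symmetric]]]]) auto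

lemma norm_cls_reflect: "square_integrable f \<Longrightarrow> norm (cls (\<lambda>x. f (- x))) = norm (cls f)"
  using integral_lborel_reflect[of "\<lambda>x. (norm (f x))\<^sup>2"] square_integrable_reflect[of f]
    square_integrable_measurable[of f]
  by (intro power2_eq_imp_eq[OF trans[OF norm_cls2 trans[OF _ norm_cls2[symmetric]]]]) auto

subsection \<open>Continuity of translation\<close>

text \<open>Outer regularity replaces \<open>A\<close> by an open set.  A point of an open set stays in it under small
  translations, so there the integrand tends to 0 pointwise.\<close>

lemma translate_indicator_tendsto:
  fixes z :: "nat \<Rightarrow> real^3"
  assumes z: "z \<longlonglongrightarrow> 0" and A: "A \<in> sets borel" "emeasure lborel A < \<infinity>"
  shows "(\<lambda>n. LINT x|lborel. indicator A x * (1 - indicator A (z n + x))) \<longlonglongrightarrow> (0::real)"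
proof (rule LIMSEQ_I)
  fix e :: real assume e: "0 < e"
  obtain U where U: "open U" "A \<subseteq> U" "emeasure lborel (U - A) < ennreal (e/2)"
    using outer_regular_lborel[OF A(1), of "e/2"] e by auto
  have Ub[measurable]: "U \<in> sets borel" using U by auto
  note A(1)[measurable]
  have UAfin: "emeasure lborel (U - A) < \<infinity>" using U(3) by (rule less_trans) simp
  have "emeasure lborel U \<le> emeasure lborel A + emeasure lborel (U - A)"
    using emeasure_subadditive[of A lborel "U - A"] A U(2) by (simp add: Un_absorb1)
  also have "\<dots> < \<infinity>" using A UAfin by simp
  finally have Ufin: "emeasure lborel U < \<infinity>" .
  have iU: "integrable lborel (indicator U :: _ \<Rightarrow> real)" using Ufin by simp
  have iUA: "integrable lborel (indicator (U - A) :: _ \<Rightarrow> real)" using UAfin by simp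
  have iUA': "integrable lborel (\<lambda>x. indicator (U - A) (t + x) :: real)" for t
    using iUA by (subst integrable_lborel_translate) auto
  have mUA: "measure lborel (U - A) < e / 2"
    using U(3) e UAfin by (simp add: emeasure_eq_ennreal_measure ennreal_less_iff)
  have iUz: "integrable lborel (\<lambda>x. indicator U x * (1 - indicator U (z n + x)) :: real)" for n
    by (rule Bochner_Integration.integrable_bound[OF iU]) (auto simp: indicator_def)
  have iAz: "integrable lborel (\<lambda>x. indicator A x * (1 - indicator A (z n + x)) :: real)" for n
    by (rule Bochner_Integration.integrable_bound[OF iU]) (use U(2) in \<open>auto simp: indicator_def\<close>)
  have "(\<lambda>n. LINT x|lborel. indicator U x * (1 - indicator U (z n + x))) \<longlonglongrightarrow> (LINT x|(lborel :: (real^3) measure). (0::real))"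
  proof (rule integral_dominated_convergence[where w = "indicator U"])
    show "AE x in lborel. (\<lambda>n. indicator U x * (1 - indicator U (z n + x))) \<longlonglongrightarrow> (0::real)"
    proof (rule AE_I2)
      fix x
      show "(\<lambda>n. indicator U x * (1 - indicator U (z n + x))) \<longlonglongrightarrow> (0::real)"
      proof (cases "x \<in> U")
        case True
        have "(\<lambda>n. z n + x) \<longlonglongrightarrow> 0 + x" by (intro tendsto_intros z)
        then have "eventually (\<lambda>n. z n + x \<in> U) sequentially"
          using U(1) True by (auto dest: topological_tendstoD)
        then have "eventually (\<lambda>n. indicator U x * (1 - indicator U (z n + x)) = (0::real)) sequentially"
          by eventually_elim simp
        then show ?thesis by (rule tendsto_eventually)
      qed simp
    qed
  qed (use iU in \<open>auto simp: indicator_def\<close>)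
  then have "(\<lambda>n. LINT x|lborel. indicator U x * (1 - indicator U (z n + x))) \<longlonglongrightarrow> (0::real)" by simp
  then obtain N where N: "\<And>n. n \<ge> N \<Longrightarrow> \<bar>LINT x|lborel. indicator U x * (1 - indicator U (z n + x))\<bar> < e / 2"
    using LIMSEQ_D[of _ "0::real" "e/2"] e by fastforce
  show "\<exists>N. \<forall>n\<ge>N. norm ((LINT x|lborel. indicator A x * (1 - indicator A (z n + x))) - (0::real)) < e"
  proof (intro exI[of _ N] allI impI)
    fix n assume n: "N \<le> n"
    have "(LINT x|lborel. indicator A x * (1 - indicator A (z n + x)) :: real) \<le>
        (LINT x|lborel. indicator U x * (1 - indicator U (z n + x)) + indicator (U - A) (z n + x))"
      by (intro integral_mono Bochner_Integration.integrable_add iAz iUz iUA')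
         (use U(2) in \<open>auto simp: indicator_def\<close>)
    also have "\<dots> = (LINT x|lborel. indicator U x * (1 - indicator U (z n + x))) + measure lborel (U - A)"
      by (subst Bochner_Integration.integral_add[OF iUz iUA'], subst integral_lborel_translate) auto
    also have "\<dots> < e / 2 + e / 2"
      using N[OF n] mUA by (intro add_strict_mono) auto
    finally have "(LINT x|lborel. indicator A x * (1 - indicator A (z n + x))) < e" by simp
    moreover have "0 \<le> (LINT x|lborel. indicator A x * (1 - indicator A (z n + x)) :: real)"
      by (rule integral_nonneg_AE) (auto simp: indicator_def)
    ultimately show "norm ((LINT x|lborel. indicator A x * (1 - indicator A (z n + x))) - (0::real)) < e" by simp
  qed
qed

lemma translate_L1_tendsto:
  fixes f :: "real^3 \<Rightarrow> real"
  assumes f: "integrable lborel f" and z: "z \<longlonglongrightarrow> 0"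
  shows "(\<lambda>n. LINT x|lborel. \<bar>f (z n + x) - f x\<bar>) \<longlonglongrightarrow> 0"
  using f
proof (induction rule: integrable_induct)
  case (base A c)
  then have [measurable]: "A \<in> sets borel" by simp
  let ?h = "\<lambda>t x. indicator A x * (1 - indicator A (t + x)) :: real"
  have iA: "integrable lborel (indicator A :: _ \<Rightarrow> real)" using base by simp
  have ih: "integrable lborel (?h t)" for t
    by (rule Bochner_Integration.integrable_bound[OF iA]) (auto simp: indicator_def)
  have eq: "(LINT x|lborel. \<bar>indicator A (z n + x) *\<^sub>R c - indicator A x *\<^sub>R c\<bar>)
     = \<bar>c\<bar> * ((LINT x|lborel. ?h (z n) x) + (LINT x|lborel. ?h (- z n) x))" for n
  proof -
    have "(LINT x|lborel. \<bar>indicator A (z n + x) *\<^sub>R c - indicator A x *\<^sub>R c\<bar>)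
        = (LINT x|lborel. \<bar>c\<bar> * (?h (z n) x + ?h (- z n) (z n + x)))"
      by (rule Bochner_Integration.integral_cong) (auto simp: indicator_def)
    also have "\<dots> = \<bar>c\<bar> * ((LINT x|lborel. ?h (z n) x) + (LINT x|lborel. ?h (- z n) (z n + x)))"
    proof (subst integral_mult_right_zero, subst Bochner_Integration.integral_add)
      show "integrable lborel (\<lambda>x. ?h (- z n) (z n + x))"
        by (subst integrable_lborel_translate) (measurable, rule ih)
    qed (rule ih, rule refl)
    also have "(LINT x|lborel. ?h (- z n) (z n + x)) = (LINT x|lborel. ?h (- z n) x)"
      by (rule integral_lborel_translate) measurable
    finally show ?thesis .
  qed
  have zm: "(\<lambda>n. - z n) \<longlonglongrightarrow> 0" using tendsto_minus[OF z] by simp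
  have "(\<lambda>n. \<bar>c\<bar> * ((LINT x|lborel. ?h (z n) x) + (LINT x|lborel. ?h (- z n) x))) \<longlonglongrightarrow> \<bar>c\<bar> * (0 + 0)"
    using base by (intro tendsto_intros translate_indicator_tendsto z zm) auto
  then show ?case unfolding eq by simp
next
  case (add f g)
  have [measurable]: "f \<in> borel_measurable borel" "g \<in> borel_measurable borel"
    using add.hyps by auto
  have i: "integrable lborel (\<lambda>x. \<bar>f (z n + x) - f x\<bar>)" "integrable lborel (\<lambda>x. \<bar>g (z n + x) - g x\<bar>)" for n
    using add.hyps by (auto intro!: integrable_abs Bochner_Integration.integrable_diff simp: integrable_lborel_translate)
  have "(\<lambda>n. (LINT x|lborel. \<bar>f (z n + x) - f x\<bar>) + (LINT x|lborel. \<bar>g (z n + x) - g x\<bar>)) \<longlonglongrightarrow> 0 + 0"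
    by (intro tendsto_intros add.IH)
  then have lim: "(\<lambda>n. LINT x|lborel. \<bar>f (z n + x) - f x\<bar> + \<bar>g (z n + x) - g x\<bar>) \<longlonglongrightarrow> 0"
    by (simp add: i)
  show ?case
  proof (rule tendsto_sandwich[OF _ _ tendsto_const lim])
    show "\<forall>\<^sub>F n in sequentially. (LINT x|lborel. \<bar>f (z n + x) + g (z n + x) - (f x + g x)\<bar>)
        \<le> (LINT x|lborel. \<bar>f (z n + x) - f x\<bar> + \<bar>g (z n + x) - g x\<bar>)"
      using i by (intro always_eventually allI integral_mono') auto
  qed auto
next
  case (lim f s)
  have [measurable]: "f \<in> borel_measurable borel" "s i \<in> borel_measurable borel" for i
    using lim.hyps(1,4) by auto
  have lim0: "(\<lambda>i. LINT x|lborel. \<bar>s i x - f x\<bar>) \<longlonglongrightarrow> (LINT x|(lborel :: (real^3) measure). 0)"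
  proof (rule integral_dominated_convergence[where w = "\<lambda>x. 3 * \<bar>f x\<bar>"])
    show "AE x in lborel. (\<lambda>i. \<bar>s i x - f x\<bar>) \<longlonglongrightarrow> 0"
      using lim.hyps(2) by (intro AE_I2 tendsto_rabs_zero LIM_zero) simp
    show "AE x in lborel. norm \<bar>s i x - f x\<bar> \<le> 3 * \<bar>f x\<bar>" for i
    proof (rule AE_I2)
      fix x show "norm \<bar>s i x - f x\<bar> \<le> 3 * \<bar>f x\<bar>" using lim.hyps(3)[of x i] by simp
    qed
  qed (use lim.hyps(4) in auto)
  show ?case
  proof (rule LIMSEQ_I)
    fix e :: real assume e: "0 < e"
    obtain i where i: "\<bar>LINT x|lborel. \<bar>s i x - f x\<bar>\<bar> < e / 3"
      using LIMSEQ_D[OF lim0, of "e/3"] e by auto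
    obtain N where N: "\<And>n. n \<ge> N \<Longrightarrow> \<bar>LINT x|lborel. \<bar>s i (z n + x) - s i x\<bar>\<bar> < e / 3"
      using LIMSEQ_D[OF lim.IH[of i], of "e/3"] e by auto
    show "\<exists>N. \<forall>n\<ge>N. norm ((LINT x|lborel. \<bar>f (z n + x) - f x\<bar>) - 0) < e"
    proof (intro exI[of _ N] allI impI)
      fix n assume n: "N \<le> n"
      have i1: "integrable lborel (\<lambda>x. \<bar>s i x - f x\<bar>)" using lim.hyps(1,4) by auto
      have i2: "integrable lborel (\<lambda>x. \<bar>s i (z n + x) - f (z n + x)\<bar>)"
        using integrable_lborel_translate[of "\<lambda>x. \<bar>s i x - f x\<bar>" "z n"] i1 by auto
      have i3: "integrable lborel (\<lambda>x. \<bar>s i (z n + x) - s i x\<bar>)"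
        using lim.hyps(1) by (auto intro!: integrable_abs Bochner_Integration.integrable_diff simp: integrable_lborel_translate)
      have "(LINT x|lborel. \<bar>f (z n + x) - f x\<bar>) \<le>
        (LINT x|lborel. (\<bar>s i (z n + x) - f (z n + x)\<bar> + \<bar>s i (z n + x) - s i x\<bar>) + \<bar>s i x - f x\<bar>)"
        by (rule integral_mono') (use i1 i2 i3 in auto)
      also have "\<dots> = (LINT x|lborel. \<bar>s i (z n + x) - f (z n + x)\<bar>) + (LINT x|lborel. \<bar>s i (z n + x) - s i x\<bar>) + (LINT x|lborel. \<bar>s i x - f x\<bar>)"
        using i1 i2 i3 by simp
      also have "(LINT x|lborel. \<bar>s i (z n + x) - f (z n + x)\<bar>) = (LINT x|lborel. \<bar>s i x - f x\<bar>)"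
        by (rule integral_lborel_translate) measurable
      finally have "(LINT x|lborel. \<bar>f (z n + x) - f x\<bar>) < e"
        using i N[OF n] by simp
      then show "norm ((LINT x|lborel. \<bar>f (z n + x) - f x\<bar>) - 0) < e"
        by (simp add: integral_nonneg_AE)
    qed
  qed
qed

text \<open>The inequality \<open>(a - b)\<^sup>2 \<le> |a\<^sup>2 - b\<^sup>2|\<close> for nonnegative numbers deduces this from the continuity
  of translation in \<open>L\<^sup>1\<close> for the square of \<open>f\<close>.\<close>

lemma translate_L2_tendsto_nonneg:
  fixes f :: "real^3 \<Rightarrow> real"
  assumes f: "square_integrable f" and nonneg: "\<And>x. 0 \<le> f x" and z: "z \<longlonglongrightarrow> 0"
  shows "(\<lambda>n. LINT x|lborel. (f (z n + x) - f x)\<^sup>2) \<longlonglongrightarrow> 0"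
proof -
  have [measurable]: "f \<in> borel_measurable borel" using f by (rule square_integrable_measurable)
  have i: "integrable lborel (\<lambda>x. (f x)\<^sup>2)" using square_integrable_norm2[OF f] by simp
  have lim: "(\<lambda>n. LINT x|lborel. \<bar>(f (z n + x))\<^sup>2 - (f x)\<^sup>2\<bar>) \<longlonglongrightarrow> 0"
    by (rule translate_L1_tendsto[OF i z])
  show ?thesis
  proof (rule tendsto_sandwich[OF _ _ tendsto_const lim])
    have *: "(a - b)\<^sup>2 \<le> \<bar>a\<^sup>2 - b\<^sup>2\<bar>" if "0 \<le> a" "0 \<le> b" for a b :: real
    proof -
      have "(a - b)\<^sup>2 = \<bar>a - b\<bar> * \<bar>a - b\<bar>" by (simp add: power2_eq_square)
      also have "\<dots> \<le> \<bar>a - b\<bar> * \<bar>a + b\<bar>" using that by (intro mult_left_mono) auto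
      also have "\<dots> = \<bar>a\<^sup>2 - b\<^sup>2\<bar>" by (simp add: abs_mult[symmetric] power2_eq_square algebra_simps)
      finally show ?thesis .
    qed
    have "integrable lborel (\<lambda>x. \<bar>(f (z n + x))\<^sup>2 - (f x)\<^sup>2\<bar>)" for n
      using i integrable_lborel_translate[of "\<lambda>x. (f x)\<^sup>2" "z n"] by auto
    then show "\<forall>\<^sub>F n in sequentially. (LINT x|lborel. (f (z n + x) - f x)\<^sup>2) \<le> (LINT x|lborel. \<bar>(f (z n + x))\<^sup>2 - (f x)\<^sup>2\<bar>)"
      by (intro always_eventually allI integral_mono') (auto intro!: * nonneg)
  qed auto
qed

text \<open>Each component is the difference of its positive and its negative part.\<close>

lemma translate_L2_tendsto:
  fixes f :: "real^3 \<Rightarrow> 'b::euclidean_space"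
  assumes f: "square_integrable f" and z: "z \<longlonglongrightarrow> 0"
  shows "(\<lambda>n. cls (\<lambda>x. f (z n + x))) \<longlonglongrightarrow> cls f"
proof -
  have [measurable]: "f \<in> borel_measurable borel" using f by (rule square_integrable_measurable)
  define p where "p = (\<lambda>b x. max 0 (f x \<bullet> b))"
  define q where "q = (\<lambda>b x. max 0 (- (f x \<bullet> b)))"
  have [measurable]: "p b \<in> borel_measurable borel" "q b \<in> borel_measurable borel" for b
    by (auto simp: p_def q_def)
  have p: "square_integrable (p b)" and q: "square_integrable (q b)" if "b \<in> Basis" for b
  proof -
    have "\<bar>f x \<bullet> b\<bar> \<le> norm (f x)" for x using Basis_le_norm[OF that] .
    then have "norm (p b x) \<le> 1 * norm (f x)" "norm (q b x) \<le> 1 * norm (f x)" for x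
      unfolding p_def q_def by (smt (verit) real_norm_def norm_ge_zero)+
    then show "square_integrable (p b)" "square_integrable (q b)"
      by (auto intro!: square_integrable_bound[OF f, of _ 1])
  qed
  let ?I = "\<lambda>n. \<Sum>b\<in>Basis. 2 * (LINT x|lborel. (p b (z n + x) - p b x)\<^sup>2) + 2 * (LINT x|lborel. (q b (z n + x) - q b x)\<^sup>2)"
  have lim: "?I \<longlonglongrightarrow> (\<Sum>b\<in>(Basis::'b set). 2 * 0 + 2 * 0)"
    by (intro tendsto_intros translate_L2_tendsto_nonneg p q z) (auto simp: p_def q_def)
  have d: "square_integrable (\<lambda>x. f (z n + x) - f x)" for n
    by (intro square_integrable_diff square_integrable_translate f)
  have dp: "integrable lborel (\<lambda>x. (p b (z n + x) - p b x)\<^sup>2)" if "b \<in> Basis" for b n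
    using square_integrable_norm2[OF square_integrable_diff[OF square_integrable_translate[OF p[OF that]] p[OF that]]] by simp
  have dq: "integrable lborel (\<lambda>x. (q b (z n + x) - q b x)\<^sup>2)" if "b \<in> Basis" for b n
    using square_integrable_norm2[OF square_integrable_diff[OF square_integrable_translate[OF q[OF that]] q[OF that]]] by simp
  have pw: "(norm (f y - f x))\<^sup>2 \<le> (\<Sum>b\<in>Basis. 2 * (p b y - p b x)\<^sup>2 + 2 * (q b y - q b x)\<^sup>2)" for x y
  proof -
    have "(norm (f y - f x))\<^sup>2 = (\<Sum>b\<in>Basis. ((f y - f x) \<bullet> b)\<^sup>2)"
      unfolding power2_norm_eq_inner by (subst euclidean_inner) (simp add: power2_eq_square)
    also have "\<dots> \<le> (\<Sum>b\<in>Basis. 2 * (p b y - p b x)\<^sup>2 + 2 * (q b y - q b x)\<^sup>2)"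
    proof (rule sum_mono)
      fix b :: 'b
      have "(f y - f x) \<bullet> b = (p b y - p b x) - (q b y - q b x)"
        by (auto simp: p_def q_def inner_diff_left max_def)
      moreover have "(s - t)\<^sup>2 \<le> 2 * s\<^sup>2 + 2 * t\<^sup>2" for s t :: real
        using zero_le_power2[of "s + t"] by (simp add: power2_sum power2_diff)
      ultimately show "((f y - f x) \<bullet> b)\<^sup>2 \<le> 2 * (p b y - p b x)\<^sup>2 + 2 * (q b y - q b x)\<^sup>2" by simp
    qed
    finally show ?thesis .
  qed
  have "(norm (cls (\<lambda>x. f (z n + x)) - cls f))\<^sup>2 \<le> ?I n" for n
  proof -
    have "(norm (cls (\<lambda>x. f (z n + x)) - cls f))\<^sup>2 = (LINT x|lborel. (norm (f (z n + x) - f x))\<^sup>2)"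
      using norm_cls2[OF d] by (simp add: cls_diff square_integrable_translate f)
    also have "\<dots> \<le> (LINT x|lborel. (\<Sum>b\<in>Basis. 2 * (p b (z n + x) - p b x)\<^sup>2 + 2 * (q b (z n + x) - q b x)\<^sup>2))"
      using dp dq by (intro integral_mono square_integrable_norm2 d pw Bochner_Integration.integrable_sum
          Bochner_Integration.integrable_add integrable_mult_right) auto
    also have "\<dots> = ?I n"
      using dp dq by simp
    finally show ?thesis .
  qed
  note est = this
  have "?I \<longlonglongrightarrow> 0" using lim by simp
  have "(\<lambda>n. (norm (cls (\<lambda>x. f (z n + x)) - cls f))\<^sup>2) \<longlonglongrightarrow> 0"
    by (rule tendsto_sandwich[OF _ _ tendsto_const \<open>?I \<longlonglongrightarrow> 0\<close>])
       (intro always_eventually allI est zero_le_power2)+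
  then have "(\<lambda>n. sqrt ((norm (cls (\<lambda>x. f (z n + x)) - cls f))\<^sup>2)) \<longlonglongrightarrow> sqrt 0"
    by (rule tendsto_real_sqrt)
  then show ?thesis by (simp add: tendsto_norm_zero_iff LIM_zero_iff)
qed

section \<open>Fourier integrals\<close>

definition fourier_integral :: "(real^3 \<Rightarrow> complex) \<Rightarrow> real^3 \<Rightarrow> complex" where
  "fourier_integral f \<xi> = (LINT x|lborel. cis (- 2 * pi * (x \<bullet> \<xi>)) * f x)"

lemma borel_measurable_cis[measurable]: "cis \<in> borel_measurable borel"
  by (intro borel_measurable_continuous_onI continuous_intros)

lemma borel_measurable_cnj[measurable]: "cnj \<in> borel_measurable borel"
  by (intro borel_measurable_continuous_onI continuous_intros)

lemma integrable_cis_mult: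
  assumes "integrable lborel f" and [measurable]: "g \<in> borel_measurable borel"
  shows "integrable (lborel :: (real^3) measure) (\<lambda>x. cis (g x) * f x)"
  using assms(1) by (rule Bochner_Integration.integrable_bound) (use assms in \<open>auto simp: norm_mult\<close>)

lemma fourier_integral_measurable[measurable (raw)]:
  assumes [measurable]: "f \<in> borel_measurable borel"
  shows "fourier_integral f \<in> borel_measurable borel"
proof -
  have "(\<lambda>\<xi>. LINT x|lborel. cis (- 2 * pi * (x \<bullet> \<xi>)) * f x) \<in> borel_measurable borel"
    by (rule lborel.borel_measurable_lebesgue_integral) measurable
  then show ?thesis by (simp add: fourier_integral_def[abs_def])
qed

lemma norm_fourier_integral_le: "norm (fourier_integral f \<xi>) \<le> (LINT x|lborel. norm (f x))"
  unfolding fourier_integral_def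
  using integral_norm_bound[of lborel "\<lambda>x. cis (- 2 * pi * (x \<bullet> \<xi>)) * f x"] by (simp add: norm_mult)

lemma fourier_integral_diff:
  assumes "integrable lborel f" "integrable lborel g"
  shows "fourier_integral (\<lambda>x. f x - g x) \<xi> = fourier_integral f \<xi> - fourier_integral g \<xi>"
  unfolding fourier_integral_def
  by (simp add: right_diff_distrib integrable_cis_mult assms)

lemma fourier_integral_cnj: "fourier_integral (\<lambda>x. cnj (f x)) \<xi> = cnj (fourier_integral f (- \<xi>))"
proof -
  have "cnj (fourier_integral f (- \<xi>)) = (LINT x|lborel. cnj (cis (- 2 * pi * (x \<bullet> - \<xi>)) * f x))"
    unfolding fourier_integral_def by (rule Bochner_Integration.integral_cnj[symmetric])
  then show ?thesis by (simp add: fourier_integral_def cis_cnj)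
qed

text \<open>Domination by a product of integrable functions suffices for Fubini's theorem.\<close>

lemma integrable_pair_bound:
  fixes f :: "real^3 \<Rightarrow> complex" and g :: "real^3 \<Rightarrow> complex" and h :: "(real^3) \<times> (real^3) \<Rightarrow> complex"
  assumes f: "integrable lborel f" and g: "integrable lborel g"
    and [measurable]: "h \<in> borel_measurable (borel \<Otimes>\<^sub>M borel)"
    and h: "\<And>x y. norm (h (x, y)) \<le> norm (f x) * norm (g y)"
  shows "integrable (lborel \<Otimes>\<^sub>M lborel) h"
proof (rule lborel_pair.Fubini_integrable)
  have [measurable]: "f \<in> borel_measurable borel" "g \<in> borel_measurable borel" using f g by auto
  have "(\<lambda>x. LINT y|lborel. norm (h (x, y))) \<in> borel_measurable lborel"
    by (rule lborel.borel_measurable_lebesgue_integral) measurable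
  show i2: "AE x in lborel. integrable lborel (\<lambda>y. h (x, y))"
  proof (rule AE_I2)
    fix x
    show "integrable lborel (\<lambda>y. h (x, y))"
      by (rule Bochner_Integration.integrable_bound[OF integrable_mult_right[OF integrable_norm[OF g], of "norm (f x)"]])
         (auto intro: h)
  qed
  show "integrable lborel (\<lambda>x. LINT y|lborel. norm (h (x, y)))"
  proof (rule Bochner_Integration.integrable_bound)
    show "integrable lborel (\<lambda>x. norm (f x) * (LINT y|lborel. norm (g y)))"
      using f by auto
    show "AE x in lborel. norm (LINT y|lborel. norm (h (x, y))) \<le> norm (norm (f x) * (LINT y|lborel. norm (g y)))"
    proof (rule AE_I2)
      fix x
      have "(LINT y|lborel. norm (h (x, y))) \<le> (LINT y|lborel. norm (f x) * norm (g y))"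
        using g by (intro integral_mono') (auto intro: h)
      then show "norm (LINT y|lborel. norm (h (x, y))) \<le> norm (norm (f x) * (LINT y|lborel. norm (g y)))"
        by simp
    qed
  qed fact
qed measurable

text \<open>Both sides are the double integral of \<open>cis (- 2 \<pi> x \<cdot> \<xi>) f(x) g(\<xi>)\<close>.\<close>

lemma fourier_integral_multiplication_formula:
  assumes f: "integrable lborel f" and g: "integrable lborel g"
  shows "(LINT \<xi>|lborel. fourier_integral f \<xi> * g \<xi>) = (LINT x|lborel. f x * fourier_integral g x)"
proof -
  have [measurable]: "f \<in> borel_measurable borel" "g \<in> borel_measurable borel" using f g by auto
  define h where "h = (\<lambda>x \<xi>. cis (- 2 * pi * (x \<bullet> \<xi>)) * f x * g \<xi>)"
  have "integrable (lborel \<Otimes>\<^sub>M lborel) (case_prod h)"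
    by (rule integrable_pair_bound[OF f g]) (auto simp: h_def norm_mult)
  then have "(LINT \<xi>|lborel. LINT x|lborel. h x \<xi>) = (LINT x|lborel. LINT \<xi>|lborel. h x \<xi>)"
    by (rule lborel_pair.Fubini_integral)
  moreover have "(LINT x|lborel. h x \<xi>) = fourier_integral f \<xi> * g \<xi>" for \<xi>
    unfolding h_def fourier_integral_def by simp
  moreover have "(LINT \<xi>|lborel. h x \<xi>) = f x * fourier_integral g x" for x
  proof -
    have "(LINT \<xi>|lborel. h x \<xi>) = (LINT \<xi>|lborel. f x * (cis (- 2 * pi * (\<xi> \<bullet> x)) * g \<xi>))"
      by (simp add: h_def inner_commute mult_ac)
    then show ?thesis by (simp add: fourier_integral_def)
  qed
  ultimately show ?thesis by simp
qed

subsection \<open>The Gaussian\<close>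

definition gaussian :: "real^3 \<Rightarrow> real" where "gaussian x = exp (- pi * (norm x)\<^sup>2)"

lemma gaussian_measurable[measurable]: "gaussian \<in> borel_measurable borel"
  unfolding gaussian_def[abs_def] by measurable

lemma gaussian_pos: "0 < gaussian x" and gaussian_le_1: "gaussian x \<le> 1"
  by (auto simp: gaussian_def)

text \<open>This is the characteristic function of the standard normal distribution, rescaled by \<open>sqrt (2 \<pi>)\<close>.\<close>

lemma gaussian_fourier_1D:
  "integrable lborel (\<lambda>x::real. exp (complex_of_real (- pi * x\<^sup>2) + \<i> * complex_of_real (- 2 * pi * x * t)))"
  "(LINT x|lborel. exp (complex_of_real (- pi * x\<^sup>2) + \<i> * complex_of_real (- 2 * pi * x * t)))
     = complex_of_real (exp (- pi * t\<^sup>2))"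
proof -
  define c where "c = sqrt (2 * pi)"
  have c: "0 < c" "c\<^sup>2 = 2 * pi" by (auto simp: c_def)
  define s where "s = - c * t"
  define F where "F = (\<lambda>y::real. std_normal_density y *\<^sub>R exp (\<i> * complex_of_real (s * y)))"
  have iF: "integrable lborel F"
    unfolding F_def
    by (rule Bochner_Integration.integrable_bound[OF integrable_std_normal_moment[of 0]])
       (auto simp: norm_mult)
  have "complex_of_real (exp (- (s\<^sup>2) / 2)) = char std_normal_distribution s"
    by (simp add: char_std_normal_distribution)
  also have "\<dots> = (LINT y|lborel. F y)"
    unfolding char_def F_def by (subst integral_density) (auto simp: normal_density_nonneg)
  also have "\<dots> = c *\<^sub>R (LINT x|lborel. F (0 + c * x))"
    using c by (subst lborel_integral_real_affine[of c _ 0]) auto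
  finally have eq: "complex_of_real (exp (- (s\<^sup>2) / 2)) = (LINT x|lborel. c *\<^sub>R F (c * x))" by simp
  have F: "c *\<^sub>R F (c * x) = exp (complex_of_real (- pi * x\<^sup>2) + \<i> * complex_of_real (- 2 * pi * x * t))" for x
  proof -
    have "std_normal_density (c * x) = exp (- pi * x\<^sup>2) / c"
      by (simp add: normal_density_def power_mult_distrib c c_def[symmetric])
    moreover have "s * (c * x) = - 2 * pi * x * t"
      using c(2) by (simp add: s_def power2_eq_square mult_ac)
    ultimately have "c *\<^sub>R F (c * x) = complex_of_real (exp (- pi * x\<^sup>2)) * exp (\<i> * complex_of_real (- 2 * pi * x * t))"
      using c(1) unfolding F_def by (simp add: scaleR_conv_of_real)
    then show ?thesis by (simp only: exp_add exp_of_real)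
  qed
  have "integrable lborel (\<lambda>x. c *\<^sub>R F (c * x))"
    using lborel_integrable_real_affine[OF iF, of c 0] c by auto
  then show "integrable lborel (\<lambda>x::real. exp (complex_of_real (- pi * x\<^sup>2) + \<i> * complex_of_real (- 2 * pi * x * t)))"
    unfolding F .
  have "s\<^sup>2 / 2 = pi * t\<^sup>2" by (simp add: s_def power_mult_distrib c)
  then show "(LINT x|lborel. exp (complex_of_real (- pi * x\<^sup>2) + \<i> * complex_of_real (- 2 * pi * x * t)))
     = complex_of_real (exp (- pi * t\<^sup>2))"
    using eq unfolding F by simp
qed

lemma gaussian_product:
  fixes f :: "real^3 \<Rightarrow> real"
  shows "cis (- 2 * pi * ((\<Sum>b\<in>Basis. f b *\<^sub>R b) \<bullet> \<xi>)) * complex_of_real (gaussian (\<Sum>b\<in>Basis. f b *\<^sub>R b))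
   = (\<Prod>b\<in>Basis. exp (complex_of_real (- pi * (f b)\<^sup>2) + \<i> * complex_of_real (- 2 * pi * f b * (\<xi> \<bullet> b))))"
proof -
  have 1: "(\<Sum>b\<in>Basis. f b *\<^sub>R b) \<bullet> \<xi> = (\<Sum>b\<in>Basis. f b * (\<xi> \<bullet> b))"
    by (simp add: inner_sum_left inner_commute[of \<xi>])
  have 2: "(norm (\<Sum>b\<in>Basis. f b *\<^sub>R b))\<^sup>2 = (\<Sum>b\<in>Basis. (f b)\<^sup>2)"
    unfolding power2_norm_eq_inner by (subst euclidean_inner) (simp add: power2_eq_square)
  show ?thesis
    unfolding 1 2 gaussian_def cis_conv_exp exp_of_real[symmetric] exp_add[symmetric] exp_sum[OF finite_Basis, symmetric]
    by (simp add: sum_subtractf sum_distrib_left sum_negf mult_ac) (rule arg_cong[where f = exp], rule minus_diff_commute)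
qed

lemma fourier_integral_gaussian:
  "integrable lborel (\<lambda>x. complex_of_real (gaussian x))"
  "fourier_integral (\<lambda>x. complex_of_real (gaussian x)) \<xi> = complex_of_real (gaussian \<xi>)"
proof -
  interpret product_sigma_finite "\<lambda>_::real^3. lborel :: real measure" ..
  let ?T = "\<lambda>f. \<Sum>b\<in>Basis. f b *\<^sub>R (b :: real^3)"
  have T[measurable]: "?T \<in> (\<Pi>\<^sub>M b\<in>Basis. lborel) \<rightarrow>\<^sub>M borel" by measurable
  have i: "integrable lborel (\<lambda>x. cis (- 2 * pi * (x \<bullet> \<xi>)) * complex_of_real (gaussian x))" for \<xi>
    unfolding lborel_eq[where 'a = "real^3"]
  proof (subst integrable_distr_eq)
    show "integrable (\<Pi>\<^sub>M b\<in>Basis. lborel) (\<lambda>f. cis (- 2 * pi * (?T f \<bullet> \<xi>)) * complex_of_real (gaussian (?T f)))"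
      unfolding gaussian_product by (intro product_integrable_prod gaussian_fourier_1D) auto
  qed auto
  from i[of 0] show "integrable lborel (\<lambda>x. complex_of_real (gaussian x))" by simp
  have "fourier_integral (\<lambda>x. complex_of_real (gaussian x)) \<xi>
      = (LINT f|(\<Pi>\<^sub>M b\<in>Basis. lborel). cis (- 2 * pi * (?T f \<bullet> \<xi>)) * complex_of_real (gaussian (?T f)))"
    unfolding fourier_integral_def lborel_eq[where 'a = "real^3"] by (subst integral_distr) auto
  also have "\<dots> = (\<Prod>b\<in>Basis. complex_of_real (exp (- pi * (\<xi> \<bullet> b)\<^sup>2)))"
    unfolding gaussian_product by (subst product_integral_prod) (simp_all only: gaussian_fourier_1D finite_Basis)
  also have "\<dots> = complex_of_real (exp (\<Sum>b\<in>Basis. - pi * (\<xi> \<bullet> b)\<^sup>2))"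
    by (simp add: exp_sum)
  also have "(\<Sum>b\<in>Basis. - pi * (\<xi> \<bullet> b)\<^sup>2) = - pi * (norm \<xi>)\<^sup>2"
    unfolding power2_norm_eq_inner by (subst euclidean_inner) (simp add: power2_eq_square sum_distrib_left sum_negf)
  finally show "fourier_integral (\<lambda>x. complex_of_real (gaussian x)) \<xi> = complex_of_real (gaussian \<xi>)"
    by (simp add: gaussian_def)
qed

lemma gaussian_integrable: "integrable lborel gaussian"
  using integrable_norm[OF fourier_integral_gaussian(1)] by (simp add: gaussian_def[abs_def])

lemma gaussian_integral: "(LINT x|lborel. gaussian x) = 1"
  using fourier_integral_gaussian(2)[of 0] by (simp add: fourier_integral_def gaussian_def)

lemma fourier_integral_gaussian_dilate:
  assumes n: "0 < n"
  shows "fourier_integral (\<lambda>x. complex_of_real (gaussian ((1 / n) *\<^sub>R x))) \<xi> = complex_of_real (n^3 * gaussian (n *\<^sub>R \<xi>))"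
proof -
  let ?h = "\<lambda>x. cis (- 2 * pi * (x \<bullet> (n *\<^sub>R \<xi>))) * complex_of_real (gaussian x)"
  have "fourier_integral (\<lambda>x. complex_of_real (gaussian ((1 / n) *\<^sub>R x))) \<xi> = (LINT x|lborel. ?h ((1 / n) *\<^sub>R x))"
    using n by (simp add: fourier_integral_def)
  also have "\<dots> = (1 / (1 / n)^3) *\<^sub>R (LINT x|lborel. ?h x)"
    using n by (intro integral_lborel_dilate) auto
  also have "(LINT x|lborel. ?h x) = complex_of_real (gaussian (n *\<^sub>R \<xi>))"
    using fourier_integral_gaussian(2)[of "n *\<^sub>R \<xi>"] by (simp add: fourier_integral_def)
  finally show ?thesis by (simp add: power_divide scaleR_conv_of_real)
qed

subsection \<open>Plancherel's identity for integrable functions\<close>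

lemma integrable_mult_bounded:
  fixes f g :: "real^3 \<Rightarrow> complex"
  assumes f: "integrable lborel f" and [measurable]: "g \<in> borel_measurable borel" and g: "\<And>x. norm (g x) \<le> C"
  shows "integrable lborel (\<lambda>x. f x * g x)"
proof (rule Bochner_Integration.integrable_bound[OF integrable_mult_right[OF f, of "complex_of_real C"]])
  have "0 \<le> C" using norm_ge_zero g order_trans by blast
  moreover have "norm (f x) * norm (g x) \<le> norm (f x) * C" for x
    by (intro mult_left_mono g) auto
  ultimately show "AE x in lborel. norm (f x * g x) \<le> norm (complex_of_real C * f x)"
    by (intro AE_I2) (simp add: norm_mult mult.commute[of C])
qed (use f in auto)

text \<open>The Gaussian factor makes the triple integral hidden in the left side absolutely convergent.  Using the
  multiplication formula twice moves both transforms onto the Gaussian, whose transform is again a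
  Gaussian, concentrated at scale \<open>1 / n\<close>.  What remains is a Gaussian average of the autocorrelation
  of \<open>f\<close>.\<close>

lemma gaussian_damped_energy:
  assumes f: "integrable lborel f" and f2: "square_integrable f" and n: "0 < n"
  shows "(LINT \<xi>|lborel. gaussian ((1 / n) *\<^sub>R \<xi>) * (norm (fourier_integral f \<xi>))\<^sup>2)
       = (LINT w|lborel. gaussian w * (cls f \<bullet> cls (\<lambda>x. f ((1 / n) *\<^sub>R w + x))))"
proof -
  have [measurable]: "f \<in> borel_measurable borel" using f by auto
  define G where "G = (\<lambda>\<xi>. complex_of_real (gaussian ((1 / n) *\<^sub>R \<xi>)))"
  have [measurable]: "G \<in> borel_measurable borel" unfolding G_def by measurable
  have G: "integrable lborel G"
    unfolding G_def using n by (intro integrable_lborel_dilate[of "\<lambda>x. complex_of_real (gaussian x)"] fourier_integral_gaussian(1)) auto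
  let ?F = "fourier_integral f"
  define C where "C = (LINT x|lborel. norm (f x))"
  have FC: "norm (?F \<xi>) \<le> C" for \<xi> unfolding C_def by (rule norm_fourier_integral_le)
  \<comment> \<open>Up to conjugation this is the mean of \<open>f\<close> around \<open>x\<close> with Gaussian weight at scale \<open>1 / n\<close>.\<close>
  have inner_eq: "fourier_integral (\<lambda>\<xi>. G \<xi> * cnj (?F \<xi>)) x
      = cnj (LINT w|lborel. complex_of_real (gaussian w) * f ((1 / n) *\<^sub>R w + x))" for x
  proof -
    define k where "k = (\<lambda>\<xi>. G \<xi> * cis (2 * pi * (\<xi> \<bullet> x)))"
    have k: "integrable lborel k"
      unfolding k_def by (rule integrable_mult_bounded[OF G, of _ 1]) auto
    have Fk: "fourier_integral k y = complex_of_real (n^3 * gaussian (n *\<^sub>R (y - x)))" for y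
    proof -
      have "fourier_integral k y = fourier_integral G (y - x)"
        unfolding fourier_integral_def k_def
        by (rule Bochner_Integration.integral_cong) (auto simp: inner_diff_right cis_mult algebra_simps)
      then show ?thesis unfolding G_def fourier_integral_gaussian_dilate[OF n] .
    qed
    have "fourier_integral (\<lambda>\<xi>. G \<xi> * cnj (?F \<xi>)) x = (LINT \<xi>|lborel. cnj (?F \<xi> * k \<xi>))"
      unfolding fourier_integral_def[of "\<lambda>\<xi>. G \<xi> * cnj (?F \<xi>)"] k_def
      by (rule Bochner_Integration.integral_cong) (auto simp: G_def cis_cnj)
    also have "\<dots> = cnj (LINT \<xi>|lborel. ?F \<xi> * k \<xi>)"
      by (rule Bochner_Integration.integral_cnj)
    also have "(LINT \<xi>|lborel. ?F \<xi> * k \<xi>) = (LINT y|lborel. f y * fourier_integral k y)"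
      by (rule fourier_integral_multiplication_formula[OF f k])
    also have "\<dots> = (LINT u|lborel. f (x + u) * fourier_integral k (x + u))"
      using fourier_integral_measurable[OF borel_measurable_integrable[OF k, simplified]]
      by (intro integral_lborel_translate[symmetric]) auto
    also have "\<dots> = (LINT u|lborel. complex_of_real (n^3) * (complex_of_real (gaussian (n *\<^sub>R u)) * f ((1 / n) *\<^sub>R (n *\<^sub>R u) + x)))"
      using n by (simp add: Fk mult_ac add.commute)
    also have "\<dots> = complex_of_real (n^3) * (LINT u|lborel. complex_of_real (gaussian (n *\<^sub>R u)) * f ((1 / n) *\<^sub>R (n *\<^sub>R u) + x))"
      by simp
    also have "(LINT u|lborel. complex_of_real (gaussian (n *\<^sub>R u)) * f ((1 / n) *\<^sub>R (n *\<^sub>R u) + x))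
        = (1 / n^3) *\<^sub>R (LINT w|lborel. complex_of_real (gaussian w) * f ((1 / n) *\<^sub>R w + x))"
      by (rule integral_lborel_dilate[OF _ n]) measurable
    finally show ?thesis using n by (simp add: scaleR_conv_of_real)
  qed
  define h where "h = (\<lambda>w x. complex_of_real (gaussian w) * (f x * cnj (f ((1 / n) *\<^sub>R w + x))))"
  have h_meas[measurable]: "case_prod h \<in> borel_measurable (borel \<Otimes>\<^sub>M borel)"
    unfolding h_def by measurable
  have sq: "square_integrable (\<lambda>x. f (v + x))" for v by (rule square_integrable_translate[OF f2])
  have ih: "integrable lborel (\<lambda>x. h w x)" for w
    unfolding h_def
    by (intro integrable_mult_right Bochner_Integration.integrable_bound[OF square_integrable_norm_mult[OF f2 sq[of "(1 / n) *\<^sub>R w"]]])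
       (auto simp: norm_mult)
  have hbound: "(LINT x|lborel. norm (h w x)) \<le> gaussian w * (norm (cls f))\<^sup>2" for w
  proof -
    have "(LINT x|lborel. norm (h w x)) = (LINT x|lborel. gaussian w * (norm (f x) * norm (f ((1 / n) *\<^sub>R w + x))))"
      using gaussian_pos[of w] by (simp add: h_def norm_mult)
    also have "\<dots> = gaussian w * (LINT x|lborel. norm (f x) * norm (f ((1 / n) *\<^sub>R w + x)))" by simp
    also have "(LINT x|lborel. norm (f x) * norm (f ((1 / n) *\<^sub>R w + x))) = cls (\<lambda>x. norm (f x)) \<bullet> cls (\<lambda>x. norm (f ((1 / n) *\<^sub>R w + x)))"
    proof (subst inner_cls)
      show "square_integrable (\<lambda>x. norm (f x))" "square_integrable (\<lambda>x. norm (f ((1 / n) *\<^sub>R w + x)))"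
        by (rule square_integrable_bound[OF f2, of _ 1] square_integrable_bound[OF sq[of "(1 / n) *\<^sub>R w"], of _ 1]; simp)+
    qed simp
    also have "\<dots> \<le> norm (cls (\<lambda>x. norm (f x))) * norm (cls (\<lambda>x. norm (f ((1 / n) *\<^sub>R w + x))))"
      by (rule norm_cauchy_schwarz)
    also have "\<dots> \<le> norm (cls f) * norm (cls f)"
    proof (intro mult_mono)
      show "norm (cls (\<lambda>x. norm (f x))) \<le> norm (cls f)"
        by (intro norm_cls_mono square_integrable_bound[OF f2, of _ 1] f2) auto
      have "norm (cls (\<lambda>x. norm (f ((1 / n) *\<^sub>R w + x)))) \<le> norm (cls (\<lambda>x. f ((1 / n) *\<^sub>R w + x)))"
        by (intro norm_cls_mono square_integrable_bound[OF sq, of _ 1] sq) auto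
      then show "norm (cls (\<lambda>x. norm (f ((1 / n) *\<^sub>R w + x)))) \<le> norm (cls f)"
        by (simp only: norm_cls_translate[OF f2])
    qed auto
    finally show ?thesis using gaussian_pos[of w] by (simp add: power2_eq_square mult_left_mono)
  qed
  have "integrable (lborel \<Otimes>\<^sub>M lborel) (case_prod h)"
  proof (rule lborel_pair.Fubini_integrable)
    show "AE w in lborel. integrable lborel (\<lambda>x. case (w, x) of (w, x) \<Rightarrow> h w x)" using ih by simp
    have "(\<lambda>w. LINT x|lborel. norm (h w x)) \<in> borel_measurable borel"
      by (rule lborel.borel_measurable_lebesgue_integral) measurable
    then show "integrable lborel (\<lambda>w. LINT x|lborel. norm (case (w, x) of (w, x) \<Rightarrow> h w x))"
      using hbound gaussian_pos
      by (intro Bochner_Integration.integrable_bound[OF integrable_mult_left[OF gaussian_integrable, of "(norm (cls f))\<^sup>2"]])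
         (auto intro!: AE_I2 simp: abs_mult integral_nonneg_AE less_imp_le)
  qed measurable
  then have fub: "(LINT x|lborel. LINT w|lborel. h w x) = (LINT w|lborel. LINT x|lborel. h w x)"
    by (rule lborel_pair.Fubini_integral)
  have "complex_of_real (LINT \<xi>|lborel. gaussian ((1 / n) *\<^sub>R \<xi>) * (norm (?F \<xi>))\<^sup>2)
      = (LINT \<xi>|lborel. ?F \<xi> * (G \<xi> * cnj (?F \<xi>)))"
    unfolding integral_complex_of_real[symmetric]
    by (rule Bochner_Integration.integral_cong) (simp_all only: G_def of_real_mult complex_norm_square mult_ac)
  also have "\<dots> = (LINT x|lborel. f x * fourier_integral (\<lambda>\<xi>. G \<xi> * cnj (?F \<xi>)) x)"
    by (rule fourier_integral_multiplication_formula[OF f integrable_mult_bounded[OF G _, of _ C]]) (auto simp: FC)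
  also have "\<dots> = (LINT x|lborel. LINT w|lborel. h w x)"
    unfolding inner_eq h_def
    by (rule Bochner_Integration.integral_cong)
       (auto simp flip: Bochner_Integration.integral_cnj integral_mult_right_zero simp: mult_ac)
  also note fub
  also have "(LINT w|lborel. LINT x|lborel. h w x)
      = (LINT w|lborel. complex_of_real (gaussian w) * (LINT x|lborel. f x * cnj (f ((1 / n) *\<^sub>R w + x))))"
    unfolding h_def by simp
  finally have eq: "complex_of_real (LINT \<xi>|lborel. gaussian ((1 / n) *\<^sub>R \<xi>) * (norm (?F \<xi>))\<^sup>2)
      = (LINT w|lborel. complex_of_real (gaussian w) * (LINT x|lborel. f x * cnj (f ((1 / n) *\<^sub>R w + x))))" .
  have int: "integrable lborel (\<lambda>w. complex_of_real (gaussian w) * (LINT x|lborel. f x * cnj (f ((1 / n) *\<^sub>R w + x))))"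
    using lborel_pair.integrable_fst'[OF \<open>integrable (lborel \<Otimes>\<^sub>M lborel) (case_prod h)\<close>] unfolding h_def by simp
  have int': "integrable lborel (\<lambda>x. f x * cnj (f (v + x)))" for v
    by (rule Bochner_Integration.integrable_bound[OF square_integrable_norm_mult[OF f2 sq[of v]]]) (auto simp: norm_mult)
  have Re: "Re (complex_of_real (gaussian w) * (LINT x|lborel. f x * cnj (f ((1 / n) *\<^sub>R w + x))))
      = gaussian w * (cls f \<bullet> cls (\<lambda>x. f ((1 / n) *\<^sub>R w + x)))" for w
    by (simp add: inner_cls f2 sq inner_complex_def integral_Re[OF int', symmetric])
  have "(LINT \<xi>|lborel. gaussian ((1 / n) *\<^sub>R \<xi>) * (norm (?F \<xi>))\<^sup>2)
      = Re (LINT w|lborel. complex_of_real (gaussian w) * (LINT x|lborel. f x * cnj (f ((1 / n) *\<^sub>R w + x))))"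
    using arg_cong[OF eq, of Re] by simp
  also have "\<dots> = (LINT w|lborel. gaussian w * (cls f \<bullet> cls (\<lambda>x. f ((1 / n) *\<^sub>R w + x))))"
    unfolding integral_Re[OF int, symmetric] Re ..
  finally show ?thesis .
qed

text \<open>The autocorrelation is continuous at 0 because translation is continuous in \<open>L\<^sup>2\<close>.\<close>

lemma gaussian_damped_energy_tendsto:
  assumes f: "integrable lborel f" and f2: "square_integrable f"
  shows "(\<lambda>n. LINT \<xi>|lborel. gaussian ((1 / real (Suc n)) *\<^sub>R \<xi>) * (norm (fourier_integral f \<xi>))\<^sup>2)
     \<longlonglongrightarrow> (norm (cls f))\<^sup>2"
proof -
  have [measurable]: "f \<in> borel_measurable borel" using f by auto
  have sq: "square_integrable (\<lambda>x. f (v + x))" for v by (rule square_integrable_translate[OF f2])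
  have "(\<lambda>n. LINT w|lborel. gaussian w * (cls f \<bullet> cls (\<lambda>x. f ((1 / real (Suc n)) *\<^sub>R w + x))))
      \<longlonglongrightarrow> (LINT w|lborel. gaussian w * (cls f \<bullet> cls f))"
  proof (rule integral_dominated_convergence[where w = "\<lambda>w. gaussian w * (norm (cls f))\<^sup>2"])
    show "integrable lborel (\<lambda>w. gaussian w * (norm (cls f))\<^sup>2)"
      by (intro integrable_mult_left gaussian_integrable)
    show "AE w in lborel. (\<lambda>n. gaussian w * (cls f \<bullet> cls (\<lambda>x. f ((1 / real (Suc n)) *\<^sub>R w + x)))) \<longlonglongrightarrow> gaussian w * (cls f \<bullet> cls f)"
    proof (intro AE_I2 tendsto_intros translate_L2_tendsto[OF f2])
      fix w :: "real^3"
      have "(\<lambda>n. (1 / real (Suc n)) *\<^sub>R w) \<longlonglongrightarrow> 0 *\<^sub>R w"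
        by (intro tendsto_intros LIMSEQ_Suc[OF lim_1_over_n])
      then show "(\<lambda>n. (1 / real (Suc n)) *\<^sub>R w) \<longlonglongrightarrow> 0" by simp
    qed
    show "AE w in lborel. norm (gaussian w * (cls f \<bullet> cls (\<lambda>x. f ((1 / real (Suc n)) *\<^sub>R w + x)))) \<le> gaussian w * (norm (cls f))\<^sup>2" for n
    proof (rule AE_I2)
      fix w
      have "\<bar>cls f \<bullet> cls (\<lambda>x. f ((1 / real (Suc n)) *\<^sub>R w + x))\<bar> \<le> norm (cls f) * norm (cls (\<lambda>x. f ((1 / real (Suc n)) *\<^sub>R w + x)))"
        by (rule Cauchy_Schwarz_ineq2)
      then show "norm (gaussian w * (cls f \<bullet> cls (\<lambda>x. f ((1 / real (Suc n)) *\<^sub>R w + x)))) \<le> gaussian w * (norm (cls f))\<^sup>2"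
        using gaussian_pos[of w] unfolding norm_cls_translate[OF f2]
        by (simp add: abs_mult power2_eq_square mult_left_mono less_imp_le)
    qed
    show "(\<lambda>w. gaussian w * (cls f \<bullet> cls (\<lambda>x. f ((1 / real (Suc n)) *\<^sub>R w + x)))) \<in> borel_measurable lborel" for n
    proof -
      have "(\<lambda>w. LINT x|lborel. f x \<bullet> f ((1 / real (Suc n)) *\<^sub>R w + x)) \<in> borel_measurable borel"
        by (rule lborel.borel_measurable_lebesgue_integral) measurable
      then show ?thesis by (simp add: inner_cls f2 sq)
    qed
  qed (simp add: gaussian_measurable)
  moreover have "(LINT w|lborel. gaussian w * (cls f \<bullet> cls f)) = (norm (cls f))\<^sup>2"
    by (simp add: gaussian_integral power2_norm_eq_inner)
  ultimately show ?thesis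
    by (subst gaussian_damped_energy[OF f f2]) auto
qed

text \<open>Fatou's lemma applied to the damped energies bounds the energy of the transform from above, and
  the damping factor being at most 1 bounds it from below.\<close>

theorem plancherel_integrable:
  assumes f: "integrable lborel f" and f2: "square_integrable f"
  shows "square_integrable (fourier_integral f)" "norm (cls (fourier_integral f)) = norm (cls f)"
proof -
  have [measurable]: "f \<in> borel_measurable borel" using f by auto
  let ?F = "fourier_integral f"
  define C where "C = (LINT x|lborel. norm (f x))"
  have FC: "norm (?F \<xi>) \<le> C" for \<xi> unfolding C_def by (rule norm_fourier_integral_le)
  have C0: "0 \<le> C" using FC norm_ge_zero order_trans by blast
  let ?g = "\<lambda>n \<xi>. gaussian ((1 / real (Suc n)) *\<^sub>R \<xi>)"
  note lim = gaussian_damped_energy_tendsto[OF f f2]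
  have ig: "integrable lborel (\<lambda>\<xi>. ?g n \<xi> * (norm (?F \<xi>))\<^sup>2)" for n
  proof (rule Bochner_Integration.integrable_bound)
    show "integrable lborel (\<lambda>x. ?g n x * C\<^sup>2)"
      by (intro integrable_mult_left integrable_lborel_dilate gaussian_integrable) auto
    show "AE x in lborel. norm (?g n x * (norm (?F x))\<^sup>2) \<le> norm (?g n x * C\<^sup>2)"
      using gaussian_pos FC C0 by (intro AE_I2) (auto simp: abs_mult intro!: mult_left_mono power_mono)
  qed auto
  have glim: "(\<lambda>n. ?g n \<xi> * (norm (?F \<xi>))\<^sup>2) \<longlonglongrightarrow> (norm (?F \<xi>))\<^sup>2" for \<xi>
  proof -
    have "(\<lambda>n. exp (- pi * (norm ((1 / real (Suc n)) *\<^sub>R \<xi>))\<^sup>2) * (norm (?F \<xi>))\<^sup>2) \<longlonglongrightarrow> exp (- pi * (norm (0 *\<^sub>R \<xi>))\<^sup>2) * (norm (?F \<xi>))\<^sup>2"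
      by (intro tendsto_intros LIMSEQ_Suc[OF lim_1_over_n])
    then show ?thesis by (simp add: gaussian_def)
  qed
  have "(\<integral>\<^sup>+\<xi>. ennreal ((norm (?F \<xi>))\<^sup>2) \<partial>lborel) = (\<integral>\<^sup>+\<xi>. liminf (\<lambda>n. ennreal (?g n \<xi> * (norm (?F \<xi>))\<^sup>2)) \<partial>lborel)"
    by (intro nn_integral_cong lim_imp_Liminf[OF sequentially_bot, symmetric] tendsto_ennrealI glim)
  also have "\<dots> \<le> liminf (\<lambda>n. \<integral>\<^sup>+\<xi>. ennreal (?g n \<xi> * (norm (?F \<xi>))\<^sup>2) \<partial>lborel)"
    by (rule nn_integral_liminf) measurable
  also have "\<dots> = liminf (\<lambda>n. ennreal (LINT \<xi>|lborel. ?g n \<xi> * (norm (?F \<xi>))\<^sup>2))"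
    using gaussian_pos by (subst nn_integral_eq_integral[OF ig]) (auto simp: less_imp_le)
  also have "\<dots> = ennreal ((norm (cls f))\<^sup>2)"
    by (intro lim_imp_Liminf[OF sequentially_bot] tendsto_ennrealI lim)
  finally have le: "(\<integral>\<^sup>+\<xi>. ennreal ((norm (?F \<xi>))\<^sup>2) \<partial>lborel) \<le> ennreal ((norm (cls f))\<^sup>2)" .
  have "integrable lborel (\<lambda>\<xi>. (norm (?F \<xi>))\<^sup>2)"
    using le by (intro integrableI_nonneg) (auto intro: le_less_trans)
  then show F2: "square_integrable ?F" by (intro square_integrableI) auto
  show "norm (cls ?F) = norm (cls f)"
  proof (rule power2_eq_imp_eq[OF antisym])
    show "(norm (cls ?F))\<^sup>2 \<le> (norm (cls f))\<^sup>2"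
      using le unfolding nn_integral_norm_cls[OF F2] by simp
    show "(norm (cls f))\<^sup>2 \<le> (norm (cls ?F))\<^sup>2"
    proof (rule LIMSEQ_le_const2[OF lim], intro exI allI impI)
      fix n
      show "(LINT \<xi>|lborel. ?g n \<xi> * (norm (?F \<xi>))\<^sup>2) \<le> (norm (cls ?F))\<^sup>2"
        unfolding norm_cls2[OF F2]
        using gaussian_le_1 by (intro integral_mono ig square_integrable_norm2[OF F2] mult_left_le_one_le) (auto simp: gaussian_pos less_imp_le)
    qed
  qed auto
qed

section \<open>The Fourier transform on square integrable functions\<close>

definition truncate_to_ball :: "nat \<Rightarrow> (real^3 \<Rightarrow> complex) \<Rightarrow> real^3 \<Rightarrow> complex" where
  "truncate_to_ball n f x = indicator (cball 0 (real n)) x *\<^sub>R f x"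

lemma pred_mem_cball[measurable]: "Measurable.pred borel (\<lambda>x::real^3. x \<in> cball c r)"
  using borel_closed[OF closed_cball[of c r]] by (simp add: pred_def)

lemma fourier_trunc_eq: "fourier_trunc (real n) f = fourier_integral (truncate_to_ball n f)"
  unfolding fourier_trunc_def fourier_integral_def set_lebesgue_integral_def truncate_to_ball_def
  by (intro ext) simp

lemma square_integrable_truncate: "square_integrable f \<Longrightarrow> square_integrable (truncate_to_ball n f)"
  unfolding truncate_to_ball_def
  by (rule square_integrable_bound[where c = 1])
     (auto dest: square_integrable_measurable simp: indicator_def intro!: AE_I2)

lemma square_integrable_indicator_cball:
  "square_integrable (indicator (cball (0::real^3) r) :: _ \<Rightarrow> complex)"
proof (rule square_integrableI)
  have "integrable lborel (indicator (cball (0::real^3) r) :: _ \<Rightarrow> real)"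
    using emeasure_bounded_finite[OF bounded_cball[of "0::real^3" r]] by simp
  then show "integrable lborel (\<lambda>x. (norm (indicator (cball (0::real^3) r) x :: complex))\<^sup>2)"
    by (rule Bochner_Integration.integrable_bound) (auto simp: indicator_def)
qed measurable

lemma integrable_truncate:
  assumes f: "square_integrable f"
  shows "integrable lborel (truncate_to_ball n f)"
proof (rule Bochner_Integration.integrable_bound[OF square_integrable_norm_mult[OF square_integrable_indicator_cball f]])
  show "truncate_to_ball n f \<in> borel_measurable lborel"
    using square_integrable_measurable[OF square_integrable_truncate[OF f]] by simp
  show "AE x in lborel. norm (truncate_to_ball n f x) \<le> norm (cmod (indicator (cball 0 (real n)) x) * cmod (f x))"
    by (rule AE_I2) (simp add: truncate_to_ball_def indicator_def)
qed

lemma cls_truncate_tendsto: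
  assumes f: "square_integrable f"
  shows "(\<lambda>n. cls (truncate_to_ball n f)) \<longlonglongrightarrow> cls f"
proof -
  note t = square_integrable_truncate[OF f]
  have m[measurable]: "f \<in> borel_measurable borel" "truncate_to_ball n f \<in> borel_measurable borel" for n
    using square_integrable_measurable[OF f] square_integrable_measurable[OF t] by auto
  have "(\<lambda>n. LINT x|lborel. (norm (truncate_to_ball n f x - f x))\<^sup>2) \<longlonglongrightarrow> (LINT x|(lborel :: (real^3) measure). 0)"
  proof (rule integral_dominated_convergence[where w = "\<lambda>x. (norm (f x))\<^sup>2"])
    show "AE x in lborel. (\<lambda>n. (norm (truncate_to_ball n f x - f x))\<^sup>2) \<longlonglongrightarrow> 0"
    proof (rule AE_I2)
      fix x :: "real^3"
      obtain N :: nat where "norm x \<le> real N" using real_arch_simple by blast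
      then have "\<forall>n\<ge>N. (norm (truncate_to_ball n f x - f x))\<^sup>2 = 0"
        by (auto simp: truncate_to_ball_def indicator_def)
      then show "(\<lambda>n. (norm (truncate_to_ball n f x - f x))\<^sup>2) \<longlonglongrightarrow> 0"
        by (intro tendsto_eventually) (auto simp: eventually_sequentially)
    qed
    show "AE x in lborel. norm ((norm (truncate_to_ball n f x - f x))\<^sup>2) \<le> (norm (f x))\<^sup>2" for n
      by (rule AE_I2) (simp add: truncate_to_ball_def indicator_def)
  qed (auto intro: square_integrable_norm2 f)
  then have "(\<lambda>n. (norm (cls (truncate_to_ball n f) - cls f))\<^sup>2) \<longlonglongrightarrow> 0"
    by (simp add: cls_diff[symmetric] norm_cls2 square_integrable_diff t f)
  then have "(\<lambda>n. sqrt ((norm (cls (truncate_to_ball n f) - cls f))\<^sup>2)) \<longlonglongrightarrow> sqrt 0"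
    by (rule tendsto_real_sqrt)
  then show ?thesis by (simp add: tendsto_norm_zero_iff LIM_zero_iff)
qed

lemma plancherel_integrable_diff:
  assumes f: "integrable lborel f" "square_integrable f" and g: "integrable lborel g" "square_integrable g"
  shows "norm (cls (fourier_integral f) - cls (fourier_integral g)) = norm (cls f - cls g)"
proof -
  have "norm (cls f - cls g) = norm (cls (fourier_integral (\<lambda>x. f x - g x)))"
    using plancherel_integrable(2)[of "\<lambda>x. f x - g x"] f g
    by (simp add: cls_diff square_integrable_diff)
  also have "fourier_integral (\<lambda>x. f x - g x) = (\<lambda>\<xi>. fourier_integral f \<xi> - fourier_integral g \<xi>)"
    using f g by (intro ext fourier_integral_diff)
  finally show ?thesis using f g by (simp add: cls_diff plancherel_integrable(1))
qed

lemma nn_integral_diff_tendsto_iff: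
  assumes "\<And>n. square_integrable (F n)" "square_integrable g"
  shows "(\<lambda>n. \<integral>\<^sup>+ \<xi>. ennreal ((norm (F n \<xi> - g \<xi>))\<^sup>2) \<partial>lborel) \<longlonglongrightarrow> 0 \<longleftrightarrow> (\<lambda>n. cls (F n)) \<longlonglongrightarrow> cls g"
proof -
  have eq: "(\<lambda>n. \<integral>\<^sup>+ \<xi>. ennreal ((norm (F n \<xi> - g \<xi>))\<^sup>2) \<partial>lborel) = (\<lambda>n. ennreal ((norm (cls (F n) - cls g))\<^sup>2))"
    using assms by (simp add: nn_integral_norm_cls square_integrable_diff cls_diff)
  have "\<dots> \<longlonglongrightarrow> 0 \<longleftrightarrow> (\<lambda>n. (norm (cls (F n) - cls g))\<^sup>2) \<longlonglongrightarrow> 0"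
    unfolding ennreal_0[symmetric] by (rule tendsto_ennreal_iff) auto
  also have "\<dots> \<longleftrightarrow> (\<lambda>n. cls (F n)) \<longlonglongrightarrow> cls g"
    by (simp add: tendsto_norm_zero_iff LIM_zero_iff)
  finally show ?thesis unfolding eq .
qed

text \<open>By Plancherel's identity the transforms of the truncations of \<open>f\<close> form a Cauchy sequence together
  with the truncations themselves, so the choice in the definition of the transform has a witness.\<close>

lemma fourier_spec:
  assumes f: "square_integrable f"
  shows "square_integrable (fourier f)"
    "(\<lambda>n. cls (fourier_integral (truncate_to_ball n f))) \<longlonglongrightarrow> cls (fourier f)"
proof -
  let ?t = "\<lambda>n. truncate_to_ball n f"
  note t = integrable_truncate[OF f] square_integrable_truncate[OF f]
  have "Cauchy (\<lambda>n. cls (?t n))" using cls_truncate_tendsto[OF f] by (rule LIMSEQ_imp_Cauchy)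
  then have "Cauchy (\<lambda>n. cls (fourier_integral (?t n)))"
    unfolding Cauchy_iff by (simp add: plancherel_integrable_diff t)
  then obtain y where y: "(\<lambda>n. cls (fourier_integral (?t n))) \<longlonglongrightarrow> y"
    using Cauchy_convergent convergent_def by blast
  obtain g where g: "square_integrable g" "y = cls g" by (rule cls_cases)
  define P where "P = (\<lambda>g. square_integrable g \<and>
     (\<lambda>n::nat. \<integral>\<^sup>+ \<xi>. ennreal ((cmod (fourier_trunc (real n) f \<xi> - g \<xi>))\<^sup>2) \<partial>lborel) \<longlonglongrightarrow> 0)"
  have "P g"
    unfolding fourier_trunc_eq P_def
    using y g by (subst nn_integral_diff_tendsto_iff) (auto simp: plancherel_integrable(1) t)
  then have "P (Eps P)" by (rule someI[of P g])
  moreover have "fourier f = Eps P" by (simp add: fourier_def P_def)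
  ultimately have "P (fourier f)" by simp
  then show "square_integrable (fourier f)"
    "(\<lambda>n. cls (fourier_integral (truncate_to_ball n f))) \<longlonglongrightarrow> cls (fourier f)"
    unfolding fourier_trunc_eq P_def using nn_integral_diff_tendsto_iff[of "\<lambda>n. fourier_integral (?t n)" "fourier f"]
    by (auto simp: plancherel_integrable(1) t)
qed

lemma square_integrable_fourier: "square_integrable f \<Longrightarrow> square_integrable (fourier f)"
  by (rule fourier_spec)

text \<open>The transforms are equal everywhere, not just almost everywhere: the definition refers to the
  function only through integrals.\<close>

lemma fourier_cong_AE:
  assumes "f \<in> borel_measurable borel" "g \<in> borel_measurable borel" "AE x in lborel. f x = g x"
  shows "fourier f = fourier g"
proof -
  have "fourier_trunc R f = fourier_trunc R g" for R
  proof
    fix \<xi>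
    show "fourier_trunc R f \<xi> = fourier_trunc R g \<xi>"
      unfolding fourier_trunc_def set_lebesgue_integral_def
    proof (rule integral_cong_AE)
      note assms(1,2)[measurable]
      show "(\<lambda>x. indicator (cball 0 R) x *\<^sub>R (cis (- 2 * pi * (x \<bullet> \<xi>)) * f x)) \<in> borel_measurable lborel"
        "(\<lambda>x. indicator (cball 0 R) x *\<^sub>R (cis (- 2 * pi * (x \<bullet> \<xi>)) * g x)) \<in> borel_measurable lborel"
        by measurable
    qed (use assms(3) in eventually_elim, simp)
  qed
  then show ?thesis by (simp add: fourier_def[abs_def])
qed

theorem plancherel: "square_integrable f \<Longrightarrow> norm (cls (fourier f)) = norm (cls f)"
  using tendsto_norm[OF fourier_spec(2)[of f]] tendsto_norm[OF cls_truncate_tendsto[of f]]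
  by (intro LIMSEQ_unique[of "\<lambda>n. norm (cls (truncate_to_ball n f))"])
     (simp_all add: plancherel_integrable(2) integrable_truncate square_integrable_truncate)

lemma fourier_eq_fourier_integral:
  assumes f: "integrable lborel f" "square_integrable f"
  shows "AE \<xi> in lborel. fourier f \<xi> = fourier_integral f \<xi>"
proof -
  have "(\<lambda>n. norm (cls (truncate_to_ball n f) - cls f)) \<longlonglongrightarrow> 0"
    using cls_truncate_tendsto[OF f(2)] by (simp add: tendsto_norm_zero_iff LIM_zero_iff)
  then have "(\<lambda>n. norm (cls (fourier_integral (truncate_to_ball n f)) - cls (fourier_integral f))) \<longlonglongrightarrow> 0"
    by (simp add: plancherel_integrable_diff f integrable_truncate square_integrable_truncate)
  then have "(\<lambda>n. cls (fourier_integral (truncate_to_ball n f))) \<longlonglongrightarrow> cls (fourier_integral f)"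
    by (simp add: tendsto_norm_zero_iff LIM_zero_iff)
  then have "cls (fourier f) = cls (fourier_integral f)"
    using fourier_spec(2)[OF f(2)] LIMSEQ_unique by blast
  then show ?thesis
    using f by (simp add: cls_eq_iff square_integrable_fourier plancherel_integrable(1))
qed

lemma fourier_add:
  assumes f: "square_integrable f" and g: "square_integrable g"
  shows "AE \<xi> in lborel. fourier (\<lambda>x. f x + g x) \<xi> = fourier f \<xi> + fourier g \<xi>"
proof -
  note t = integrable_truncate square_integrable_truncate plancherel_integrable(1)
  have "fourier_integral (truncate_to_ball n (\<lambda>x. f x + g x))
     = (\<lambda>\<xi>. fourier_integral (truncate_to_ball n f) \<xi> + fourier_integral (truncate_to_ball n g) \<xi>)" for n
  proof
    fix \<xi>
    show "fourier_integral (truncate_to_ball n (\<lambda>x. f x + g x)) \<xi>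
     = fourier_integral (truncate_to_ball n f) \<xi> + fourier_integral (truncate_to_ball n g) \<xi>"
    proof -
      have i: "integrable lborel (\<lambda>x. cis (- 2 * pi * (x \<bullet> \<xi>)) * truncate_to_ball n h x)" if "square_integrable h" for h
        by (intro integrable_cis_mult t that) measurable
      show ?thesis
        unfolding fourier_integral_def Bochner_Integration.integral_add[OF i[OF f] i[OF g], symmetric]
        by (simp add: truncate_to_ball_def scaleR_add_right distrib_left)
    qed
  qed
  then have "(\<lambda>n. cls (fourier_integral (truncate_to_ball n (\<lambda>x. f x + g x)))) =
     (\<lambda>n. cls (fourier_integral (truncate_to_ball n f)) + cls (fourier_integral (truncate_to_ball n g)))"
    by (simp add: cls_add t f g)
  then have "(\<lambda>n. cls (fourier_integral (truncate_to_ball n (\<lambda>x. f x + g x)))) \<longlonglongrightarrow> cls (fourier f) + cls (fourier g)"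
    by (simp add: tendsto_add fourier_spec(2) f g)
  then have "cls (fourier (\<lambda>x. f x + g x)) = cls (fourier f) + cls (fourier g)"
    using fourier_spec(2)[OF square_integrable_add[OF f g]] LIMSEQ_unique by blast
  then show ?thesis
    by (simp add: cls_add[symmetric] cls_eq_iff square_integrable_fourier square_integrable_add f g)
qed

lemma fourier_scaleR:
  assumes f: "square_integrable f"
  shows "AE \<xi> in lborel. fourier (\<lambda>x. c *\<^sub>R f x) \<xi> = c *\<^sub>R fourier f \<xi>"
proof -
  note t = integrable_truncate square_integrable_truncate plancherel_integrable(1)
  have "fourier_integral (truncate_to_ball n (\<lambda>x. c *\<^sub>R f x)) = (\<lambda>\<xi>. c *\<^sub>R fourier_integral (truncate_to_ball n f) \<xi>)" for n
    unfolding fourier_integral_def truncate_to_ball_def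
    by (intro ext) (simp flip: integral_scaleR_right add: mult_ac scaleR_conv_of_real)
  then have "(\<lambda>n. cls (fourier_integral (truncate_to_ball n (\<lambda>x. c *\<^sub>R f x)))) =
     (\<lambda>n. c *\<^sub>R cls (fourier_integral (truncate_to_ball n f)))"
    by (simp add: cls_scaleR t f)
  then have "(\<lambda>n. cls (fourier_integral (truncate_to_ball n (\<lambda>x. c *\<^sub>R f x)))) \<longlonglongrightarrow> c *\<^sub>R cls (fourier f)"
    by (simp add: tendsto_scaleR fourier_spec(2) f)
  then have "cls (fourier (\<lambda>x. c *\<^sub>R f x)) = c *\<^sub>R cls (fourier f)"
    using fourier_spec(2)[OF square_integrable_scaleR[OF f]] LIMSEQ_unique by blast
  then show ?thesis
    by (simp add: cls_scaleR[symmetric] cls_eq_iff square_integrable_fourier square_integrable_scaleR f)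
qed

lemma cls_tendsto_isometry:
  assumes lim: "(\<lambda>n. cls (F n)) \<longlonglongrightarrow> cls g"
    and F: "\<And>n. square_integrable (F n)" and g: "square_integrable g"
    and T: "\<And>f. square_integrable f \<Longrightarrow> square_integrable (T f)"
    and iso: "\<And>f h. square_integrable f \<Longrightarrow> square_integrable h \<Longrightarrow> norm (cls (T f) - cls (T h)) = norm (cls f - cls h)"
  shows "(\<lambda>n. cls (T (F n))) \<longlonglongrightarrow> cls (T g)"
proof -
  have "(\<lambda>n. norm (cls (F n) - cls g)) \<longlonglongrightarrow> 0"
    using lim by (simp add: tendsto_norm_zero_iff LIM_zero_iff)
  then have "(\<lambda>n. norm (cls (T (F n)) - cls (T g))) \<longlonglongrightarrow> 0"
    by (simp add: iso F g)
  then show ?thesis by (simp add: tendsto_norm_zero_iff LIM_zero_iff)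
qed

lemma norm_cls_reflect_diff:
  assumes "square_integrable f" "square_integrable h"
  shows "norm (cls (\<lambda>x. f (- x)) - cls (\<lambda>x. h (- x))) = norm (cls f - cls h)"
  using norm_cls_reflect[OF square_integrable_diff[OF assms]] assms
  by (simp add: cls_diff square_integrable_reflect)

lemma fourier_reflected_limit:
  assumes f: "square_integrable f"
  shows "(\<lambda>n. cls (\<lambda>\<xi>. fourier_integral (truncate_to_ball n f) (- \<xi>))) \<longlonglongrightarrow> cls (\<lambda>\<xi>. fourier f (- \<xi>))"
  by (rule cls_tendsto_isometry[where T = "\<lambda>f x. f (- x)", OF fourier_spec(2)[OF f]])
     (auto intro: plancherel_integrable integrable_truncate square_integrable_truncate f square_integrable_fourier
        square_integrable_reflect norm_cls_reflect_diff)

lemma square_integrable_cnj: "square_integrable f \<Longrightarrow> square_integrable (\<lambda>x. cnj (f x))"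
  by (rule square_integrable_bound[where c = 1]) (auto dest!: square_integrable_measurable)

lemma norm_cls_cnj_diff:
  assumes "square_integrable f" "square_integrable h"
  shows "norm (cls (\<lambda>x. cnj (f x)) - cls (\<lambda>x. cnj (h x))) = norm (cls f - cls h)"
proof -
  have "norm (cls (\<lambda>x. cnj (f x) - cnj (h x))) = norm (cls (\<lambda>x. f x - h x))"
    using assms by (intro norm_cls_cong square_integrable_diff square_integrable_cnj)
       (auto simp flip: complex_cnj_diff)
  then show ?thesis using assms by (simp add: cls_diff square_integrable_cnj)
qed

lemma fourier_reflect:
  assumes f: "square_integrable f"
  shows "AE \<xi> in lborel. fourier (\<lambda>x. f (- x)) \<xi> = fourier f (- \<xi>)"
proof -
  have m: "truncate_to_ball n f \<in> borel_measurable borel" for n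
    by (intro square_integrable_measurable square_integrable_truncate f)
  have "fourier_integral (truncate_to_ball n (\<lambda>x. f (- x))) \<xi> = fourier_integral (truncate_to_ball n f) (- \<xi>)" for n \<xi>
  proof -
    note m[measurable]
    have "(\<lambda>x. cis (- 2 * pi * (x \<bullet> - \<xi>)) * truncate_to_ball n f x) \<in> borel_measurable borel" by measurable
    from integral_lborel_reflect[OF this] show ?thesis
      by (simp add: fourier_integral_def truncate_to_ball_def indicator_def)
  qed
  then have eq: "fourier_integral (truncate_to_ball n (\<lambda>x. f (- x))) = (\<lambda>\<xi>. fourier_integral (truncate_to_ball n f) (- \<xi>))" for n
    by auto
  have "(\<lambda>n. cls (\<lambda>\<xi>. fourier_integral (truncate_to_ball n f) (- \<xi>))) \<longlonglongrightarrow> cls (\<lambda>\<xi>. fourier f (- \<xi>))"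
    by (rule fourier_reflected_limit[OF f])
  moreover have "(\<lambda>n. cls (\<lambda>\<xi>. fourier_integral (truncate_to_ball n f) (- \<xi>))) \<longlonglongrightarrow> cls (fourier (\<lambda>x. f (- x)))"
    using fourier_spec(2)[OF square_integrable_reflect[OF f]] unfolding eq .
  ultimately have "cls (fourier (\<lambda>x. f (- x))) = cls (\<lambda>\<xi>. fourier f (- \<xi>))"
    using LIMSEQ_unique by blast
  then show ?thesis
    by (simp add: cls_eq_iff square_integrable_fourier square_integrable_reflect f)
qed

lemma fourier_cnj:
  assumes f: "square_integrable f"
  shows "AE \<xi> in lborel. fourier (\<lambda>x. cnj (f x)) \<xi> = cnj (fourier f (- \<xi>))"
proof -
  have eq: "fourier_integral (truncate_to_ball n (\<lambda>x. cnj (f x))) = (\<lambda>\<xi>. cnj (fourier_integral (truncate_to_ball n f) (- \<xi>)))" for n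
    unfolding fourier_integral_cnj[symmetric] by (simp add: truncate_to_ball_def[abs_def])
  have "(\<lambda>n. cls (\<lambda>\<xi>. fourier_integral (truncate_to_ball n f) (- \<xi>))) \<longlonglongrightarrow> cls (\<lambda>\<xi>. fourier f (- \<xi>))"
    by (rule fourier_reflected_limit[OF f])
  then have "(\<lambda>n. cls (\<lambda>\<xi>. cnj (fourier_integral (truncate_to_ball n f) (- \<xi>)))) \<longlonglongrightarrow> cls (\<lambda>\<xi>. cnj (fourier f (- \<xi>)))"
    by (rule cls_tendsto_isometry[where T = "\<lambda>f x. cnj (f x)"])
       (auto intro: plancherel_integrable integrable_truncate square_integrable_truncate f square_integrable_fourier
          square_integrable_reflect square_integrable_cnj norm_cls_cnj_diff)
  moreover have "(\<lambda>n. cls (\<lambda>\<xi>. cnj (fourier_integral (truncate_to_ball n f) (- \<xi>)))) \<longlonglongrightarrow> cls (fourier (\<lambda>x. cnj (f x)))"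
    using fourier_spec(2)[OF square_integrable_cnj[OF f]] unfolding eq .
  ultimately have "cls (fourier (\<lambda>x. cnj (f x))) = cls (\<lambda>\<xi>. cnj (fourier f (- \<xi>)))"
    using LIMSEQ_unique by blast
  then show ?thesis
    by (simp add: cls_eq_iff square_integrable_fourier square_integrable_reflect square_integrable_cnj f)
qed

subsection \<open>Inversion\<close>

definition inverse_fourier :: "(real^3 \<Rightarrow> complex) \<Rightarrow> real^3 \<Rightarrow> complex" where
  "inverse_fourier g x = fourier g (- x)"

lemma square_integrable_inverse_fourier: "square_integrable g \<Longrightarrow> square_integrable (inverse_fourier g)"
  unfolding inverse_fourier_def[abs_def] by (intro square_integrable_reflect square_integrable_fourier)

lemma norm_cls_inverse_fourier: "square_integrable g \<Longrightarrow> norm (cls (inverse_fourier g)) = norm (cls g)"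
  unfolding inverse_fourier_def[abs_def]
  by (subst norm_cls_reflect) (auto simp: square_integrable_fourier plancherel)

lemma fourier_integral_adjoint:
  assumes f: "integrable lborel f" "square_integrable f" and g: "integrable lborel g" "square_integrable g"
  shows "cls (fourier_integral f) \<bullet> cls g = cls f \<bullet> cls (\<lambda>x. fourier_integral g (- x))"
proof -
  note pl = plancherel_integrable(1)
  have g': "integrable lborel (\<lambda>x. cnj (g x))" using g by auto
  have mult_int: "integrable lborel (\<lambda>x. u x * cnj (v x))" if u: "square_integrable u" and v: "square_integrable v" for u v :: "real^3 \<Rightarrow> complex"
    by (rule Bochner_Integration.integrable_bound[OF square_integrable_norm_mult[OF u v]])
       (use u v in \<open>auto dest!: square_integrable_measurable simp: norm_mult\<close>)
  have "cls (fourier_integral f) \<bullet> cls g = (LINT \<xi>|lborel. Re (fourier_integral f \<xi> * cnj (g \<xi>)))"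
    by (simp add: inner_cls pl f g inner_complex_def)
  also have "\<dots> = Re (LINT \<xi>|lborel. fourier_integral f \<xi> * cnj (g \<xi>))"
    by (intro integral_Re mult_int pl f g)
  also have "(LINT \<xi>|lborel. fourier_integral f \<xi> * cnj (g \<xi>)) = (LINT x|lborel. f x * cnj (fourier_integral g (- x)))"
    unfolding fourier_integral_multiplication_formula[OF f(1) g'] fourier_integral_cnj ..
  also have "Re \<dots> = (LINT x|lborel. Re (f x * cnj (fourier_integral g (- x))))"
    by (intro integral_Re[symmetric] mult_int square_integrable_reflect pl f g)
  also have "\<dots> = cls f \<bullet> cls (\<lambda>x. fourier_integral g (- x))"
    by (simp add: inner_cls pl f g inner_complex_def square_integrable_reflect)
  finally show ?thesis .
qed

text \<open>The multiplication formula for truncations of \<open>f\<close> and of the conjugate of \<open>g\<close> passes to the limit.\<close>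

lemma fourier_adjoint:
  assumes f: "square_integrable f" and g: "square_integrable g"
  shows "cls (fourier f) \<bullet> cls g = cls f \<bullet> cls (inverse_fourier g)"
proof -
  note t = integrable_truncate square_integrable_truncate plancherel_integrable(1)
  have "(\<lambda>n. cls (\<lambda>\<xi>. fourier_integral (truncate_to_ball n g) (- \<xi>))) \<longlonglongrightarrow> cls (inverse_fourier g)"
    unfolding inverse_fourier_def[abs_def]
    by (rule fourier_reflected_limit[OF g])
  then have "(\<lambda>n. cls (truncate_to_ball n f) \<bullet> cls (\<lambda>\<xi>. fourier_integral (truncate_to_ball n g) (- \<xi>))) \<longlonglongrightarrow> cls f \<bullet> cls (inverse_fourier g)"
    by (intro tendsto_intros cls_truncate_tendsto f)
  moreover have "(\<lambda>n. cls (fourier_integral (truncate_to_ball n f)) \<bullet> cls (truncate_to_ball n g)) \<longlonglongrightarrow> cls (fourier f) \<bullet> cls g"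
    by (intro tendsto_intros cls_truncate_tendsto fourier_spec(2) f g)
  ultimately show ?thesis
    by (simp add: fourier_integral_adjoint t f g LIMSEQ_unique)
qed

text \<open>The transform \<open>F\<close> and its adjoint \<open>F\<^sup>*\<close> are both isometries, therefore
  \<open>\<parallel>F F\<^sup>* g - g\<parallel>\<^sup>2 = \<parallel>F\<^sup>* g\<parallel>\<^sup>2 - 2 \<parallel>F\<^sup>* g\<parallel>\<^sup>2 + \<parallel>g\<parallel>\<^sup>2 = 0\<close>.\<close>

theorem fourier_inverse_fourier:
  assumes g: "square_integrable g"
  shows "AE \<xi> in lborel. fourier (inverse_fourier g) \<xi> = g \<xi>"
proof -
  note i = square_integrable_inverse_fourier[OF g]
  let ?h = "cls (fourier (inverse_fourier g))"
  have "(norm (?h - cls g))\<^sup>2 = (norm ?h)\<^sup>2 - 2 * (?h \<bullet> cls g) + (norm (cls g))\<^sup>2"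
    by (simp add: power2_norm_eq_inner inner_diff inner_commute)
  also have "\<dots> = 0"
    by (simp add: fourier_adjoint plancherel norm_cls_inverse_fourier g i flip: power2_norm_eq_inner)
  finally show ?thesis
    using g i by (simp add: cls_eq_iff square_integrable_fourier)
qed

lemma fourier_eq_imp_eq:
  assumes f: "square_integrable f" and g: "square_integrable g" and eq: "AE \<xi> in lborel. fourier f \<xi> = fourier g \<xi>"
  shows "AE x in lborel. f x = g x"
proof -
  have "AE \<xi> in lborel. fourier (\<lambda>x. f x + (-1) *\<^sub>R g x) \<xi> = 0"
    using fourier_add[OF f square_integrable_scaleR[OF g, of "-1"]] fourier_scaleR[OF g, of "-1"] eq
    by eventually_elim simp
  then have "cls (fourier (\<lambda>x. f x - g x)) = 0"
    by (subst cls_zero[symmetric], subst cls_eq_iff) (auto intro: square_integrable_fourier square_integrable_diff f g)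
  then have "norm (cls (\<lambda>x. f x - g x)) = 0"
    using plancherel[OF square_integrable_diff[OF f g]] by simp
  then show ?thesis using f g by (simp add: cls_diff cls_eq_iff)
qed

lemma inverse_fourier_eq_integral:
  assumes g: "integrable lborel g" "square_integrable g"
  shows "AE x in lborel. inverse_fourier g x = (LINT \<xi>|lborel. cis (2 * pi * (x \<bullet> \<xi>)) * g \<xi>)"
proof -
  have "AE x in lborel. fourier g (- x) = fourier_integral g (- x)"
    using AE_lborel_reflect[OF fourier_eq_fourier_integral[OF g]] .
  then show ?thesis
    by (simp add: inverse_fourier_def fourier_integral_def inner_commute)
qed

lemma fourier_of_real_hermitian:
  assumes f: "square_integrable (\<lambda>x. complex_of_real (f x))"
  shows "AE \<xi> in lborel. fourier (\<lambda>x. complex_of_real (f x)) (- \<xi>) = cnj (fourier (\<lambda>x. complex_of_real (f x)) \<xi>)"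
  using AE_lborel_reflect[OF fourier_cnj[OF f]] by simp

text \<open>The conjugate and the reflection of a Hermitian function coincide, hence so do their transforms; one
  of these is the conjugate of the inverse transform of \<open>g\<close>, the other one the inverse transform itself.\<close>

lemma inverse_fourier_real:
  assumes g: "square_integrable g" and herm: "AE \<xi> in lborel. g (- \<xi>) = cnj (g \<xi>)"
  shows "AE x in lborel. inverse_fourier g x = complex_of_real (Re (inverse_fourier g x))"
proof -
  have [measurable]: "g \<in> borel_measurable borel" using g by (rule square_integrable_measurable)
  have "fourier (\<lambda>x. cnj (g x)) = fourier (\<lambda>x. g (- x))"
    using herm by (intro fourier_cong_AE) (auto elim: eventually_mono)
  then have "AE \<xi> in lborel. cnj (fourier g (- \<xi>)) = fourier g (- \<xi>)"
    using fourier_cnj[OF g] fourier_reflect[OF g] by (auto elim: eventually_elim2)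
  then show ?thesis
    unfolding inverse_fourier_def by eventually_elim (simp add: complex_eq_iff)
qed

section \<open>Sobolev spaces in terms of the Fourier transform\<close>

abbreviation fourier_real :: "(real^3 \<Rightarrow> real) \<Rightarrow> real^3 \<Rightarrow> complex" where
  "fourier_real f \<equiv> fourier (\<lambda>x. complex_of_real (f x))"

lemma fourier_comp_axis: "fourier_comp v (axis i 1) = fourier_real (\<lambda>x. v x $ i)"
  by (simp add: fourier_comp_def inner_axis)

lemma fourier_vec_nth: "fourier_vec v \<xi> $ i = fourier_real (\<lambda>x. v x $ i) \<xi>"
  by (simp add: fourier_vec_def fourier_comp_axis)

lemma fourier_comp_real: "fourier_comp f (1::real) = fourier_real f"
  by (simp add: fourier_comp_def)

lemma sum_Basis_vec3: "(\<Sum>b\<in>(Basis :: (real^3) set). h b) = (\<Sum>i\<in>UNIV. h (axis i 1))"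
proof -
  have eq: "(Basis :: (real^3) set) = (\<lambda>i. axis i 1) ` UNIV" by (auto simp: Basis_vec_def)
  have inj: "inj (\<lambda>i::3. axis i (1::real))" by (auto simp: inj_on_def axis_eq_axis)
  show ?thesis unfolding eq sum.reindex[OF inj] o_def ..
qed

lemma borel_measurable_nth3[measurable (raw)]:
  fixes f :: "'b \<Rightarrow> 'a::euclidean_space ^ 3"
  assumes "f \<in> borel_measurable M"
  shows "(\<lambda>x. f x $ i) \<in> borel_measurable M"
proof -
  have "(\<lambda>y :: 'a^3. y $ i) \<in> borel_measurable borel"
    by (intro borel_measurable_continuous_onI continuous_intros)
  from measurable_compose[OF assms this] show ?thesis .
qed

lemma norm2_vec3: "(norm (x :: 'a::real_normed_vector ^ 3))\<^sup>2 = (\<Sum>i\<in>UNIV. (norm (x $ i))\<^sup>2)"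
  by (simp add: norm_vec_def L2_set_def sum_nonneg)

lemma square_integrable_of_real:
  "square_integrable f \<Longrightarrow> square_integrable (\<lambda>x. complex_of_real (f x))"
  by (rule square_integrable_bound[where c = 1]) (auto dest!: square_integrable_measurable)

lemma square_integrable_nth:
  fixes v :: "real^3 \<Rightarrow> 'a::euclidean_space ^ 3"
  shows "square_integrable v \<Longrightarrow> square_integrable (\<lambda>x. v x $ i)"
  by (rule square_integrable_bound[where c = 1])
     (auto dest!: square_integrable_measurable simp: Finite_Cartesian_Product.norm_nth_le)

lemma square_integrable_vec_lambda:
  fixes v :: "real^3 \<Rightarrow> 'a::euclidean_space ^ 3"
  assumes "\<And>i. square_integrable (\<lambda>x. v x $ i)"
  shows "square_integrable v"
proof (rule square_integrableI)
  have [measurable]: "(\<lambda>x. v x $ i) \<in> borel_measurable borel" for i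
    using assms by (rule square_integrable_measurable)
  show "v \<in> borel_measurable borel"
  proof (subst borel_measurable_euclidean_space, rule ballI)
    fix b :: "'a^3" assume "b \<in> Basis"
    then obtain i u where b: "b = axis i u" by (auto simp: Basis_vec_def)
    show "(\<lambda>x. v x \<bullet> b) \<in> borel_measurable borel"
      unfolding b inner_axis by measurable
  qed
  show "integrable lborel (\<lambda>x. (norm (v x))\<^sup>2)"
    unfolding norm2_vec3 by (intro Bochner_Integration.integrable_sum square_integrable_norm2 assms)
qed

lemma square_integrable_fourier_real: "square_integrable f \<Longrightarrow> square_integrable (fourier_real f)"
  by (intro square_integrable_fourier square_integrable_of_real)

lemma square_integrable_fourier_vec: "square_integrable v \<Longrightarrow> square_integrable (fourier_vec v)"
  by (rule square_integrable_vec_lambda) (simp add: fourier_vec_nth square_integrable_fourier_real square_integrable_nth)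

lemma fourier_real_cong_AE:
  assumes "f \<in> borel_measurable borel" "g \<in> borel_measurable borel" "AE x in lborel. f x = g x"
  shows "fourier_real f = fourier_real g"
  using assms by (intro fourier_cong_AE) auto

lemma fourier_vec_cong_AE:
  assumes [measurable]: "v \<in> borel_measurable borel" "w \<in> borel_measurable borel" and eq: "AE x in lborel. v x = w x"
  shows "fourier_vec v = fourier_vec w"
proof (intro ext, simp add: vec_eq_iff fourier_vec_nth, intro allI)
  fix \<xi> i
  have "(\<lambda>x. v x $ i) \<in> borel_measurable borel" "(\<lambda>x. w x $ i) \<in> borel_measurable borel" by measurable
  then have "fourier_real (\<lambda>x. v x $ i) = fourier_real (\<lambda>x. w x $ i)"
    using eq by (intro fourier_real_cong_AE) (auto elim: eventually_mono)
  then show "fourier_real (\<lambda>x. v x $ i) \<xi> = fourier_real (\<lambda>x. w x $ i) \<xi>" by simp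
qed

lemma fourier_real_add:
  assumes "square_integrable f" "square_integrable g"
  shows "AE \<xi> in lborel. fourier_real (\<lambda>x. f x + g x) \<xi> = fourier_real f \<xi> + fourier_real g \<xi>"
  using fourier_add[OF assms[THEN square_integrable_of_real]] by simp

lemma fourier_real_scaleR:
  assumes "square_integrable f"
  shows "AE \<xi> in lborel. fourier_real (\<lambda>x. c * f x) \<xi> = c *\<^sub>R fourier_real f \<xi>"
  using fourier_scaleR[OF assms[THEN square_integrable_of_real], of c] by (simp add: scaleR_conv_of_real)

lemma AE_all_3: "(\<And>i::3. AE x in M. P i x) \<Longrightarrow> AE x in M. \<forall>i. P i x"
  by (simp add: AE_all_countable)

lemma fourier_vec_add:
  assumes "square_integrable v" "square_integrable w"
  shows "AE \<xi> in lborel. fourier_vec (\<lambda>x. v x + w x) \<xi> = fourier_vec v \<xi> + fourier_vec w \<xi>"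
  unfolding vec_eq_iff
  by (rule AE_all_3) (use fourier_real_add[OF assms[THEN square_integrable_nth]] in \<open>simp add: fourier_vec_nth\<close>)

lemma fourier_vec_scaleR:
  assumes "square_integrable v"
  shows "AE \<xi> in lborel. fourier_vec (\<lambda>x. c *\<^sub>R v x) \<xi> = c *\<^sub>R fourier_vec v \<xi>"
  unfolding vec_eq_iff
  by (rule AE_all_3) (use fourier_real_scaleR[OF assms[THEN square_integrable_nth]] in \<open>simp add: fourier_vec_nth\<close>)

lemma fourier_vec_eq_imp_eq:
  assumes v: "square_integrable v" and w: "square_integrable w"
    and eq: "AE \<xi> in lborel. fourier_vec v \<xi> = fourier_vec w \<xi>"
  shows "AE x in lborel. v x = w x"
  unfolding vec_eq_iff
proof (rule AE_all_3)
  fix i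
  have "AE \<xi> in lborel. fourier_vec v \<xi> $ i = fourier_vec w \<xi> $ i"
    using eq by eventually_elim simp
  then have "AE \<xi> in lborel. fourier_real (\<lambda>x. v x $ i) \<xi> = fourier_real (\<lambda>x. w x $ i) \<xi>"
    by (simp only: fourier_vec_nth)
  then have "AE x in lborel. complex_of_real (v x $ i) = complex_of_real (w x $ i)"
    by (rule fourier_eq_imp_eq[OF square_integrable_of_real[OF square_integrable_nth[OF v]]
          square_integrable_of_real[OF square_integrable_nth[OF w]]])
  then show "AE x in lborel. v x $ i = w x $ i" by simp
qed

definition hermitian :: "(real^3 \<Rightarrow> complex) \<Rightarrow> bool" where
  "hermitian g \<longleftrightarrow> (AE \<xi> in lborel. g (- \<xi>) = cnj (g \<xi>))"

lemma hermitian_fourier_real: "square_integrable f \<Longrightarrow> hermitian (fourier_real f)"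
  unfolding hermitian_def by (intro fourier_of_real_hermitian square_integrable_of_real)

lemma fourier_real_inverse:
  assumes g: "square_integrable g" and herm: "hermitian g"
  shows "square_integrable (\<lambda>x. Re (inverse_fourier g x))"
    "AE \<xi> in lborel. fourier_real (\<lambda>x. Re (inverse_fourier g x)) \<xi> = g \<xi>"
proof -
  note i = square_integrable_inverse_fourier[OF g]
  have [measurable]: "inverse_fourier g \<in> borel_measurable borel" by (rule square_integrable_measurable[OF i])
  show "square_integrable (\<lambda>x. Re (inverse_fourier g x))"
    by (rule square_integrable_bound[OF i, of _ 1]) (auto simp: abs_Re_le_cmod)
  have "fourier_real (\<lambda>x. Re (inverse_fourier g x)) = fourier (inverse_fourier g)"
    using inverse_fourier_real[OF g herm[unfolded hermitian_def]]
    by (intro fourier_cong_AE) (auto elim: eventually_mono)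
  then show "AE \<xi> in lborel. fourier_real (\<lambda>x. Re (inverse_fourier g x)) \<xi> = g \<xi>"
    using fourier_inverse_fourier[OF g] by simp
qed

lemma fourier_vec_surj:
  assumes g: "square_integrable g" and herm: "\<And>i. hermitian (\<lambda>\<xi>. g \<xi> $ i)"
  shows "\<exists>v. square_integrable v \<and> (AE \<xi> in lborel. fourier_vec v \<xi> = g \<xi>)"
proof (intro exI conjI)
  let ?v = "\<lambda>x. \<chi> i. Re (inverse_fourier (\<lambda>\<xi>. g \<xi> $ i) x)"
  note gi = square_integrable_nth[OF g]
  show "square_integrable ?v"
  proof (rule square_integrable_vec_lambda)
    fix i show "square_integrable (\<lambda>x. ?v x $ i)"
      using fourier_real_inverse(1)[OF gi[of i] herm[of i]] by simp
  qed
  show "AE \<xi> in lborel. fourier_vec ?v \<xi> = g \<xi>"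
    unfolding vec_eq_iff
  proof (rule AE_all_3)
    fix i show "AE \<xi> in lborel. fourier_vec ?v \<xi> $ i = g \<xi> $ i"
      using fourier_real_inverse(2)[OF gi[of i] herm[of i]] by (simp add: fourier_vec_nth)
  qed
qed

subsection \<open>The weight\<close>

lemma sobolev_weight_measurable[measurable]: "sobolev_weight s \<in> borel_measurable borel"
  unfolding sobolev_weight_def[abs_def] by measurable

lemma sobolev_weight_pos: "0 < sobolev_weight s \<xi>"
proof -
  have "0 < 1 + 4 * pi\<^sup>2 * (norm \<xi>)\<^sup>2" by (intro add_pos_nonneg) auto
  then show ?thesis unfolding sobolev_weight_def by simp
qed

lemma sobolev_weight_ge_1: "0 \<le> s \<Longrightarrow> 1 \<le> sobolev_weight s \<xi>"
  unfolding sobolev_weight_def by (rule ge_one_powr_ge_zero) auto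

lemma sobolev_weight_uminus: "sobolev_weight s (- \<xi>) = sobolev_weight s \<xi>"
  by (simp add: sobolev_weight_def)

lemma sobolev_weight_half: "(sobolev_weight (s / 2) \<xi>)\<^sup>2 = sobolev_weight s \<xi>"
  unfolding sobolev_weight_def power2_eq_square by (simp flip: powr_add)

subsection \<open>Sobolev functions as elements of a Hilbert space\<close>

lemma weighted_norm2:
  fixes z :: "'a::real_normed_vector"
  shows "(norm (sobolev_weight (s / 2) \<xi> *\<^sub>R z))\<^sup>2 = sobolev_weight s \<xi> * (norm z)\<^sup>2"
  by (simp add: power_mult_distrib sobolev_weight_half)

definition weighted_real :: "real \<Rightarrow> (real^3 \<Rightarrow> real) \<Rightarrow> real^3 \<Rightarrow> complex" where
  "weighted_real s f \<xi> = sobolev_weight (s / 2) \<xi> *\<^sub>R fourier_real f \<xi>"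

definition weighted_vec :: "real \<Rightarrow> (real^3 \<Rightarrow> real^3) \<Rightarrow> real^3 \<Rightarrow> complex^3" where
  "weighted_vec s v \<xi> = sobolev_weight (s / 2) \<xi> *\<^sub>R fourier_vec v \<xi>"

lemma weighted_real_norm2: "(norm (weighted_real s f \<xi>))\<^sup>2 = sobolev_weight s \<xi> * (norm (fourier_real f \<xi>))\<^sup>2"
  unfolding weighted_real_def by (rule weighted_norm2)

lemma weighted_vec_norm2: "(norm (weighted_vec s v \<xi>))\<^sup>2 = sobolev_weight s \<xi> * (norm (fourier_vec v \<xi>))\<^sup>2"
  unfolding weighted_vec_def by (rule weighted_norm2)

lemma sobolev_real_iff:
  "f \<in> sobolev s \<longleftrightarrow> square_integrable f \<and> square_integrable (weighted_real s f)"
proof -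
  have "weighted_real s f \<in> borel_measurable borel" if "square_integrable f"
    using square_integrable_measurable[OF square_integrable_fourier_real[OF that]]
    unfolding weighted_real_def[abs_def] by measurable
  then show ?thesis
    unfolding sobolev_def square_integrable_def[of "weighted_real s f"]
    by (auto simp: weighted_real_norm2 fourier_comp_real)
qed

lemma sobolev_norm_real:
  assumes "f \<in> sobolev s"
  shows "sobolev_norm s f = norm (cls (weighted_real s f))"
proof (rule power2_eq_imp_eq)
  show "(sobolev_norm s f)\<^sup>2 = (norm (cls (weighted_real s f)))\<^sup>2"
    using assms sobolev_weight_pos[of s] unfolding sobolev_real_iff sobolev_norm_def
    by (simp add: norm_cls2 weighted_real_norm2 fourier_comp_real integral_nonneg_AE less_imp_le)
qed (auto simp: sobolev_norm_def integral_nonneg_AE less_imp_le[OF sobolev_weight_pos])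

lemma norm2_fourier_vec: "(norm (fourier_vec v \<xi>))\<^sup>2 = (\<Sum>b\<in>Basis. (cmod (fourier_comp v b \<xi>))\<^sup>2)"
  by (simp add: norm2_vec3 sum_Basis_vec3 fourier_vec_def)

lemma sobolev_vec_iff:
  "v \<in> sobolev s \<longleftrightarrow> square_integrable v \<and> square_integrable (weighted_vec s v)"
proof -
  have "weighted_vec s v \<in> borel_measurable borel" if "square_integrable v"
    using square_integrable_measurable[OF square_integrable_fourier_vec[OF that]]
    unfolding weighted_vec_def[abs_def] by measurable
  then show ?thesis
    unfolding sobolev_def square_integrable_def[of "weighted_vec s v"]
    by (auto simp: weighted_vec_norm2 norm2_fourier_vec)
qed

text \<open>Curves of Sobolev fields are studied through their images under this linear isometry.\<close>

definition sobolev_class :: "real \<Rightarrow> (real^3 \<Rightarrow> real^3) \<Rightarrow> (complex^3) l2" where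
  "sobolev_class s v = cls (weighted_vec s v)"

lemma norm_sobolev_class:
  assumes "v \<in> sobolev s"
  shows "norm (sobolev_class s v) = sobolev_norm s v"
proof (rule power2_eq_imp_eq)
  show "(norm (sobolev_class s v))\<^sup>2 = (sobolev_norm s v)\<^sup>2"
    using assms sobolev_weight_pos[of s] unfolding sobolev_vec_iff sobolev_norm_def sobolev_class_def
    by (simp add: norm_cls2 weighted_vec_norm2 norm2_fourier_vec integral_nonneg_AE less_imp_le sum_nonneg)
qed (auto simp: sobolev_norm_def integral_nonneg_AE less_imp_le[OF sobolev_weight_pos] sum_nonneg)

lemma weighted_vec_nth: "weighted_vec s v \<xi> $ i = weighted_real s (\<lambda>x. v x $ i) \<xi>"
  by (simp add: weighted_vec_def weighted_real_def fourier_vec_nth)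

lemma sobolev_vec_iff_components:
  fixes v :: "real^3 \<Rightarrow> real^3"
  shows "v \<in> sobolev s \<longleftrightarrow> (\<forall>i. (\<lambda>x. v x $ i) \<in> sobolev s)" (is "?L \<longleftrightarrow> ?R")
proof
  assume ?L then show ?R
    using square_integrable_nth[of v] square_integrable_nth[of "weighted_vec s v"]
    by (auto simp: sobolev_vec_iff sobolev_real_iff weighted_vec_nth weighted_vec_nth[abs_def])
next
  assume ?R then show ?L
    unfolding sobolev_vec_iff sobolev_real_iff
    by (auto intro!: square_integrable_vec_lambda simp: weighted_vec_nth)
qed

lemma norm2_cls_vec:
  fixes g :: "real^3 \<Rightarrow> complex^3"
  assumes g: "square_integrable g"
  shows "(norm (cls g))\<^sup>2 = (\<Sum>i\<in>UNIV. (norm (cls (\<lambda>x. g x $ i)))\<^sup>2)"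
proof -
  have "(norm (cls g))\<^sup>2 = (LINT x|lborel. (\<Sum>i\<in>UNIV. (norm (g x $ i))\<^sup>2))"
    by (simp add: norm_cls2[OF g] norm2_vec3)
  also have "\<dots> = (\<Sum>i\<in>UNIV. LINT x|lborel. (norm (g x $ i))\<^sup>2)"
    by (intro Bochner_Integration.integral_sum square_integrable_norm2 square_integrable_nth g)
  finally show ?thesis by (simp add: norm_cls2 square_integrable_nth g)
qed

lemma sobolev_norm_vec:
  fixes v :: "real^3 \<Rightarrow> real^3"
  assumes "v \<in> sobolev s"
  shows "(sobolev_norm s v)\<^sup>2 = (\<Sum>i\<in>UNIV. (sobolev_norm s (\<lambda>x. v x $ i))\<^sup>2)"
  using assms sobolev_vec_iff_components[of v s] unfolding norm_sobolev_class[OF assms, symmetric] sobolev_class_def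
  by (simp add: norm2_cls_vec sobolev_vec_iff sobolev_norm_real weighted_vec_nth)

lemma sobolev_real_add:
  assumes f: "f \<in> sobolev s" and g: "g \<in> sobolev s"
  shows "(\<lambda>x. f x + g x :: real) \<in> sobolev s"
    "sobolev_norm s (\<lambda>x. f x + g x) \<le> sobolev_norm s f + sobolev_norm s g"
proof -
  have fg: "square_integrable f" "square_integrable g" "square_integrable (weighted_real s f)" "square_integrable (weighted_real s g)"
    using f g by (auto simp: sobolev_real_iff)
  have eq: "AE \<xi> in lborel. weighted_real s f \<xi> + weighted_real s g \<xi> = weighted_real s (\<lambda>x. f x + g x) \<xi>"
    using fourier_real_add[OF fg(1,2)] unfolding weighted_real_def by eventually_elim (simp add: scaleR_add_right)
  have [measurable]: "fourier_real (\<lambda>x. f x + g x) \<in> borel_measurable borel"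
    by (intro square_integrable_measurable square_integrable_fourier_real square_integrable_add fg)
  have m: "weighted_real s (\<lambda>x. f x + g x) \<in> borel_measurable borel"
    unfolding weighted_real_def[abs_def] by measurable
  have sq: "square_integrable (weighted_real s (\<lambda>x. f x + g x))"
    by (rule square_integrable_cong_AE[OF square_integrable_add[OF fg(3,4)] m eq])
  then show in_s: "(\<lambda>x. f x + g x) \<in> sobolev s"
    by (simp add: sobolev_real_iff square_integrable_add fg)
  have "cls (weighted_real s (\<lambda>x. f x + g x)) = cls (weighted_real s f) + cls (weighted_real s g)"
    unfolding cls_add[OF fg(3,4), symmetric] using eq
    by (subst cls_eq_iff[OF sq square_integrable_add[OF fg(3,4)]]) (auto elim: eventually_mono)
  then show "sobolev_norm s (\<lambda>x. f x + g x) \<le> sobolev_norm s f + sobolev_norm s g"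
    by (simp add: sobolev_norm_real f g in_s norm_triangle_ineq)
qed

lemma sobolev_real_zero: "(\<lambda>x. 0::real) \<in> sobolev s" "sobolev_norm s (\<lambda>x. 0::real) = 0"
proof -
  have z: "AE \<xi> in lborel. weighted_real s (\<lambda>x. 0) \<xi> = 0"
    using fourier_real_scaleR[of "\<lambda>x. 0::real" 0] unfolding weighted_real_def by (auto elim: eventually_mono)
  have [measurable]: "fourier_real (\<lambda>x. 0) \<in> borel_measurable borel"
    by (intro square_integrable_measurable square_integrable_fourier_real) simp
  have m: "weighted_real s (\<lambda>x. 0) \<in> borel_measurable borel"
    unfolding weighted_real_def[abs_def] by measurable
  have sq: "square_integrable (weighted_real s (\<lambda>x. 0))"
    by (rule square_integrable_cong_AE[OF square_integrable_zero m]) (use z in \<open>auto elim: eventually_mono\<close>)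
  then show in_s: "(\<lambda>x. 0::real) \<in> sobolev s" by (simp add: sobolev_real_iff)
  have "cls (weighted_real s (\<lambda>x. 0)) = 0"
    unfolding cls_zero[symmetric] by (subst cls_eq_iff[OF sq square_integrable_zero]) (rule z)
  then show "sobolev_norm s (\<lambda>x. 0::real) = 0" by (simp add: sobolev_norm_real in_s)
qed

lemma sobolev_real_sum:
  assumes "\<And>j. j \<in> J \<Longrightarrow> (f j :: real^3 \<Rightarrow> real) \<in> sobolev s"
  shows "(\<lambda>x. \<Sum>j\<in>J. f j x) \<in> sobolev s \<and> sobolev_norm s (\<lambda>x. \<Sum>j\<in>J. f j x) \<le> (\<Sum>j\<in>J. sobolev_norm s (f j))"
  using assms
proof (induction J rule: infinite_finite_induct)
  case (insert j J)
  then show ?case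
    using sobolev_real_add[of "f j" s "\<lambda>x. \<Sum>j\<in>J. f j x"] by (auto intro: order_trans)
qed (simp_all add: sobolev_real_zero)

lemma sobolev_class_lin:
  assumes v: "v \<in> sobolev s" and w: "w \<in> sobolev s"
  shows "(\<lambda>x. a *\<^sub>R v x + b *\<^sub>R w x) \<in> sobolev s"
    "sobolev_class s (\<lambda>x. a *\<^sub>R v x + b *\<^sub>R w x) = a *\<^sub>R sobolev_class s v + b *\<^sub>R sobolev_class s w"
    "AE \<xi> in lborel. fourier_vec (\<lambda>x. a *\<^sub>R v x + b *\<^sub>R w x) \<xi> = a *\<^sub>R fourier_vec v \<xi> + b *\<^sub>R fourier_vec w \<xi>"
proof -
  have vw: "square_integrable v" "square_integrable w" "square_integrable (weighted_vec s v)" "square_integrable (weighted_vec s w)"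
    using v w by (auto simp: sobolev_vec_iff)
  let ?z = "\<lambda>x. a *\<^sub>R v x + b *\<^sub>R w x"
  have z: "square_integrable ?z" by (intro square_integrable_add square_integrable_scaleR vw)
  show F: "AE \<xi> in lborel. fourier_vec ?z \<xi> = a *\<^sub>R fourier_vec v \<xi> + b *\<^sub>R fourier_vec w \<xi>"
    using fourier_vec_add[OF vw(1,2)[THEN square_integrable_scaleR], of a b]
      fourier_vec_scaleR[OF vw(1), of a] fourier_vec_scaleR[OF vw(2), of b]
    by eventually_elim simp
  have eq: "AE \<xi> in lborel. a *\<^sub>R weighted_vec s v \<xi> + b *\<^sub>R weighted_vec s w \<xi> = weighted_vec s ?z \<xi>"
    using F unfolding weighted_vec_def by eventually_elim (simp add: scaleR_add_right mult.commute)
  have [measurable]: "fourier_vec ?z \<in> borel_measurable borel"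
    by (intro square_integrable_measurable square_integrable_fourier_vec z)
  have m: "weighted_vec s ?z \<in> borel_measurable borel"
    unfolding weighted_vec_def[abs_def] by measurable
  have lin: "square_integrable (\<lambda>\<xi>. a *\<^sub>R weighted_vec s v \<xi> + b *\<^sub>R weighted_vec s w \<xi>)"
    by (intro square_integrable_add square_integrable_scaleR vw)
  have sq: "square_integrable (weighted_vec s ?z)"
    by (rule square_integrable_cong_AE[OF lin m eq])
  then show "?z \<in> sobolev s" by (simp add: sobolev_vec_iff z)
  have "sobolev_class s ?z = cls (\<lambda>\<xi>. a *\<^sub>R weighted_vec s v \<xi> + b *\<^sub>R weighted_vec s w \<xi>)"
    unfolding sobolev_class_def using eq by (subst cls_eq_iff[OF sq lin]) (auto elim: eventually_mono)
  then show "sobolev_class s ?z = a *\<^sub>R sobolev_class s v + b *\<^sub>R sobolev_class s w"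
    by (simp add: sobolev_class_def cls_add cls_scaleR square_integrable_scaleR vw)
qed

lemma sobolev_class_cong_AE:
  assumes "v \<in> sobolev s" "w \<in> borel_measurable borel" "AE x in lborel. v x = w x"
  shows "w \<in> sobolev s" "sobolev_class s w = sobolev_class s v"
proof -
  have v: "square_integrable v" "square_integrable (weighted_vec s v)" using assms(1) by (auto simp: sobolev_vec_iff)
  have w: "square_integrable w" by (rule square_integrable_cong_AE[OF v(1) assms(2,3)])
  have "fourier_vec w = fourier_vec v"
    using assms(3) by (intro fourier_vec_cong_AE square_integrable_measurable v w) (auto elim: eventually_mono)
  then have eq: "weighted_vec s w = weighted_vec s v" by (simp add: weighted_vec_def[abs_def])
  then show "w \<in> sobolev s" "sobolev_class s w = sobolev_class s v" using v w by (auto simp: sobolev_vec_iff sobolev_class_def)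
qed

lemma sobolev_class_eq_imp_AE_eq:
  assumes v: "v \<in> sobolev s" and w: "w \<in> sobolev s" and eq: "sobolev_class s v = sobolev_class s w"
  shows "AE x in lborel. v x = w x"
proof (rule fourier_vec_eq_imp_eq)
  have "AE \<xi> in lborel. weighted_vec s v \<xi> = weighted_vec s w \<xi>"
    using eq v w by (simp add: sobolev_class_def cls_eq_iff sobolev_vec_iff)
  then show "AE \<xi> in lborel. fourier_vec v \<xi> = fourier_vec w \<xi>"
    by eventually_elim (use sobolev_weight_pos[of "s/2"] in \<open>simp add: weighted_vec_def\<close>, metis less_irrefl)
qed (use v w in \<open>auto simp: sobolev_vec_iff\<close>)

section \<open>Integrability of transforms\<close>

lemma ex_dyadic_interval:
  fixes y :: real
  assumes "1 \<le> y"
  obtains k :: nat where "2 ^ k \<le> y" "y < 2 ^ Suc k"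
proof -
  define n where "n = (LEAST n. y < 2 ^ n)"
  have "\<exists>n. y < 2 ^ n" by (rule real_arch_pow) simp
  then have n: "y < 2 ^ n" unfolding n_def by (rule LeastI_ex)
  have "n \<noteq> 0" using n assms by (intro notI) simp
  then obtain k where k: "n = Suc k" by (cases n) auto
  have "\<not> y < 2 ^ k" using not_less_Least[of k "\<lambda>n. y < 2 ^ n"] k by (simp add: n_def)
  then show ?thesis using that[of k] n k by simp
qed

text \<open>The hypotheses allow a different ball for each point.  Summing over all balls bounds the integral,
  which serves as a substitute for polar coordinates.\<close>

lemma integrable_dyadic:
  fixes f :: "real^3 \<Rightarrow> real"
  assumes [measurable]: "f \<in> borel_measurable borel" and f: "\<And>\<xi>. 0 \<le> f \<xi>"
    and a: "\<And>k. 0 \<le> a k" and r: "\<And>k. 0 \<le> r k"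
    and le: "\<And>\<xi>. \<exists>k::nat. f \<xi> \<le> a k * indicator (cball (0::real^3) (r k)) \<xi>"
    and sum: "summable (\<lambda>k. a k * r k ^ 3)"
  shows "integrable lborel f"
proof (rule integrableI_nonneg)
  have "(\<integral>\<^sup>+\<xi>. ennreal (f \<xi>) \<partial>lborel) \<le> (\<integral>\<^sup>+\<xi>. (\<Sum>k. ennreal (a k * indicator (cball (0::real^3) (r k)) \<xi>)) \<partial>lborel)"
  proof (rule nn_integral_mono)
    fix \<xi> :: "real^3"
    obtain k where "f \<xi> \<le> a k * indicator (cball (0::real^3) (r k)) \<xi>" using le by blast
    then have "ennreal (f \<xi>) \<le> ennreal (a k * indicator (cball (0::real^3) (r k)) \<xi>)" by (rule ennreal_leI)
    also have "\<dots> = sum (\<lambda>k. ennreal (a k * indicator (cball (0::real^3) (r k)) \<xi>)) {k}" by simp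
    also have "\<dots> \<le> (\<Sum>k. ennreal (a k * indicator (cball (0::real^3) (r k)) \<xi>))"
      by (rule sum_le_suminf) auto
    finally show "ennreal (f \<xi>) \<le> (\<Sum>k. ennreal (a k * indicator (cball (0::real^3) (r k)) \<xi>))" .
  qed
  also have "\<dots> = (\<Sum>k. \<integral>\<^sup>+\<xi>. ennreal (a k * indicator (cball (0::real^3) (r k)) \<xi>) \<partial>lborel)"
    by (rule nn_integral_suminf) measurable
  also have "\<dots> = (\<Sum>k. ennreal (unit_ball_vol 3 * (a k * r k ^ 3)))"
  proof (rule suminf_cong)
    fix k
    have "(\<integral>\<^sup>+\<xi>. ennreal (a k * indicator (cball (0::real^3) (r k)) \<xi>) \<partial>lborel) =
        (\<integral>\<^sup>+\<xi>. ennreal (a k) * indicator (cball (0::real^3) (r k)) \<xi> \<partial>lborel)"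
      by (rule nn_integral_cong) (simp add: indicator_def)
    also have "\<dots> = ennreal (a k) * emeasure lborel (cball (0::real^3) (r k))"
      by (rule nn_integral_cmult_indicator) simp
    also have "\<dots> = ennreal (unit_ball_vol 3 * (a k * r k ^ 3))"
      using a[of k] r[of k] by (simp add: emeasure_cball ennreal_mult[symmetric] mult_ac)
    finally show "(\<integral>\<^sup>+\<xi>. ennreal (a k * indicator (cball (0::real^3) (r k)) \<xi>) \<partial>lborel) = ennreal (unit_ball_vol 3 * (a k * r k ^ 3))" .
  qed
  also have "\<dots> = ennreal (\<Sum>k. unit_ball_vol 3 * (a k * r k ^ 3))"
    using a r by (intro suminf_ennreal2 summable_mult sum) auto
  also have "\<dots> < \<infinity>" by simp
  finally show "(\<integral>\<^sup>+\<xi>. ennreal (f \<xi>) \<partial>lborel) < \<infinity>" .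
qed (use f in auto)

text \<open>At distance about \<open>2\<^sup>-\<^sup>k\<close> from the origin the function is at most \<open>4\<^sup>k\<^sup>+\<^sup>1\<close>, on a set of measure about \<open>8\<^sup>-\<^sup>k\<close>.\<close>

lemma integrable_inverse_square_cball:
  "integrable lborel (\<lambda>\<xi>::real^3. (indicator (cball 0 1) \<xi> / norm \<xi>)\<^sup>2 :: real)"
proof (rule integrable_dyadic[where a = "\<lambda>k. 4 ^ Suc k" and r = "\<lambda>k. (1/2) ^ k"])
  show "summable (\<lambda>k. 4 ^ Suc k * ((1/2) ^ k) ^ 3 :: real)"
  proof -
    have "4 ^ Suc k * ((1/2) ^ k) ^ 3 = 4 * (1/2::real) ^ k" for k
      using power_mult_distrib[of "4::real" "1/8" k] power_mult[of "1/2::real" k 3] power_mult[of "1/2::real" 3 k]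
      by (simp add: mult.commute power3_eq_cube)
    show ?thesis unfolding \<open>\<And>k. 4 ^ Suc k * ((1/2) ^ k) ^ 3 = 4 * (1/2::real) ^ k\<close>
      by (intro summable_mult summable_geometric) simp
  qed
  show "\<exists>k. (indicator (cball 0 1) \<xi> / norm \<xi>)\<^sup>2 \<le> 4 ^ Suc k * indicator (cball 0 ((1/2) ^ k)) \<xi>" for \<xi> :: "real^3"
  proof (cases "\<xi> = 0 \<or> 1 < norm \<xi>")
    case True
    then have "indicator (cball 0 1) \<xi> / norm \<xi> = 0" by auto
    then show ?thesis by (intro exI[of _ 0]) (simp only: power2_eq_square, simp)
  next
    case False
    then have "1 \<le> 1 / norm \<xi>" by simp
    then obtain k where k: "2 ^ k \<le> 1 / norm \<xi>" "1 / norm \<xi> < 2 ^ Suc k" by (rule ex_dyadic_interval)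
    have "norm \<xi> \<le> (1/2) ^ k" using k(1) False by (simp add: power_one_over field_simps)
    moreover have "(1 / norm \<xi>)\<^sup>2 \<le> (2 ^ Suc k)\<^sup>2" using k(2) by (intro power_mono) auto
    moreover have "(2 ^ Suc k)\<^sup>2 = (4::real) ^ Suc k" by (simp add: power2_eq_square flip: power_mult_distrib)
    ultimately show ?thesis using False by (intro exI[of _ k]) simp
  qed
qed (auto intro!: borel_measurable_power borel_measurable_divide)

text \<open>At distance about \<open>2\<^sup>k\<close> from the origin the function is about \<open>4\<^sup>-\<^sup>s\<^sup>k\<close>, on a set of measure about \<open>8\<^sup>k\<close>, and
  \<open>8 \<cdot> 4\<^sup>-\<^sup>s < 1\<close> means \<open>s > 3/2\<close>.\<close>

lemma integrable_sobolev_weight_neg: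
  assumes s: "3 / 2 < s"
  shows "integrable lborel (sobolev_weight (- s))"
proof (rule integrable_dyadic[where a = "\<lambda>k. 4 powr s * (4 powr (- s)) ^ k" and r = "\<lambda>k. 2 ^ k"])
  \<comment> \<open>The factor \<open>4 powr s\<close> shifts the index by one: the ball of radius \<open>2 ^ Suc k\<close> has to cover the
      shell \<open>2 ^ k \<le> norm \<xi> < 2 ^ Suc k\<close>, and the ball of radius 1 the rest.\<close>
  have q: "4 powr (- s) * 8 < (1::real)"
  proof -
    have "4 powr (- s) < (4::real) powr (- (3/2))" using s by (intro powr_less_mono) auto
    also have "(4::real) powr (- (3/2)) = 2 powr (2 * (- (3/2)))" by (subst powr_powr[symmetric]) simp
    also have "\<dots> = 1 / 8" by (simp add: powr_minus_divide)
    finally show ?thesis by simp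
  qed
  show "summable (\<lambda>k. 4 powr s * (4 powr (- s)) ^ k * (2 ^ k) ^ 3 :: real)"
  proof -
    have "4 powr s * (4 powr (- s)) ^ k * (2 ^ k) ^ 3 = 4 powr s * (4 powr (- s) * 8) ^ k" for k
      using power_mult[of "2::real" k 3] power_mult[of "2::real" 3 k]
      by (simp add: mult.commute power_mult_distrib)
    show ?thesis unfolding \<open>\<And>k. 4 powr s * (4 powr (- s)) ^ k * (2 ^ k) ^ 3 = 4 powr s * (4 powr (- s) * 8) ^ k\<close>
      using q by (intro summable_mult summable_geometric) simp
  qed
  show "\<exists>k. sobolev_weight (- s) \<xi> \<le> 4 powr s * (4 powr (- s)) ^ k * indicator (cball 0 (2 ^ k)) \<xi>" for \<xi> :: "real^3"
  proof (cases "norm \<xi> \<le> 1")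
    case True
    have "sobolev_weight (- s) \<xi> \<le> 1"
      using sobolev_weight_ge_1[of s \<xi>] s by (simp add: sobolev_weight_def powr_minus inverse_le_1_iff)
    also have "1 \<le> (4::real) powr s" using s by (intro ge_one_powr_ge_zero) auto
    finally show ?thesis using True by (intro exI[of _ 0]) simp
  next
    case False
    then have "1 \<le> norm \<xi>" by simp
    then obtain k where k: "2 ^ k \<le> norm \<xi>" "norm \<xi> < 2 ^ Suc k" by (rule ex_dyadic_interval)
    have "(2 ^ k)\<^sup>2 \<le> (norm \<xi>)\<^sup>2" using k(1) by (intro power_mono) auto
    moreover have "(2 ^ k)\<^sup>2 = (4::real) ^ k" by (simp add: power2_eq_square flip: power_mult_distrib)
    moreover have "(norm \<xi>)\<^sup>2 \<le> 1 + 4 * pi\<^sup>2 * (norm \<xi>)\<^sup>2"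
    proof -
      have "1 \<le> pi" using pi_ge_two by linarith
      then have "1 \<le> 4 * pi\<^sup>2" using one_le_power[of pi 2] by linarith
      then have "1 * (norm \<xi>)\<^sup>2 \<le> 4 * pi\<^sup>2 * (norm \<xi>)\<^sup>2" by (intro mult_right_mono) auto
      then show ?thesis by simp
    qed
    ultimately have "4 ^ k \<le> 1 + 4 * pi\<^sup>2 * (norm \<xi>)\<^sup>2" by linarith
    then have "sobolev_weight (- s) \<xi> \<le> (4 ^ k) powr (- s)"
      unfolding sobolev_weight_def using s by (intro powr_mono2') auto
    also have "\<dots> = (4 powr (- s)) ^ k"
      by (simp add: powr_realpow[symmetric] powr_powr mult.commute)
    also have "\<dots> = 4 powr s * (4 powr (- s)) ^ Suc k"
      by (simp add: powr_minus)
    finally show ?thesis using k(2) by (intro exI[of _ "Suc k"]) simp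
  qed
qed (auto intro: less_imp_le[OF sobolev_weight_pos])

text \<open>By the Cauchy-Schwarz inequality, since the inverse weight is square integrable.\<close>

lemma weighted_imp_integrable:
  fixes g :: "real^3 \<Rightarrow> 'b::euclidean_space"
  assumes s: "3 / 2 < s" and [measurable]: "g \<in> borel_measurable borel"
    and g: "square_integrable (\<lambda>\<xi>. sobolev_weight (s / 2) \<xi> *\<^sub>R g \<xi>)"
  shows "integrable lborel g"
proof -
  have w: "square_integrable (sobolev_weight (- s / 2))"
    using integrable_sobolev_weight_neg[OF s] sobolev_weight_half[of "- s"]
    by (intro square_integrableI) auto
  have "sobolev_weight (- s / 2) \<xi> * sobolev_weight (s / 2) \<xi> = 1" for \<xi>
  proof -
    have "0 < 1 + 4 * pi\<^sup>2 * (norm \<xi>)\<^sup>2" by (intro add_pos_nonneg) auto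
    then have "1 + 4 * pi\<^sup>2 * (norm \<xi>)\<^sup>2 \<noteq> 0" by (rule less_imp_neq[symmetric])
    then show ?thesis unfolding sobolev_weight_def by (simp add: powr_add[symmetric])
  qed
  then have eq: "norm (sobolev_weight (- s / 2) \<xi>) * norm (sobolev_weight (s / 2) \<xi> *\<^sub>R g \<xi>) = norm (g \<xi>)" for \<xi>
    using sobolev_weight_pos[of "- s / 2" \<xi>] sobolev_weight_pos[of "s / 2" \<xi>]
    by (simp add: mult.assoc[symmetric])
  have "integrable lborel (\<lambda>\<xi>. norm (g \<xi>))"
    using square_integrable_norm_mult[OF w g] unfolding eq .
  then show ?thesis by (rule integrable_norm_cancel) auto
qed

text \<open>Low frequencies are where the velocity may fail to be square integrable; its transform is still
  integrable there, because \<open>1 / |\<xi>|\<close> is square integrable near 0.\<close>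

lemma integrable_over_norm:
  fixes g :: "real^3 \<Rightarrow> 'b::euclidean_space"
  assumes g: "integrable lborel g" and g2: "square_integrable g"
  shows "integrable lborel (\<lambda>\<xi>. norm (g \<xi>) / norm \<xi>)"
proof (rule Bochner_Integration.integrable_bound)
  have [measurable]: "g \<in> borel_measurable borel" using g by auto
  have c: "square_integrable (\<lambda>\<xi>::real^3. indicator (cball 0 1) \<xi> / norm \<xi> :: real)"
    using integrable_inverse_square_cball by (intro square_integrableI) auto
  show "integrable lborel (\<lambda>\<xi>. norm (indicator (cball 0 1) \<xi> / norm \<xi> :: real) * norm (g \<xi>) + norm (g \<xi>))"
    by (intro Bochner_Integration.integrable_add square_integrable_norm_mult c g2 integrable_norm g)
  show "(\<lambda>\<xi>. norm (g \<xi>) / norm \<xi>) \<in> borel_measurable lborel" by measurable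
  show "AE \<xi> in lborel. norm (norm (g \<xi>) / norm \<xi>)
      \<le> norm (norm (indicator (cball 0 1) \<xi> / norm \<xi> :: real) * norm (g \<xi>) + norm (g \<xi>))"
  proof (rule AE_I2)
    fix \<xi> :: "real^3"
    show "norm (norm (g \<xi>) / norm \<xi>) \<le> norm (norm (indicator (cball 0 1) \<xi> / norm \<xi> :: real) * norm (g \<xi>) + norm (g \<xi>))"
    proof -
      have "norm (g \<xi>) / norm \<xi> \<le> norm (indicator (cball 0 1) \<xi> / norm \<xi> :: real) * norm (g \<xi>) + norm (g \<xi>)"
      proof (cases "norm \<xi> \<le> 1")
        case True
        then have "norm (indicator (cball 0 1) \<xi> / norm \<xi> :: real) * norm (g \<xi>) = norm (g \<xi>) / norm \<xi>" by simp
        then show ?thesis using norm_ge_zero[of "g \<xi>"] by linarith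
      next
        case False
        then have "norm (g \<xi>) / norm \<xi> \<le> norm (g \<xi>) / 1" by (intro divide_left_mono) auto
        then show ?thesis using False by simp
      qed
      moreover have "0 \<le> norm (g \<xi>) / norm \<xi>" by simp
      ultimately show ?thesis unfolding real_norm_def by linarith
    qed
  qed
qed

subsection \<open>Differentiating inverse Fourier integrals\<close>

text \<open>The quadratic bound gives the pointwise limit of difference quotients, the linear one an
  integrable majorant for them.\<close>

lemma norm_cis_taylor:
  "norm (cis (b + t) - cis b - \<i> * complex_of_real t * cis b) \<le> t\<^sup>2 / 2"
  "norm (cis (b + t) - cis b - \<i> * complex_of_real t * cis b) \<le> 2 * \<bar>t\<bar>"
proof -
  have eq: "cis (b + t) - cis b - \<i> * complex_of_real t * cis b
      = cis b * (iexp t - (\<Sum>k\<le>1. (\<i> * complex_of_real t) ^ k / fact k))"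
    by (simp add: cis_mult[symmetric] cis_conv_exp[of t] algebra_simps)
  show "norm (cis (b + t) - cis b - \<i> * complex_of_real t * cis b) \<le> t\<^sup>2 / 2"
    using iexp_approx1[of t 1] unfolding eq by (simp add: norm_mult numeral_2_eq_2)
  show "norm (cis (b + t) - cis b - \<i> * complex_of_real t * cis b) \<le> 2 * \<bar>t\<bar>"
    using iexp_approx2[of t 1] unfolding eq by (simp add: norm_mult)
qed

lemma has_derivative_inverse_fourier_integral:
  assumes M: "integrable lborel M" and M1: "integrable lborel (\<lambda>\<xi>. norm \<xi> * norm (M \<xi>))"
  shows "((\<lambda>x. LINT \<xi>|lborel. cis (2 * pi * (x \<bullet> \<xi>)) * M \<xi>) has_derivative
     (\<lambda>h. LINT \<xi>|lborel. cis (2 * pi * (x \<bullet> \<xi>)) * (2 * pi * \<i> * complex_of_real (h \<bullet> \<xi>) * M \<xi>))) (at (x :: real^3))"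
proof (rule has_derivativeI)
  have [measurable]: "M \<in> borel_measurable borel" using M by auto
  let ?D = "\<lambda>h \<xi>. cis (2 * pi * (x \<bullet> \<xi>)) * (2 * pi * \<i> * complex_of_real (h \<bullet> \<xi>) * M \<xi>)"
  have nD: "norm (?D h \<xi>) \<le> 2 * pi * norm h * (norm \<xi> * norm (M \<xi>))" for h \<xi>
  proof -
    have "norm (?D h \<xi>) = 2 * pi * (\<bar>h \<bullet> \<xi>\<bar> * norm (M \<xi>))" by (simp add: norm_mult)
    also have "\<dots> \<le> 2 * pi * ((norm h * norm \<xi>) * norm (M \<xi>))"
      by (intro mult_left_mono mult_right_mono Cauchy_Schwarz_ineq2) auto
    finally show ?thesis by (simp add: mult_ac)
  qed
  have iD: "integrable lborel (?D h)" for h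
    by (rule Bochner_Integration.integrable_bound[OF integrable_mult_right[OF M1, of "2 * pi * norm h"]])
       (use nD in \<open>auto intro!: AE_I2 simp: abs_mult\<close>)
  have iF: "integrable lborel (\<lambda>\<xi>. cis (2 * pi * (y \<bullet> \<xi>)) * M \<xi>)" for y
    by (intro integrable_cis_mult M) measurable
  show "bounded_linear (\<lambda>h. LINT \<xi>|lborel. ?D h \<xi>)"
  proof (rule bounded_linear_intro[where K = "2 * pi * (LINT \<xi>|lborel. norm \<xi> * norm (M \<xi>))"])
    show "(LINT \<xi>|lborel. ?D (h + k) \<xi>) = (LINT \<xi>|lborel. ?D h \<xi>) + (LINT \<xi>|lborel. ?D k \<xi>)" for h k
      unfolding Bochner_Integration.integral_add[OF iD iD, symmetric]
      by (simp add: inner_add_left algebra_simps)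
    show "(LINT \<xi>|lborel. ?D (r *\<^sub>R h) \<xi>) = r *\<^sub>R (LINT \<xi>|lborel. ?D h \<xi>)" for r h
      unfolding integral_scaleR_right[symmetric]
      by (simp only: inner_scaleR_left of_real_mult scaleR_conv_of_real[where 'a = complex] mult_ac)
    show "norm (LINT \<xi>|lborel. ?D h \<xi>) \<le> norm h * (2 * pi * (LINT \<xi>|lborel. norm \<xi> * norm (M \<xi>)))" for h
    proof -
      have "norm (LINT \<xi>|lborel. ?D h \<xi>) \<le> (LINT \<xi>|lborel. norm (?D h \<xi>))" by (rule integral_norm_bound)
      also have "\<dots> \<le> (LINT \<xi>|lborel. 2 * pi * norm h * (norm \<xi> * norm (M \<xi>)))"
        by (intro integral_mono integrable_norm iD integrable_mult_right M1 nD)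
      also have "\<dots> = 2 * pi * norm h * (LINT \<xi>|lborel. norm \<xi> * norm (M \<xi>))"
        by (rule integral_mult_right_zero)
      finally show ?thesis by (simp only: mult_ac)
    qed
  qed
  show "((\<lambda>y. ((LINT \<xi>|lborel. cis (2 * pi * (y \<bullet> \<xi>)) * M \<xi>) - (LINT \<xi>|lborel. cis (2 * pi * (x \<bullet> \<xi>)) * M \<xi>)
      - (LINT \<xi>|lborel. ?D (y - x) \<xi>)) /\<^sub>R norm (y - x)) \<longlongrightarrow> 0) (at x)"
    unfolding tendsto_at_iff_sequentially
  proof (intro allI impI)
    fix X assume X: "\<forall>i. X i \<in> UNIV - {x}" "X \<longlonglongrightarrow> x"
    define R where "R = (\<lambda>i \<xi>. inverse (norm (X i - x)) *\<^sub>R (cis (2 * pi * (X i \<bullet> \<xi>)) * M \<xi> - cis (2 * pi * (x \<bullet> \<xi>)) * M \<xi> - ?D (X i - x) \<xi>))"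
    have R: "R i \<xi> = inverse (norm (X i - x)) *\<^sub>R ((cis (b + t) - cis b - \<i> * complex_of_real t * cis b) * M \<xi>)"
      if "b = 2 * pi * (x \<bullet> \<xi>)" "t = 2 * pi * ((X i - x) \<bullet> \<xi>)" for i \<xi> b t
      unfolding R_def that by (simp add: algebra_simps)
    have t_le: "\<bar>2 * pi * ((X i - x) \<bullet> \<xi>)\<bar> \<le> 2 * pi * (norm (X i - x) * norm \<xi>)" for i \<xi>
      using Cauchy_Schwarz_ineq2[of "X i - x" \<xi>] by (simp add: abs_mult)
    have pos: "0 < norm (X i - x)" for i using X(1) by simp
    have R1: "norm (R i \<xi>) \<le> 4 * pi * (norm \<xi> * norm (M \<xi>))" for i \<xi>
    proof -
      let ?b = "2 * pi * (x \<bullet> \<xi>)" and ?t = "2 * pi * ((X i - x) \<bullet> \<xi>)"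
      have "norm (R i \<xi>) = inverse (norm (X i - x)) * (norm (cis (?b + ?t) - cis ?b - \<i> * complex_of_real ?t * cis ?b) * norm (M \<xi>))"
        unfolding R[OF refl refl] norm_scaleR norm_mult by simp
      also have "\<dots> \<le> inverse (norm (X i - x)) * ((2 * (2 * pi * (norm (X i - x) * norm \<xi>))) * norm (M \<xi>))"
        using norm_cis_taylor(2)[of ?b ?t] t_le[of i \<xi>] by (intro mult_left_mono mult_right_mono) auto
      also have "\<dots> = 4 * pi * (norm \<xi> * norm (M \<xi>))" using pos[of i] by (simp add: field_simps)
      finally show ?thesis .
    qed
    have R2: "norm (R i \<xi>) \<le> norm (X i - x) * (2 * pi\<^sup>2 * (norm \<xi>)\<^sup>2 * norm (M \<xi>))" for i \<xi>
    proof -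
      let ?b = "2 * pi * (x \<bullet> \<xi>)" and ?t = "2 * pi * ((X i - x) \<bullet> \<xi>)"
      have "norm (R i \<xi>) = inverse (norm (X i - x)) * (norm (cis (?b + ?t) - cis ?b - \<i> * complex_of_real ?t * cis ?b) * norm (M \<xi>))"
        unfolding R[OF refl refl] norm_scaleR norm_mult by simp
      also have "\<dots> \<le> inverse (norm (X i - x)) * (((2 * pi * (norm (X i - x) * norm \<xi>))\<^sup>2 / 2) * norm (M \<xi>))"
      proof (intro mult_left_mono mult_right_mono order_trans[OF norm_cis_taylor(1)] divide_right_mono)
        show "?t\<^sup>2 \<le> (2 * pi * (norm (X i - x) * norm \<xi>))\<^sup>2"
          using power_mono[OF t_le[of i \<xi>], of 2] by (simp only: power2_abs abs_ge_zero)
      qed auto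
      also have "\<dots> = norm (X i - x) * (2 * pi\<^sup>2 * (norm \<xi>)\<^sup>2 * norm (M \<xi>))"
        using pos[of i] by (simp add: power2_eq_square field_simps)
      finally show ?thesis .
    qed
    have "(\<lambda>i. LINT \<xi>|lborel. R i \<xi>) \<longlonglongrightarrow> (LINT \<xi>|(lborel :: (real^3) measure). 0)"
    proof (rule integral_dominated_convergence[where w = "\<lambda>\<xi>. 4 * pi * (norm \<xi> * norm (M \<xi>))"])
      show "integrable lborel (\<lambda>\<xi>. 4 * pi * (norm \<xi> * norm (M \<xi>)))" by (intro integrable_mult_right M1)
      show "R i \<in> borel_measurable lborel" for i unfolding R_def by measurable
      show "AE \<xi> in lborel. norm (R i \<xi>) \<le> 4 * pi * (norm \<xi> * norm (M \<xi>))" for i by (rule AE_I2, rule R1)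
      show "AE \<xi> in lborel. (\<lambda>i. R i \<xi>) \<longlonglongrightarrow> 0"
      proof (rule AE_I2)
        fix \<xi> :: "real^3"
        have "(\<lambda>i. norm (X i - x) * (2 * pi\<^sup>2 * (norm \<xi>)\<^sup>2 * norm (M \<xi>))) \<longlonglongrightarrow> norm (x - x) * (2 * pi\<^sup>2 * (norm \<xi>)\<^sup>2 * norm (M \<xi>))"
          by (intro tendsto_intros X)
        then have "(\<lambda>i. norm (X i - x) * (2 * pi\<^sup>2 * (norm \<xi>)\<^sup>2 * norm (M \<xi>))) \<longlonglongrightarrow> 0" by simp
        then show "(\<lambda>i. R i \<xi>) \<longlonglongrightarrow> 0"
          by (rule Lim_null_comparison[rotated]) (intro always_eventually allI R2)
      qed
    qed simp
    moreover have "(LINT \<xi>|lborel. R i \<xi>) = ((LINT \<xi>|lborel. cis (2 * pi * (X i \<bullet> \<xi>)) * M \<xi>) - (LINT \<xi>|lborel. cis (2 * pi * (x \<bullet> \<xi>)) * M \<xi>)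
      - (LINT \<xi>|lborel. ?D (X i - x) \<xi>)) /\<^sub>R norm (X i - x)" for i
      unfolding R_def integral_scaleR_right
      by (simp only: Bochner_Integration.integral_diff[OF Bochner_Integration.integrable_diff[OF iF iF] iD] Bochner_Integration.integral_diff[OF iF iF])
    ultimately show "((\<lambda>y. ((LINT \<xi>|lborel. cis (2 * pi * (y \<bullet> \<xi>)) * M \<xi>) - (LINT \<xi>|lborel. cis (2 * pi * (x \<bullet> \<xi>)) * M \<xi>)
      - (LINT \<xi>|lborel. ?D (y - x) \<xi>)) /\<^sub>R norm (y - x)) \<circ> X) \<longlonglongrightarrow> 0"
      by (simp add: o_def)
  qed
qed

section \<open>The velocity gradient\<close>

lemma velocity_hat_1: "velocity_hat w \<xi> $ 1 = (1 / (4 * pi\<^sup>2 * (norm \<xi>)\<^sup>2)) *\<^sub>R (2 * pi * \<i> * (complex_of_real (\<xi> $ 2) * fourier_vec w \<xi> $ 3 - complex_of_real (\<xi> $ 3) * fourier_vec w \<xi> $ 2))"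
  and velocity_hat_2: "velocity_hat w \<xi> $ 2 = (1 / (4 * pi\<^sup>2 * (norm \<xi>)\<^sup>2)) *\<^sub>R (2 * pi * \<i> * (complex_of_real (\<xi> $ 3) * fourier_vec w \<xi> $ 1 - complex_of_real (\<xi> $ 1) * fourier_vec w \<xi> $ 3))"
  and velocity_hat_3: "velocity_hat w \<xi> $ 3 = (1 / (4 * pi\<^sup>2 * (norm \<xi>)\<^sup>2)) *\<^sub>R (2 * pi * \<i> * (complex_of_real (\<xi> $ 1) * fourier_vec w \<xi> $ 2 - complex_of_real (\<xi> $ 2) * fourier_vec w \<xi> $ 1))"
  by (simp_all add: velocity_hat_def ccross3_def vector_3 algebra_simps)

lemma velocity_hat_measurable:
  assumes "square_integrable w"
  shows "(\<lambda>\<xi>. velocity_hat w \<xi> $ i) \<in> borel_measurable borel"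
proof -
  have [measurable]: "fourier_vec w \<in> borel_measurable borel"
    by (intro square_integrable_measurable square_integrable_fourier_vec assms)
  have "i = 1 \<or> i = 2 \<or> i = 3" using exhaust_3 by blast
  then show ?thesis by (elim disjE; simp only: velocity_hat_1 velocity_hat_2 velocity_hat_3; measurable)
qed

lemma velocity_hat_linear:
  assumes "fourier_vec z \<xi> = a *\<^sub>R fourier_vec v \<xi> + b *\<^sub>R fourier_vec w \<xi>"
  shows "velocity_hat z \<xi> = a *\<^sub>R velocity_hat v \<xi> + b *\<^sub>R velocity_hat w \<xi>"
  unfolding vec_eq_iff
proof
  fix i :: 3
  have "i = 1 \<or> i = 2 \<or> i = 3" using exhaust_3 by blast
  then show "velocity_hat z \<xi> $ i = (a *\<^sub>R velocity_hat v \<xi> + b *\<^sub>R velocity_hat w \<xi>) $ i"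
    by (elim disjE) (simp_all add: velocity_hat_1 velocity_hat_2 velocity_hat_3 assms algebra_simps scaleR_conv_of_real[where 'a = complex])
qed

lemma velocity_hat_hermitian:
  assumes "square_integrable w"
  shows "hermitian (\<lambda>\<xi>. velocity_hat w \<xi> $ i)"
  unfolding hermitian_def
proof -
  have "AE \<xi> in lborel. \<forall>i. fourier_vec w (- \<xi>) $ i = cnj (fourier_vec w \<xi> $ i)"
    unfolding fourier_vec_nth
    by (intro AE_all_3 hermitian_fourier_real[unfolded hermitian_def] square_integrable_nth assms)
  then show "AE \<xi> in lborel. velocity_hat w (- \<xi>) $ i = cnj (velocity_hat w \<xi> $ i)"
  proof eventually_elim
    case (elim \<xi>)
    have "i = 1 \<or> i = 2 \<or> i = 3" using exhaust_3 by blast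
    then show ?case
      by (elim disjE) (simp_all add: velocity_hat_1 velocity_hat_2 velocity_hat_3 elim algebra_simps)
  qed
qed

text \<open>The difference of the two sides is \<open>|x \<cdot> h|\<^sup>2\<close>, by Lagrange's identity for the real and the
  imaginary part of \<open>h\<close>.\<close>

lemma lagrange_real_complex:
  fixes x1 x2 x3 :: real and h1 h2 h3 :: complex
  shows "(cmod (x2 * h3 - x3 * h2))\<^sup>2 + (cmod (x3 * h1 - x1 * h3))\<^sup>2 + (cmod (x1 * h2 - x2 * h1))\<^sup>2
     \<le> (x1\<^sup>2 + x2\<^sup>2 + x3\<^sup>2) * ((cmod h1)\<^sup>2 + (cmod h2)\<^sup>2 + (cmod h3)\<^sup>2)"
proof -
  have "(x1\<^sup>2 + x2\<^sup>2 + x3\<^sup>2) * ((cmod h1)\<^sup>2 + (cmod h2)\<^sup>2 + (cmod h3)\<^sup>2)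
     - ((cmod (x2 * h3 - x3 * h2))\<^sup>2 + (cmod (x3 * h1 - x1 * h3))\<^sup>2 + (cmod (x1 * h2 - x2 * h1))\<^sup>2)
     = (x1 * Re h1 + x2 * Re h2 + x3 * Re h3)\<^sup>2 + (x1 * Im h1 + x2 * Im h2 + x3 * Im h3)\<^sup>2"
    by (simp add: cmod_power2) algebra
  moreover have "\<dots> \<ge> 0" by (intro add_nonneg_nonneg zero_le_power2)
  ultimately show ?thesis by linarith
qed

text \<open>The left side is the squared length of the transform of the velocity gradient.\<close>

lemma norm_velocity_hat:
  "4 * pi\<^sup>2 * (norm \<xi>)\<^sup>2 * (norm (velocity_hat w \<xi>))\<^sup>2 \<le> (norm (fourier_vec w \<xi>))\<^sup>2"
proof (cases "\<xi> = 0")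
  case False
  let ?h = "fourier_vec w \<xi>"
  let ?q = "1 / (4 * pi\<^sup>2 * (norm \<xi>)\<^sup>2)"
  have q: "0 < ?q" using False by simp
  let ?S = "(cmod (\<xi>$2 * ?h$3 - \<xi>$3 * ?h$2))\<^sup>2 + (cmod (\<xi>$3 * ?h$1 - \<xi>$1 * ?h$3))\<^sup>2 + (cmod (\<xi>$1 * ?h$2 - \<xi>$2 * ?h$1))\<^sup>2"
  have "(norm (velocity_hat w \<xi>))\<^sup>2 = (?q * (2 * pi))\<^sup>2 * ?S"
    unfolding norm2_vec3 sum_3 velocity_hat_1 velocity_hat_2 velocity_hat_3
    by (simp only: norm_scaleR norm_mult power_mult_distrib norm_of_real norm_ii) (simp add: power_mult_distrib algebra_simps)
  also have "\<dots> \<le> (?q * (2 * pi))\<^sup>2 * ((norm \<xi>)\<^sup>2 * (norm ?h)\<^sup>2)"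
    using lagrange_real_complex[of "\<xi>$2" "?h$3" "\<xi>$3" "?h$2" "?h$1" "\<xi>$1"]
    by (intro mult_left_mono) (simp_all add: norm2_vec3 sum_3)
  also have "\<dots> = ?q * (norm ?h)\<^sup>2"
    using False by (simp add: power_mult_distrib power2_eq_square field_simps)
  finally have "(norm (velocity_hat w \<xi>))\<^sup>2 \<le> ?q * (norm ?h)\<^sup>2" .
  then have "4 * pi\<^sup>2 * (norm \<xi>)\<^sup>2 * (norm (velocity_hat w \<xi>))\<^sup>2 \<le> 4 * pi\<^sup>2 * (norm \<xi>)\<^sup>2 * (?q * (norm ?h)\<^sup>2)"
    by (intro mult_left_mono) auto
  also have "\<dots> = (norm ?h)\<^sup>2" using False by simp
  finally show ?thesis .
qed simp

lemma norm_velocity_hat_le: "2 * pi * norm \<xi> * norm (velocity_hat w \<xi>) \<le> norm (fourier_vec w \<xi>)"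
proof (rule power2_le_imp_le)
  have "(2 * pi * norm \<xi> * norm (velocity_hat w \<xi>))\<^sup>2 = 4 * pi\<^sup>2 * (norm \<xi>)\<^sup>2 * (norm (velocity_hat w \<xi>))\<^sup>2"
    by (simp only: power_mult_distrib) simp
  then show "(2 * pi * norm \<xi> * norm (velocity_hat w \<xi>))\<^sup>2 \<le> (norm (fourier_vec w \<xi>))\<^sup>2"
    using norm_velocity_hat[of \<xi> w] by linarith
qed simp

definition gradient_hat :: "(real^3 \<Rightarrow> real^3) \<Rightarrow> 3 \<Rightarrow> 3 \<Rightarrow> real^3 \<Rightarrow> complex" where
  "gradient_hat w i j \<xi> = 2 * pi * \<i> * complex_of_real (\<xi> $ j) * velocity_hat w \<xi> $ i"

definition velocity_gradient :: "(real^3 \<Rightarrow> real^3) \<Rightarrow> 3 \<Rightarrow> 3 \<Rightarrow> real^3 \<Rightarrow> real" where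
  "velocity_gradient w i j x = Re (LINT \<xi>|lborel. cis (2 * pi * (x \<bullet> \<xi>)) * gradient_hat w i j \<xi>)"

lemma sum_norm2_gradient_hat: "(\<Sum>i\<in>UNIV. \<Sum>j\<in>UNIV. (norm (gradient_hat w i j \<xi>))\<^sup>2) \<le> (norm (fourier_vec w \<xi>))\<^sup>2"
proof -
  have "(\<Sum>i\<in>UNIV. \<Sum>j\<in>UNIV. (norm (gradient_hat w i j \<xi>))\<^sup>2)
      = (\<Sum>i\<in>UNIV. \<Sum>j\<in>UNIV. 4 * pi\<^sup>2 * ((norm (velocity_hat w \<xi> $ i))\<^sup>2 * (norm (\<xi> $ j))\<^sup>2))"
    by (intro sum.cong refl) (simp add: gradient_hat_def norm_mult power_mult_distrib)
  also have "\<dots> = 4 * pi\<^sup>2 * (norm \<xi>)\<^sup>2 * (norm (velocity_hat w \<xi>))\<^sup>2"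
    by (simp add: norm2_vec3 sum_3 algebra_simps)
  finally show ?thesis using norm_velocity_hat[of \<xi> w] by linarith
qed

lemma norm_gradient_hat: "norm (gradient_hat w i j \<xi>) \<le> norm (fourier_vec w \<xi>)"
proof (rule power2_le_imp_le)
  have "(norm (gradient_hat w i j \<xi>))\<^sup>2 \<le> (\<Sum>j\<in>UNIV. (norm (gradient_hat w i j \<xi>))\<^sup>2)"
    by (rule member_le_sum) auto
  also have "\<dots> \<le> (\<Sum>i\<in>UNIV. \<Sum>j\<in>UNIV. (norm (gradient_hat w i j \<xi>))\<^sup>2)"
    by (rule member_le_sum[of i _ "\<lambda>i. \<Sum>j\<in>UNIV. (norm (gradient_hat w i j \<xi>))\<^sup>2"]) (auto intro: sum_nonneg)
  also note sum_norm2_gradient_hat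
  finally show "(norm (gradient_hat w i j \<xi>))\<^sup>2 \<le> (norm (fourier_vec w \<xi>))\<^sup>2" .
qed simp

lemma gradient_hat_measurable:
  assumes "square_integrable w"
  shows "gradient_hat w i j \<in> borel_measurable borel"
proof -
  note velocity_hat_measurable[OF assms, measurable]
  show ?thesis unfolding gradient_hat_def[abs_def] by measurable
qed

lemma gradient_hat_hermitian:
  assumes "square_integrable w"
  shows "hermitian (gradient_hat w i j)"
  using velocity_hat_hermitian[OF assms, of i] unfolding hermitian_def gradient_hat_def
  by eventually_elim simp

locale smooth_sobolev =
  fixes s :: real
  assumes s: "3 / 2 < s"
begin

lemma fourier_vec_integrable:
  assumes "w \<in> sobolev s"
  shows "integrable lborel (fourier_vec w)"
proof (rule weighted_imp_integrable[OF s])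
  show "fourier_vec w \<in> borel_measurable borel"
    using assms by (intro square_integrable_measurable square_integrable_fourier_vec) (auto simp: sobolev_vec_iff)
  show "square_integrable (\<lambda>\<xi>. sobolev_weight (s / 2) \<xi> *\<^sub>R fourier_vec w \<xi>)"
    using assms by (auto simp: sobolev_vec_iff weighted_vec_def[abs_def])
qed

lemma velocity_hat_integrable:
  assumes w: "w \<in> sobolev s"
  shows "integrable lborel (\<lambda>\<xi>. velocity_hat w \<xi> $ i)"
    "integrable lborel (\<lambda>\<xi>. norm \<xi> * norm (velocity_hat w \<xi> $ i))"
proof -
  have w2: "square_integrable w" using w by (simp add: sobolev_vec_iff)
  note velocity_hat_measurable[OF w2, measurable]
  have i1: "integrable lborel (\<lambda>\<xi>. norm (fourier_vec w \<xi>) / norm \<xi>)"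
    by (intro integrable_over_norm fourier_vec_integrable w square_integrable_fourier_vec w2)
  have le: "norm \<xi> * norm (velocity_hat w \<xi> $ i) \<le> norm (fourier_vec w \<xi>)" for \<xi>
  proof -
    have "norm \<xi> * norm (velocity_hat w \<xi> $ i) \<le> norm \<xi> * norm (velocity_hat w \<xi>)"
      by (intro mult_left_mono Finite_Cartesian_Product.norm_nth_le) auto
    also have "\<dots> \<le> (2 * pi) * (norm \<xi> * norm (velocity_hat w \<xi>))"
    proof -
      have "1 \<le> 2 * pi" using pi_ge_two by linarith
      then have "1 * (norm \<xi> * norm (velocity_hat w \<xi>)) \<le> (2 * pi) * (norm \<xi> * norm (velocity_hat w \<xi>))"
        by (rule mult_right_mono) simp
      then show ?thesis by simp
    qed
    also have "\<dots> \<le> norm (fourier_vec w \<xi>)" using norm_velocity_hat_le[of \<xi> w] by (simp only: mult.assoc)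
    finally show ?thesis .
  qed
  show "integrable lborel (\<lambda>\<xi>. velocity_hat w \<xi> $ i)"
  proof (rule Bochner_Integration.integrable_bound[OF i1])
    show "AE \<xi> in lborel. norm (velocity_hat w \<xi> $ i) \<le> norm (norm (fourier_vec w \<xi>) / norm \<xi>)"
    proof (rule AE_I2)
      fix \<xi>
      show "norm (velocity_hat w \<xi> $ i) \<le> norm (norm (fourier_vec w \<xi>) / norm \<xi>)"
      proof (cases "\<xi> = 0")
        case True
        then show ?thesis by (simp add: velocity_hat_def)
      next
        case False
        then show ?thesis using le[of \<xi>] by (simp add: field_simps)
      qed
    qed
  qed measurable
  show "integrable lborel (\<lambda>\<xi>. norm \<xi> * norm (velocity_hat w \<xi> $ i))"
  proof (rule Bochner_Integration.integrable_bound[OF fourier_vec_integrable[OF w]])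
    show "AE \<xi> in lborel. norm (norm \<xi> * norm (velocity_hat w \<xi> $ i)) \<le> norm (fourier_vec w \<xi>)"
      using le by (intro AE_I2) simp
  qed measurable
qed

lemma gradient_hat_integrable:
  assumes w: "w \<in> sobolev s"
  shows "integrable lborel (gradient_hat w i j)" "square_integrable (gradient_hat w i j)"
    "square_integrable (\<lambda>\<xi>. sobolev_weight (s / 2) \<xi> *\<^sub>R gradient_hat w i j \<xi>)"
proof -
  have w2: "square_integrable w" and ww: "square_integrable (weighted_vec s w)" using w by (auto simp: sobolev_vec_iff)
  note gradient_hat_measurable[OF w2, measurable]
  show "integrable lborel (gradient_hat w i j)"
    by (rule Bochner_Integration.integrable_bound[OF fourier_vec_integrable[OF w]]) (auto simp: norm_gradient_hat)
  show "square_integrable (gradient_hat w i j)"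
    by (rule square_integrable_bound[OF square_integrable_fourier_vec[OF w2], of _ 1]) (auto simp: norm_gradient_hat)
  show "square_integrable (\<lambda>\<xi>. sobolev_weight (s / 2) \<xi> *\<^sub>R gradient_hat w i j \<xi>)"
  proof (rule square_integrable_bound[OF ww])
    show "AE \<xi> in lborel. norm (sobolev_weight (s / 2) \<xi> *\<^sub>R gradient_hat w i j \<xi>) \<le> 1 * norm (weighted_vec s w \<xi>)"
      by (rule AE_I2) (simp only: weighted_vec_def norm_scaleR mult_1 mult_left_mono norm_gradient_hat abs_ge_zero)
  qed measurable
qed

lemma velocity_has_derivative:
  assumes w: "w \<in> sobolev s"
  shows "(velocity w has_derivative (\<lambda>h. \<chi> i. \<Sum>j\<in>UNIV. h $ j * velocity_gradient w i j x)) (at x)"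
proof (subst has_derivative_componentwise_within, rule ballI)
  fix b :: "real^3" assume "b \<in> Basis"
  then obtain i where b: "b = axis i 1" by (auto simp: Basis_vec_def)
  let ?M = "\<lambda>\<xi>. velocity_hat w \<xi> $ i"
  have D: "((\<lambda>x. LINT \<xi>|lborel. cis (2 * pi * (x \<bullet> \<xi>)) * ?M \<xi>) has_derivative
     (\<lambda>h. LINT \<xi>|lborel. cis (2 * pi * (x \<bullet> \<xi>)) * (2 * pi * \<i> * complex_of_real (h \<bullet> \<xi>) * ?M \<xi>))) (at x)"
    by (intro has_derivative_inverse_fourier_integral velocity_hat_integrable w)
  have ig: "integrable lborel (\<lambda>\<xi>. cis (2 * pi * (x \<bullet> \<xi>)) * gradient_hat w i j \<xi>)" for j
    by (intro integrable_cis_mult gradient_hat_integrable w) measurable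
  have eq: "Re (LINT \<xi>|lborel. cis (2 * pi * (x \<bullet> \<xi>)) * (2 * pi * \<i> * complex_of_real (h \<bullet> \<xi>) * ?M \<xi>))
      = (\<Sum>j\<in>UNIV. h $ j * velocity_gradient w i j x)" for h
  proof -
    have "(LINT \<xi>|lborel. cis (2 * pi * (x \<bullet> \<xi>)) * (2 * pi * \<i> * complex_of_real (h \<bullet> \<xi>) * ?M \<xi>))
        = (LINT \<xi>|lborel. (\<Sum>j\<in>UNIV. complex_of_real (h $ j) * (cis (2 * pi * (x \<bullet> \<xi>)) * gradient_hat w i j \<xi>)))"
      by (rule Bochner_Integration.integral_cong)
         (simp_all add: inner_vec_def gradient_hat_def sum_distrib_left sum_distrib_right mult_ac)
    also have "\<dots> = (\<Sum>j\<in>UNIV. complex_of_real (h $ j) * (LINT \<xi>|lborel. cis (2 * pi * (x \<bullet> \<xi>)) * gradient_hat w i j \<xi>))"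
      by (subst Bochner_Integration.integral_sum) (simp_all add: ig)
    finally show ?thesis by (simp add: velocity_gradient_def)
  qed
  have "((\<lambda>x. Re (LINT \<xi>|lborel. cis (2 * pi * (x \<bullet> \<xi>)) * ?M \<xi>)) has_derivative
     (\<lambda>h. \<Sum>j\<in>UNIV. h $ j * velocity_gradient w i j x)) (at x)"
    using bounded_linear.has_derivative[OF bounded_linear_Re D] unfolding eq .
  then show "((\<lambda>x. velocity w x \<bullet> b) has_derivative (\<lambda>h. (\<chi> i. \<Sum>j\<in>UNIV. h $ j * velocity_gradient w i j x) \<bullet> b)) (at x)"
    by (simp add: b inner_axis velocity_def)
qed

text \<open>The transform of the gradient is integrable, square integrable and Hermitian.  So the classical
  gradient, given by an inverse Fourier integral, agrees almost everywhere with the inverse transform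
  in \<open>L\<^sup>2\<close> and has the expected transform.\<close>

lemma fourier_velocity_gradient:
  assumes w: "w \<in> sobolev s"
  shows "square_integrable (velocity_gradient w i j)"
    "AE \<xi> in lborel. fourier_real (velocity_gradient w i j) \<xi> = gradient_hat w i j \<xi>"
proof -
  have w2: "square_integrable w" using w by (simp add: sobolev_vec_iff)
  note gradient_hat_measurable[OF w2, measurable]
  note gh = gradient_hat_integrable(1,2)[OF w, of i j] and herm = gradient_hat_hermitian[OF w2, of i j]
  have "(\<lambda>x. LINT \<xi>|lborel. cis (2 * pi * (x \<bullet> \<xi>)) * gradient_hat w i j \<xi>) \<in> borel_measurable borel"
    by (rule lborel.borel_measurable_lebesgue_integral) measurable
  then have m: "velocity_gradient w i j \<in> borel_measurable borel"
    unfolding velocity_gradient_def[abs_def] by measurable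
  have eq: "AE x in lborel. Re (inverse_fourier (gradient_hat w i j) x) = velocity_gradient w i j x"
    using inverse_fourier_eq_integral[OF gh] unfolding velocity_gradient_def by eventually_elim simp
  note inv = fourier_real_inverse[OF gh(2) herm]
  show "square_integrable (velocity_gradient w i j)"
    by (rule square_integrable_cong_AE[OF inv(1) m eq])
  have "fourier_real (\<lambda>x. Re (inverse_fourier (gradient_hat w i j) x)) = fourier_real (velocity_gradient w i j)"
    by (rule fourier_real_cong_AE[OF square_integrable_measurable[OF inv(1)] m eq])
  then show "AE \<xi> in lborel. fourier_real (velocity_gradient w i j) \<xi> = gradient_hat w i j \<xi>"
    using inv(2) by simp
qed

lemma velocity_gradient_sobolev:
  assumes w: "w \<in> sobolev s"
  shows "velocity_gradient w i j \<in> sobolev s"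
    "(sobolev_norm s (velocity_gradient w i j))\<^sup>2 = (LINT \<xi>|lborel. sobolev_weight s \<xi> * (norm (gradient_hat w i j \<xi>))\<^sup>2)"
    "integrable lborel (\<lambda>\<xi>. sobolev_weight s \<xi> * (norm (gradient_hat w i j \<xi>))\<^sup>2)"
proof -
  note F = fourier_velocity_gradient[OF w, of i j] and gw = gradient_hat_integrable(3)[OF w, of i j]
  have [measurable]: "fourier_real (velocity_gradient w i j) \<in> borel_measurable borel"
    by (intro square_integrable_measurable square_integrable_fourier_real F)
  have m: "weighted_real s (velocity_gradient w i j) \<in> borel_measurable borel"
    unfolding weighted_real_def[abs_def] by measurable
  have eq: "AE \<xi> in lborel. sobolev_weight (s / 2) \<xi> *\<^sub>R gradient_hat w i j \<xi> = weighted_real s (velocity_gradient w i j) \<xi>"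
    using F(2) unfolding weighted_real_def by eventually_elim simp
  have sq: "square_integrable (weighted_real s (velocity_gradient w i j))"
    by (rule square_integrable_cong_AE[OF gw m eq])
  then show S: "velocity_gradient w i j \<in> sobolev s" by (simp add: sobolev_real_iff F)
  have "cls (weighted_real s (velocity_gradient w i j)) = cls (\<lambda>\<xi>. sobolev_weight (s / 2) \<xi> *\<^sub>R gradient_hat w i j \<xi>)"
    using eq by (subst cls_eq_iff[OF sq gw]) (auto elim: eventually_mono)
  then show "(sobolev_norm s (velocity_gradient w i j))\<^sup>2 = (LINT \<xi>|lborel. sobolev_weight s \<xi> * (norm (gradient_hat w i j \<xi>))\<^sup>2)"
    unfolding sobolev_norm_real[OF S] by (simp only: norm_cls2[OF gw] weighted_norm2)
  show "integrable lborel (\<lambda>\<xi>. sobolev_weight s \<xi> * (norm (gradient_hat w i j \<xi>))\<^sup>2)"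
    using square_integrable_norm2[OF gw] unfolding weighted_norm2 .
qed

lemma sum_norm2_velocity_gradient:
  assumes w: "w \<in> sobolev s"
  shows "(\<Sum>i\<in>UNIV. \<Sum>j\<in>UNIV. (sobolev_norm s (velocity_gradient w i j))\<^sup>2) \<le> (sobolev_norm s w)\<^sup>2"
proof -
  have ww: "square_integrable (weighted_vec s w)" using w by (auto simp: sobolev_vec_iff)
  note G = velocity_gradient_sobolev[OF w]
  have "(\<Sum>i\<in>UNIV. \<Sum>j\<in>UNIV. (sobolev_norm s (velocity_gradient w i j))\<^sup>2)
      = (LINT \<xi>|lborel. (\<Sum>i\<in>UNIV. \<Sum>j\<in>UNIV. sobolev_weight s \<xi> * (norm (gradient_hat w i j \<xi>))\<^sup>2))"
    by (simp add: G(2) G(3))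
  also have "\<dots> \<le> (LINT \<xi>|lborel. (norm (weighted_vec s w \<xi>))\<^sup>2)"
  proof (intro integral_mono Bochner_Integration.integrable_sum G(3) square_integrable_norm2 ww)
    fix \<xi>
    have "(\<Sum>i\<in>UNIV. \<Sum>j\<in>UNIV. sobolev_weight s \<xi> * (norm (gradient_hat w i j \<xi>))\<^sup>2)
        = sobolev_weight s \<xi> * (\<Sum>i\<in>UNIV. \<Sum>j\<in>UNIV. (norm (gradient_hat w i j \<xi>))\<^sup>2)"
      by (simp add: sum_distrib_left)
    also have "\<dots> \<le> sobolev_weight s \<xi> * (norm (fourier_vec w \<xi>))\<^sup>2"
      by (intro mult_left_mono sum_norm2_gradient_hat less_imp_le[OF sobolev_weight_pos])
    finally show "(\<Sum>i\<in>UNIV. \<Sum>j\<in>UNIV. sobolev_weight s \<xi> * (norm (gradient_hat w i j \<xi>))\<^sup>2) \<le> (norm (weighted_vec s w \<xi>))\<^sup>2"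
      by (simp only: weighted_vec_norm2)
  qed
  also have "\<dots> = (sobolev_norm s w)\<^sup>2"
    by (simp add: norm_cls2[OF ww, symmetric] norm_sobolev_class[OF w, symmetric] sobolev_class_def)
  finally show ?thesis .
qed

text \<open>The bilinear form behind the stretching term: the derivative along \<open>v\<close> of the velocity of \<open>w\<close>.\<close>

definition stretch :: "(real^3 \<Rightarrow> real^3) \<Rightarrow> (real^3 \<Rightarrow> real^3) \<Rightarrow> real^3 \<Rightarrow> real^3" where
  "stretch v w x = (\<chi> i. \<Sum>j\<in>UNIV. v x $ j * velocity_gradient w i j x)"

lemma stretching_eq_stretch: "w \<in> sobolev s \<Longrightarrow> stretching w = stretch w w"
  unfolding stretching_def[abs_def] stretch_def[abs_def]
  by (simp add: frechet_derivative_at[OF velocity_has_derivative, symmetric])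

lemma stretch_left_linear:
  "stretch (\<lambda>x. a *\<^sub>R v x + b *\<^sub>R v' x) w x = a *\<^sub>R stretch v w x + b *\<^sub>R stretch v' w x"
  by (simp add: stretch_def vec_eq_iff sum.distrib sum_distrib_left algebra_simps)

lemma velocity_gradient_linear:
  assumes v: "v \<in> sobolev s" and w: "w \<in> sobolev s"
  shows "velocity_gradient (\<lambda>x. a *\<^sub>R v x + b *\<^sub>R w x) i j x = a * velocity_gradient v i j x + b * velocity_gradient w i j x"
proof -
  let ?z = "\<lambda>x. a *\<^sub>R v x + b *\<^sub>R w x"
  note z = sobolev_class_lin[OF v w, of a b]
  let ?c = "\<lambda>\<xi>. cis (2 * pi * (x \<bullet> \<xi>))"
  have ig: "integrable lborel (\<lambda>\<xi>. ?c \<xi> * gradient_hat u i j \<xi>)" if "u \<in> sobolev s" for u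
    using that by (intro integrable_cis_mult gradient_hat_integrable) auto
  have "(LINT \<xi>|lborel. ?c \<xi> * gradient_hat ?z i j \<xi>)
      = (LINT \<xi>|lborel. a *\<^sub>R (?c \<xi> * gradient_hat v i j \<xi>) + b *\<^sub>R (?c \<xi> * gradient_hat w i j \<xi>))"
  proof (rule integral_cong_AE)
    show "AE \<xi> in lborel. ?c \<xi> * gradient_hat ?z i j \<xi> = a *\<^sub>R (?c \<xi> * gradient_hat v i j \<xi>) + b *\<^sub>R (?c \<xi> * gradient_hat w i j \<xi>)"
      using z(3)
    proof eventually_elim
      case (elim \<xi>)
      from velocity_hat_linear[OF this] show ?case
        by (simp add: gradient_hat_def algebra_simps)
    qed
    show "(\<lambda>\<xi>. ?c \<xi> * gradient_hat ?z i j \<xi>) \<in> borel_measurable lborel"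
      using ig[OF z(1)] by (rule borel_measurable_integrable)
    show "(\<lambda>\<xi>. a *\<^sub>R (?c \<xi> * gradient_hat v i j \<xi>) + b *\<^sub>R (?c \<xi> * gradient_hat w i j \<xi>)) \<in> borel_measurable lborel"
      by (intro borel_measurable_integrable Bochner_Integration.integrable_add integrable_scaleR_right ig v w)
  qed
  also have "\<dots> = a *\<^sub>R (LINT \<xi>|lborel. ?c \<xi> * gradient_hat v i j \<xi>) + b *\<^sub>R (LINT \<xi>|lborel. ?c \<xi> * gradient_hat w i j \<xi>)"
    by (subst Bochner_Integration.integral_add) (simp_all add: ig v w)
  finally show ?thesis by (simp add: velocity_gradient_def)
qed

lemma stretch_right_linear:
  assumes "w \<in> sobolev s" "w' \<in> sobolev s"
  shows "stretch v (\<lambda>x. a *\<^sub>R w x + b *\<^sub>R w' x) x = a *\<^sub>R stretch v w x + b *\<^sub>R stretch v w' x"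
  by (simp add: stretch_def vec_eq_iff velocity_gradient_linear[OF assms] sum.distrib sum_distrib_left algebra_simps)

lemma stretch_cong_AE:
  assumes v: "v \<in> borel_measurable borel" "v' \<in> borel_measurable borel" "AE x in lborel. v x = v' x"
    and w: "w \<in> borel_measurable borel" "w' \<in> borel_measurable borel" "AE x in lborel. w x = w' x"
  shows "AE x in lborel. stretch v w x = stretch v' w' x"
proof -
  have "fourier_vec w = fourier_vec w'" by (rule fourier_vec_cong_AE[OF w])
  then have "velocity_gradient w = velocity_gradient w'"
    by (simp add: velocity_gradient_def[abs_def] gradient_hat_def velocity_hat_def)
  with v(3) show ?thesis by (auto simp: stretch_def elim: eventually_mono)
qed

end

locale sobolev_algebra = smooth_sobolev +
  fixes C :: real
  assumes C: "0 < C"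
    and algebra: "\<And>f g :: real^3 \<Rightarrow> real. f \<in> sobolev s \<Longrightarrow> g \<in> sobolev s \<Longrightarrow>
      (\<lambda>x. f x * g x) \<in> sobolev s \<and>
      sobolev_norm s (\<lambda>x. f x * g x) \<le> C * sobolev_norm s f * sobolev_norm s g"
begin

text \<open>The algebra inequality is used for each of the nine products of scalar functions.  The Cauchy-Schwarz
  inequality in the index \<open>j\<close> and summation over \<open>i\<close> then keep the constant equal to \<open>C\<close>.\<close>

lemma stretch_bound:
  assumes v: "v \<in> sobolev s" and w: "w \<in> sobolev s"
  shows "stretch v w \<in> sobolev s" "sobolev_norm s (stretch v w) \<le> C * sobolev_norm s v * sobolev_norm s w"
proof -
  let ?n = "sobolev_norm s"
  let ?v = "\<lambda>j x. v x $ j" and ?G = "\<lambda>i j. velocity_gradient w i j"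
  have vj: "?v j \<in> sobolev s" for j using v by (simp add: sobolev_vec_iff_components)
  note G = velocity_gradient_sobolev(1)[OF w]
  have nonneg: "0 \<le> ?n f" for f :: "real^3 \<Rightarrow> real"
    by (auto simp: sobolev_norm_def integral_nonneg_AE less_imp_le[OF sobolev_weight_pos] sum_nonneg)
  have comp: "(\<lambda>x. \<Sum>j\<in>UNIV. ?v j x * ?G i j x) \<in> sobolev s \<and>
      ?n (\<lambda>x. \<Sum>j\<in>UNIV. ?v j x * ?G i j x) \<le> (\<Sum>j\<in>UNIV. ?n (\<lambda>x. ?v j x * ?G i j x))" for i
    by (rule sobolev_real_sum) (simp add: algebra vj G)
  have nth: "(\<lambda>x. stretch v w x $ i) = (\<lambda>x. \<Sum>j\<in>UNIV. ?v j x * ?G i j x)" for i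
    by (simp add: stretch_def)
  show S: "stretch v w \<in> sobolev s"
    unfolding sobolev_vec_iff_components nth using comp by blast
  have ci: "(?n (\<lambda>x. stretch v w x $ i))\<^sup>2 \<le> C\<^sup>2 * ((?n v)\<^sup>2 * (\<Sum>j\<in>UNIV. (?n (?G i j))\<^sup>2))" for i
  proof -
    have "?n (\<lambda>x. stretch v w x $ i) \<le> (\<Sum>j\<in>UNIV. ?n (\<lambda>x. ?v j x * ?G i j x))"
      unfolding nth using comp by blast
    also have "\<dots> \<le> (\<Sum>j\<in>UNIV. C * (?n (?v j) * ?n (?G i j)))"
      using algebra[OF vj G] by (intro sum_mono) (simp add: mult.assoc)
    also have "\<dots> = C * (\<Sum>j\<in>UNIV. ?n (?v j) * ?n (?G i j))" by (simp add: sum_distrib_left)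
    finally have "(?n (\<lambda>x. stretch v w x $ i))\<^sup>2 \<le> (C * (\<Sum>j\<in>UNIV. ?n (?v j) * ?n (?G i j)))\<^sup>2"
      by (intro power_mono nonneg)
    also have "\<dots> = C\<^sup>2 * (\<Sum>j\<in>UNIV. ?n (?v j) * ?n (?G i j))\<^sup>2" by (rule power_mult_distrib)
    also have "\<dots> \<le> C\<^sup>2 * ((\<Sum>j\<in>UNIV. (?n (?v j))\<^sup>2) * (\<Sum>j\<in>UNIV. (?n (?G i j))\<^sup>2))"
      by (intro mult_left_mono Cauchy_Schwarz_ineq_sum) simp
    finally show ?thesis unfolding sobolev_norm_vec[OF v] .
  qed
  have "(?n (stretch v w))\<^sup>2 \<le> (\<Sum>i\<in>UNIV. C\<^sup>2 * ((?n v)\<^sup>2 * (\<Sum>j\<in>UNIV. (?n (?G i j))\<^sup>2)))"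
    unfolding sobolev_norm_vec[OF S] by (intro sum_mono ci)
  also have "\<dots> = C\<^sup>2 * (?n v)\<^sup>2 * (\<Sum>i\<in>UNIV. \<Sum>j\<in>UNIV. (?n (?G i j))\<^sup>2)"
    by (simp add: sum_distrib_left mult.assoc)
  also have "\<dots> \<le> C\<^sup>2 * (?n v)\<^sup>2 * (?n w)\<^sup>2"
    by (intro mult_left_mono sum_norm2_velocity_gradient w) simp
  also have "\<dots> = (C * ?n v * ?n w)\<^sup>2" by (simp add: power_mult_distrib)
  finally show "?n (stretch v w) \<le> C * ?n v * ?n w"
    by (rule power2_le_imp_le) (use C in \<open>simp add: norm_sobolev_class[OF v, symmetric] norm_sobolev_class[OF w, symmetric]\<close>)
qed

end

section \<open>The Helmholtz projection\<close>

definition freq_dot :: "real^3 \<Rightarrow> complex^3 \<Rightarrow> complex" where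
  "freq_dot \<xi> h = (\<Sum>i\<in>UNIV. complex_of_real (\<xi> $ i) * h $ i)"

text \<open>The symbol of the projection, \<open>h - (\<xi> \<cdot> h) \<xi> / |\<xi>|\<^sup>2\<close>.  At \<open>\<xi> = 0\<close> the quotient is 0, and the
  symbol is the identity.\<close>

definition leray :: "real^3 \<Rightarrow> complex^3 \<Rightarrow> complex^3" where
  "leray \<xi> h = (\<chi> i. h $ i - freq_dot \<xi> h / (complex_of_real (norm \<xi>))\<^sup>2 * complex_of_real (\<xi> $ i))"

lemma sobolev_df_iff:
  "v \<in> sobolev_df s \<longleftrightarrow> v \<in> sobolev s \<and> (AE \<xi> in lborel. freq_dot \<xi> (fourier_vec v \<xi>) = 0)"
  by (simp add: sobolev_df_def freq_dot_def)

lemma freq_dot_linear: "freq_dot \<xi> (a *\<^sub>R g + b *\<^sub>R h) = a *\<^sub>R freq_dot \<xi> g + b *\<^sub>R freq_dot \<xi> h"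
  by (simp add: freq_dot_def sum.distrib scaleR_sum_right algebra_simps)

lemma freq_dot_scaleR: "freq_dot \<xi> (a *\<^sub>R g) = a *\<^sub>R freq_dot \<xi> g"
  using freq_dot_linear[of \<xi> a g 0 0] by simp

lemma freq_dot_leray: "freq_dot \<xi> (leray \<xi> h) = 0"
proof (cases "\<xi> = 0")
  case True
  then show ?thesis by (simp add: freq_dot_def)
next
  case False
  define c where "c = freq_dot \<xi> h / (complex_of_real (norm \<xi>))\<^sup>2"
  have L: "leray \<xi> h $ i = h $ i - c * complex_of_real (\<xi> $ i)" for i by (simp add: leray_def c_def)
  have "freq_dot \<xi> (leray \<xi> h) = freq_dot \<xi> h - c * (\<Sum>i\<in>UNIV. (complex_of_real (\<xi> $ i))\<^sup>2)"
    by (simp add: freq_dot_def L sum_3 power2_eq_square algebra_simps)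
  also have "(\<Sum>i\<in>UNIV. (complex_of_real (\<xi> $ i))\<^sup>2) = complex_of_real ((norm \<xi>)\<^sup>2)"
    by (simp add: norm2_vec3)
  finally show ?thesis using False by (simp add: c_def)
qed

lemma norm_freq_dot: "norm (freq_dot \<xi> h) \<le> norm \<xi> * norm h"
proof (rule power2_le_imp_le)
  have "norm (freq_dot \<xi> h) \<le> (\<Sum>i\<in>UNIV. \<bar>\<xi> $ i\<bar> * norm (h $ i))"
    unfolding freq_dot_def by (rule order_trans[OF norm_sum]) (simp add: norm_mult)
  then have "(norm (freq_dot \<xi> h))\<^sup>2 \<le> (\<Sum>i\<in>UNIV. \<bar>\<xi> $ i\<bar> * norm (h $ i))\<^sup>2"
    by (rule power_mono) simp
  also have "\<dots> \<le> (\<Sum>i\<in>UNIV. \<bar>\<xi> $ i\<bar>\<^sup>2) * (\<Sum>i\<in>UNIV. (norm (h $ i))\<^sup>2)"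
    by (rule Cauchy_Schwarz_ineq_sum)
  also have "\<dots> = (norm \<xi> * norm h)\<^sup>2"
    by (simp add: power_mult_distrib norm2_vec3)
  finally show "(norm (freq_dot \<xi> h))\<^sup>2 \<le> (norm \<xi> * norm h)\<^sup>2" .
qed simp

lemma norm_leray_nth: "norm (leray \<xi> h $ i) \<le> 2 * norm h"
proof -
  have "norm (freq_dot \<xi> h / (complex_of_real (norm \<xi>))\<^sup>2 * complex_of_real (\<xi> $ i)) \<le> norm h"
  proof (cases "\<xi> = 0")
    case False
    have "norm (freq_dot \<xi> h / (complex_of_real (norm \<xi>))\<^sup>2 * complex_of_real (\<xi> $ i))
        = norm (freq_dot \<xi> h) * \<bar>\<xi> $ i\<bar> / (norm \<xi>)\<^sup>2"
      by (simp add: norm_mult norm_divide norm_power)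
    also have "\<dots> \<le> (norm \<xi> * norm h) * norm \<xi> / (norm \<xi>)\<^sup>2"
      by (intro divide_right_mono mult_mono norm_freq_dot) (auto simp: component_le_norm_cart)
    also have "\<dots> = norm h" using False by (simp add: power2_eq_square)
    finally show ?thesis .
  qed simp
  moreover have "norm (h $ i) \<le> norm h" by (rule Finite_Cartesian_Product.norm_nth_le)
  ultimately show ?thesis
    unfolding leray_def using norm_triangle_ineq4[of "h $ i" "freq_dot \<xi> h / (complex_of_real (norm \<xi>))\<^sup>2 * complex_of_real (\<xi> $ i)"]
    by simp
qed

lemma leray_cnj:
  assumes "\<And>i. g $ i = cnj (h $ i)"
  shows "leray (- \<xi>) g $ i = cnj (leray \<xi> h $ i)"
  by (simp add: leray_def freq_dot_def assms sum_negf)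

lemma leray_orthogonal:
  assumes "freq_dot \<xi> k = 0"
  shows "(\<Sum>i\<in>UNIV. (h $ i - leray \<xi> h $ i) \<bullet> (k $ i)) = 0"
proof -
  define c where "c = freq_dot \<xi> h / (complex_of_real (norm \<xi>))\<^sup>2"
  have L: "h $ i - leray \<xi> h $ i = c * complex_of_real (\<xi> $ i)" for i by (simp add: leray_def c_def)
  have "(\<Sum>i\<in>UNIV. (h $ i - leray \<xi> h $ i) \<bullet> (k $ i)) = Re (c * cnj (freq_dot \<xi> k))"
    unfolding L by (simp add: freq_dot_def inner_complex_def sum_3 algebra_simps)
  then show ?thesis by (simp add: assms)
qed

lemma inner_vec3: "(x :: 'a::real_inner ^ 3) \<bullet> y = (\<Sum>i\<in>UNIV. x $ i \<bullet> y $ i)"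
  by (simp add: inner_vec_def)

lemma sobolev_inner_eq:
  assumes v: "v \<in> sobolev s" and w: "w \<in> sobolev s"
  shows "sobolev_inner s v w = sobolev_class s v \<bullet> sobolev_class s w"
proof -
  have "sobolev_class s v \<bullet> sobolev_class s w = (LINT \<xi>|lborel. weighted_vec s v \<xi> \<bullet> weighted_vec s w \<xi>)"
    unfolding sobolev_class_def using v w by (simp add: inner_cls sobolev_vec_iff)
  also have "\<dots> = sobolev_inner s v w"
    unfolding sobolev_inner_def
    by (rule Bochner_Integration.integral_cong)
       (simp_all add: weighted_vec_def sum_Basis_vec3 inner_vec3 fourier_vec_def power2_eq_square[symmetric] sobolev_weight_half mult.assoc[symmetric] sum_distrib_left)
  finally show ?thesis by simp
qed

lemma sobolev_df_lin:
  assumes v: "v \<in> sobolev_df s" and w: "w \<in> sobolev_df s"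
  shows "(\<lambda>x. a *\<^sub>R v x + b *\<^sub>R w x) \<in> sobolev_df s"
proof -
  have vw: "v \<in> sobolev s" "w \<in> sobolev s" using v w by (auto simp: sobolev_df_iff)
  have "AE \<xi> in lborel. freq_dot \<xi> (fourier_vec (\<lambda>x. a *\<^sub>R v x + b *\<^sub>R w x) \<xi>) = 0"
    using v w sobolev_class_lin(3)[OF vw, of a b] unfolding sobolev_df_iff
    by (auto simp: freq_dot_linear elim!: eventually_elim2 intro: eventually_conj)
  then show ?thesis using sobolev_class_lin(1)[OF vw] by (simp add: sobolev_df_iff)
qed

text \<open>Dividing by the weight, which is at least 1, keeps the function square integrable and Hermitian.\<close>

lemma sobolev_class_surj:
  assumes s: "0 \<le> s" and g: "square_integrable g" and herm: "\<And>i. hermitian (\<lambda>\<xi>. g \<xi> $ i)"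
  shows "\<exists>v\<in>sobolev s. sobolev_class s v = cls g \<and> (AE \<xi> in lborel. weighted_vec s v \<xi> = g \<xi>)"
proof -
  have [measurable]: "g \<in> borel_measurable borel" using g by (rule square_integrable_measurable)
  let ?h = "\<lambda>\<xi>. (1 / sobolev_weight (s / 2) \<xi>) *\<^sub>R g \<xi>"
  have h: "square_integrable ?h"
  proof (rule square_integrable_bound[OF g])
    show "AE \<xi> in lborel. norm (?h \<xi>) \<le> 1 * norm (g \<xi>)"
    proof (rule AE_I2)
      fix \<xi>
      have "1 \<le> sobolev_weight (s / 2) \<xi>" using s by (intro sobolev_weight_ge_1) simp
      then have "\<bar>1 / sobolev_weight (s / 2) \<xi>\<bar> \<le> 1" by simp
      then show "norm (?h \<xi>) \<le> 1 * norm (g \<xi>)" unfolding norm_scaleR by (rule mult_right_mono) simp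
    qed
  qed measurable
  have hh: "hermitian (\<lambda>\<xi>. ?h \<xi> $ i)" for i
    using herm[of i] unfolding hermitian_def
    by eventually_elim (simp add: sobolev_weight_uminus)
  obtain v where v: "square_integrable v" "AE \<xi> in lborel. fourier_vec v \<xi> = ?h \<xi>"
    using fourier_vec_surj[OF h hh] by blast
  have eq: "AE \<xi> in lborel. g \<xi> = weighted_vec s v \<xi>"
    using v(2)
  proof eventually_elim
    case (elim \<xi>)
    then show ?case using sobolev_weight_pos[of "s / 2" \<xi>] by (simp add: weighted_vec_def)
  qed
  have [measurable]: "fourier_vec v \<in> borel_measurable borel"
    by (intro square_integrable_measurable square_integrable_fourier_vec v)
  have "weighted_vec s v \<in> borel_measurable borel" unfolding weighted_vec_def[abs_def] by measurable
  from square_integrable_cong_AE[OF g this eq] have wv: "square_integrable (weighted_vec s v)" .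
  then have "v \<in> sobolev s" by (simp add: sobolev_vec_iff v)
  moreover have eq': "AE \<xi> in lborel. weighted_vec s v \<xi> = g \<xi>" using eq by (auto elim: eventually_mono)
  moreover have "sobolev_class s v = cls g"
    unfolding sobolev_class_def using cls_eq_iff[OF wv g] eq' by simp
  ultimately show ?thesis by blast
qed

lemma hermitian_weighted_vec:
  assumes "v \<in> sobolev s"
  shows "AE \<xi> in lborel. \<forall>i. weighted_vec s v (- \<xi>) $ i = cnj (weighted_vec s v \<xi> $ i)"
proof -
  have "AE \<xi> in lborel. \<forall>i. fourier_vec v (- \<xi>) $ i = cnj (fourier_vec v \<xi> $ i)"
    unfolding fourier_vec_nth using assms
    by (intro AE_all_3 hermitian_fourier_real[unfolded hermitian_def] square_integrable_nth) (auto simp: sobolev_vec_iff)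
  then show ?thesis by eventually_elim (simp add: weighted_vec_def sobolev_weight_uminus)
qed

lemma freq_dot_weighted_vec: "freq_dot \<xi> (weighted_vec s v \<xi>) = 0 \<longleftrightarrow> freq_dot \<xi> (fourier_vec v \<xi>) = 0"
  using sobolev_weight_pos[of "s / 2" \<xi>] by (simp add: weighted_vec_def freq_dot_scaleR)

text \<open>Removing the component along the frequency leaves a field that is divergence free, and what is
  removed is pointwise orthogonal to every divergence free transform.\<close>

lemma helmholtz_exists:
  assumes s: "0 \<le> s" and f: "f \<in> sobolev s"
  shows "\<exists>w\<in>sobolev_df s. \<forall>v\<in>sobolev_df s. sobolev_inner s (\<lambda>x. f x - w x) v = 0"
proof -
  have wf: "square_integrable (weighted_vec s f)" using f by (simp add: sobolev_vec_iff)
  have [measurable]: "weighted_vec s f \<in> borel_measurable borel" using wf by (rule square_integrable_measurable)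
  let ?g = "\<lambda>\<xi>. leray \<xi> (weighted_vec s f \<xi>)"
  have g: "square_integrable ?g"
  proof (rule square_integrable_vec_lambda)
    fix i
    show "square_integrable (\<lambda>\<xi>. ?g \<xi> $ i)"
    proof (rule square_integrable_bound[OF wf])
      show "(\<lambda>\<xi>. ?g \<xi> $ i) \<in> borel_measurable borel"
        unfolding leray_def freq_dot_def by simp
      show "AE \<xi> in lborel. norm (?g \<xi> $ i) \<le> 2 * norm (weighted_vec s f \<xi>)"
        by (intro AE_I2 norm_leray_nth)
    qed
  qed
  have herm: "hermitian (\<lambda>\<xi>. ?g \<xi> $ i)" for i
    using hermitian_weighted_vec[OF f] unfolding hermitian_def
    by eventually_elim (simp add: leray_cnj)
  obtain w where w: "w \<in> sobolev s" "sobolev_class s w = cls ?g" "AE \<xi> in lborel. weighted_vec s w \<xi> = ?g \<xi>"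
    using sobolev_class_surj[OF s g herm] by blast
  have "AE \<xi> in lborel. freq_dot \<xi> (fourier_vec w \<xi>) = 0"
    using w(3) by eventually_elim (metis freq_dot_weighted_vec freq_dot_leray)
  then have wdf: "w \<in> sobolev_df s" using w(1) by (simp add: sobolev_df_iff)
  moreover have "sobolev_inner s (\<lambda>x. f x - w x) v = 0" if v: "v \<in> sobolev_df s" for v
  proof -
    have vs: "v \<in> sobolev s" and v0: "AE \<xi> in lborel. freq_dot \<xi> (weighted_vec s v \<xi>) = 0"
      using v by (auto simp: sobolev_df_iff freq_dot_weighted_vec)
    have wv: "square_integrable (weighted_vec s v)" using vs by (simp add: sobolev_vec_iff)
    note lin = sobolev_class_lin[OF f w(1), of 1 "-1", simplified]
    have "sobolev_inner s (\<lambda>x. f x - w x) v = (cls (weighted_vec s f) - cls ?g) \<bullet> cls (weighted_vec s v)"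
      using lin(1,2) by (simp add: sobolev_inner_eq vs w(2)) (simp add: sobolev_class_def)
    also have "\<dots> = (LINT \<xi>|lborel. (weighted_vec s f \<xi> - ?g \<xi>) \<bullet> weighted_vec s v \<xi>)"
      by (simp add: cls_diff[symmetric] inner_cls square_integrable_diff wf g wv)
    also have "\<dots> = 0"
    proof (rule integral_eq_zero_AE)
      show "AE \<xi> in lborel. (weighted_vec s f \<xi> - ?g \<xi>) \<bullet> weighted_vec s v \<xi> = 0"
        using v0 by eventually_elim (simp add: inner_vec3 leray_orthogonal)
    qed
    finally show ?thesis .
  qed
  ultimately show ?thesis by blast
qed

lemma helmholtz_spec:
  assumes "0 \<le> s" "f \<in> sobolev s"
  shows "helmholtz s f \<in> sobolev_df s"
    "\<And>v. v \<in> sobolev_df s \<Longrightarrow> (sobolev_class s f - sobolev_class s (helmholtz s f)) \<bullet> sobolev_class s v = 0"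
proof -
  define P where "P = (\<lambda>w. w \<in> sobolev_df s \<and> (\<forall>v\<in>sobolev_df s. sobolev_inner s (\<lambda>x. f x - w x) v = 0))"
  have "\<exists>w. P w" unfolding P_def using helmholtz_exists[OF assms] by blast
  then have "P (Eps P)" by (rule someI_ex)
  moreover have "helmholtz s f = Eps P" by (simp add: helmholtz_def P_def)
  ultimately have P: "P (helmholtz s f)" by simp
  then show df: "helmholtz s f \<in> sobolev_df s" by (simp add: P_def)
  fix v assume v: "v \<in> sobolev_df s"
  have hs: "helmholtz s f \<in> sobolev s" and vs: "v \<in> sobolev s" using df v by (auto simp: sobolev_df_iff)
  note lin = sobolev_class_lin[OF assms(2) hs, of 1 "-1", simplified]
  have "sobolev_inner s (\<lambda>x. f x - helmholtz s f x) v = 0" using P v by (simp add: P_def)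
  then show "(sobolev_class s f - sobolev_class s (helmholtz s f)) \<bullet> sobolev_class s v = 0"
    using lin(1,2) by (simp add: sobolev_inner_eq vs)
qed

text \<open>Two candidates differ by a divergence free field that is orthogonal to itself.  Since the projection
  is a choice of a representative, only its class is determined.\<close>

lemma helmholtz_unique:
  assumes s: "0 \<le> s" and f: "f \<in> sobolev s" and w: "w \<in> sobolev_df s"
    and orth: "\<And>v. v \<in> sobolev_df s \<Longrightarrow> (sobolev_class s f - sobolev_class s w) \<bullet> sobolev_class s v = 0"
  shows "sobolev_class s (helmholtz s f) = sobolev_class s w"
proof -
  note h = helmholtz_spec[OF s f]
  have hs: "helmholtz s f \<in> sobolev s" and ws: "w \<in> sobolev s" using h(1) w by (auto simp: sobolev_df_iff)
  let ?z = "\<lambda>x. 1 *\<^sub>R helmholtz s f x + (-1) *\<^sub>R w x"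
  have z: "?z \<in> sobolev_df s" by (rule sobolev_df_lin[OF h(1) w])
  have zc: "sobolev_class s ?z = sobolev_class s (helmholtz s f) - sobolev_class s w"
    using sobolev_class_lin(2)[OF hs ws, of 1 "-1"] by simp
  have "sobolev_class s ?z \<bullet> sobolev_class s ?z
      = (sobolev_class s f - sobolev_class s w) \<bullet> sobolev_class s ?z - (sobolev_class s f - sobolev_class s (helmholtz s f)) \<bullet> sobolev_class s ?z"
    unfolding inner_diff_left[symmetric] by (subst (1) zc) simp
  also have "\<dots> = 0" using orth[OF z] h(2)[OF z] by simp
  finally show ?thesis unfolding zc by simp
qed

lemma norm_helmholtz_le:
  assumes "0 \<le> s" "f \<in> sobolev s"
  shows "norm (sobolev_class s (helmholtz s f)) \<le> norm (sobolev_class s f)"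
proof -
  note h = helmholtz_spec[OF assms]
  let ?h = "sobolev_class s (helmholtz s f)"
  have "(norm ?h)\<^sup>2 = sobolev_class s f \<bullet> ?h"
    using h(2)[OF h(1)] by (simp add: inner_diff_left power2_norm_eq_inner)
  also have "\<dots> \<le> norm (sobolev_class s f) * norm ?h" by (rule norm_cauchy_schwarz)
  finally have "norm ?h * norm ?h \<le> norm (sobolev_class s f) * norm ?h" by (simp add: power2_eq_square)
  then show ?thesis by (cases "norm ?h = 0") auto
qed

lemma helmholtz_lin:
  assumes s: "0 \<le> s" and f: "f \<in> sobolev s" and g: "g \<in> sobolev s"
  shows "sobolev_class s (helmholtz s (\<lambda>x. a *\<^sub>R f x + b *\<^sub>R g x))
    = a *\<^sub>R sobolev_class s (helmholtz s f) + b *\<^sub>R sobolev_class s (helmholtz s g)"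
proof -
  note hf = helmholtz_spec[OF s f] and hg = helmholtz_spec[OF s g]
  have hs: "helmholtz s f \<in> sobolev s" "helmholtz s g \<in> sobolev s" using hf(1) hg(1) by (auto simp: sobolev_df_iff)
  let ?w = "\<lambda>x. a *\<^sub>R helmholtz s f x + b *\<^sub>R helmholtz s g x"
  have "sobolev_class s (helmholtz s (\<lambda>x. a *\<^sub>R f x + b *\<^sub>R g x)) = sobolev_class s ?w"
  proof (rule helmholtz_unique[OF s])
    show "(\<lambda>x. a *\<^sub>R f x + b *\<^sub>R g x) \<in> sobolev s" by (rule sobolev_class_lin(1)[OF f g])
    show "?w \<in> sobolev_df s" by (rule sobolev_df_lin[OF hf(1) hg(1)])
    fix v assume v: "v \<in> sobolev_df s"
    have "sobolev_class s (\<lambda>x. a *\<^sub>R f x + b *\<^sub>R g x) - sobolev_class s ?w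
        = a *\<^sub>R (sobolev_class s f - sobolev_class s (helmholtz s f)) + b *\<^sub>R (sobolev_class s g - sobolev_class s (helmholtz s g))"
      unfolding sobolev_class_lin(2)[OF f g] sobolev_class_lin(2)[OF hs] by (simp add: scaleR_diff_right)
    then show "(sobolev_class s (\<lambda>x. a *\<^sub>R f x + b *\<^sub>R g x) - sobolev_class s ?w) \<bullet> sobolev_class s v = 0"
      using hf(2)[OF v] hg(2)[OF v] by (simp add: inner_add_left)
  qed
  then show ?thesis by (simp add: sobolev_class_lin(2)[OF hs])
qed

lemma helmholtz_cong:
  assumes s: "0 \<le> s" and f: "f \<in> sobolev s" and g: "g \<in> sobolev s" and eq: "sobolev_class s f = sobolev_class s g"
  shows "sobolev_class s (helmholtz s f) = sobolev_class s (helmholtz s g)"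
  using helmholtz_spec[OF s g] by (intro helmholtz_unique[OF s f]) (auto simp: eq)

section \<open>The space of divergence free fields\<close>

definition df_space :: "real \<Rightarrow> (complex^3) l2 set" where
  "df_space s = sobolev_class s ` sobolev_df s"

lemma df_space_iff:
  assumes s: "0 \<le> s" and g: "square_integrable g"
  shows "cls g \<in> df_space s \<longleftrightarrow>
    (AE \<xi> in lborel. \<forall>i. g (- \<xi>) $ i = cnj (g \<xi> $ i)) \<and> (AE \<xi> in lborel. freq_dot \<xi> (g \<xi>) = 0)"
proof
  assume "cls g \<in> df_space s"
  then obtain v where v: "v \<in> sobolev_df s" "cls g = sobolev_class s v" by (auto simp: df_space_def)
  then have vs: "v \<in> sobolev s" by (simp add: sobolev_df_iff)
  have eq: "AE \<xi> in lborel. g \<xi> = weighted_vec s v \<xi>"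
    using v(2) vs g by (simp add: sobolev_class_def cls_eq_iff sobolev_vec_iff)
  have "AE \<xi> in lborel. \<forall>i. g (- \<xi>) $ i = cnj (g \<xi> $ i)"
    using eq AE_lborel_reflect[OF eq] hermitian_weighted_vec[OF vs] by eventually_elim simp
  moreover have "AE \<xi> in lborel. freq_dot \<xi> (g \<xi>) = 0"
  proof -
    have "AE \<xi> in lborel. freq_dot \<xi> (fourier_vec v \<xi>) = 0" using v(1) by (simp add: sobolev_df_iff)
    then show ?thesis using eq by eventually_elim (simp add: freq_dot_weighted_vec)
  qed
  ultimately show "(AE \<xi> in lborel. \<forall>i. g (- \<xi>) $ i = cnj (g \<xi> $ i)) \<and> (AE \<xi> in lborel. freq_dot \<xi> (g \<xi>) = 0)" ..
next
  assume A: "(AE \<xi> in lborel. \<forall>i. g (- \<xi>) $ i = cnj (g \<xi> $ i)) \<and> (AE \<xi> in lborel. freq_dot \<xi> (g \<xi>) = 0)"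
  have herm: "hermitian (\<lambda>\<xi>. g \<xi> $ i)" for i
    unfolding hermitian_def using conjunct1[OF A] by eventually_elim simp
  obtain v where v: "v \<in> sobolev s" "sobolev_class s v = cls g" "AE \<xi> in lborel. weighted_vec s v \<xi> = g \<xi>"
    using sobolev_class_surj[OF s g herm] by blast
  have "AE \<xi> in lborel. freq_dot \<xi> (fourier_vec v \<xi>) = 0"
    using v(3) conjunct2[OF A] by eventually_elim (metis freq_dot_weighted_vec)
  then have "v \<in> sobolev_df s" using v(1) by (simp add: sobolev_df_iff)
  then show "cls g \<in> df_space s" unfolding df_space_def v(2)[symmetric] by (rule imageI)
qed

text \<open>A convergent sequence of classes has a subsequence of representatives that converges almost
  everywhere, at the reflected points too, and the two pointwise conditions are closed.\<close>

lemma closed_df_space: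
  assumes s: "0 \<le> s"
  shows "closed (df_space s)"
  unfolding closed_sequential_limits
proof (intro allI impI, elim conjE)
  fix y l assume y: "\<forall>n. y n \<in> df_space s" and lim: "y \<longlonglongrightarrow> l"
  have "\<exists>f. \<forall>n. square_integrable (f n) \<and> y n = cls (f n)" by (rule choice) (metis cls_cases)
  then obtain f where f: "\<And>n. square_integrable (f n)" and yf: "\<And>n. y n = cls (f n)" by blast
  obtain g where g: "square_integrable g" "l = cls g" by (rule cls_cases)
  have "y = (\<lambda>n. cls (f n))" using yf by auto
  then obtain r where r: "AE \<xi> in lborel. (\<lambda>n. f (r n) \<xi>) \<longlonglongrightarrow> g \<xi>"
    using cls_tendsto_AE_subseq[of f g, OF f g(1)] lim g(2) by auto
  have fh: "AE \<xi> in lborel. \<forall>n. (\<forall>i. f n (- \<xi>) $ i = cnj (f n \<xi> $ i)) \<and> freq_dot \<xi> (f n \<xi>) = 0"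
    unfolding AE_all_countable using y df_space_iff[OF s f] by (auto simp: yf)
  have "AE \<xi> in lborel. (\<forall>i. g (- \<xi>) $ i = cnj (g \<xi> $ i)) \<and> freq_dot \<xi> (g \<xi>) = 0"
    using r AE_lborel_reflect[OF r] fh
  proof eventually_elim
    case (elim \<xi>)
    have "g (- \<xi>) $ i = cnj (g \<xi> $ i)" for i
    proof (rule LIMSEQ_unique)
      show "(\<lambda>n. f (r n) (- \<xi>) $ i) \<longlonglongrightarrow> g (- \<xi>) $ i" by (intro tendsto_intros elim)
      show "(\<lambda>n. f (r n) (- \<xi>) $ i) \<longlonglongrightarrow> cnj (g \<xi> $ i)"
        using elim(3) by (simp add: tendsto_cnj tendsto_vec_nth elim(1))
    qed
    moreover have "freq_dot \<xi> (g \<xi>) = 0"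
    proof (rule LIMSEQ_unique)
      show "(\<lambda>n. freq_dot \<xi> (f (r n) \<xi>)) \<longlonglongrightarrow> freq_dot \<xi> (g \<xi>)"
        unfolding freq_dot_def by (intro tendsto_intros elim)
      show "(\<lambda>n. freq_dot \<xi> (f (r n) \<xi>)) \<longlonglongrightarrow> 0" using elim(3) by simp
    qed
    ultimately show ?case by blast
  qed
  then show "l \<in> df_space s"
    unfolding g(2) df_space_iff[OF s g(1)] by (auto elim: eventually_mono)
qed

lemma subspace_df_space: "subspace (df_space s)"
proof (rule subspaceI)
  have lin: "a *\<^sub>R x + b *\<^sub>R y \<in> df_space s" if xy: "x \<in> df_space s" "y \<in> df_space s" for a b x y
  proof -
    obtain v w where v: "v \<in> sobolev_df s" "x = sobolev_class s v" and w: "w \<in> sobolev_df s" "y = sobolev_class s w"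
      using xy by (auto simp: df_space_def)
    then have "sobolev_class s (\<lambda>x. a *\<^sub>R v x + b *\<^sub>R w x) = a *\<^sub>R x + b *\<^sub>R y"
      by (simp add: sobolev_class_lin sobolev_df_iff)
    moreover have "sobolev_class s (\<lambda>x. a *\<^sub>R v x + b *\<^sub>R w x) \<in> df_space s"
      unfolding df_space_def by (rule imageI) (rule sobolev_df_lin[OF v(1) w(1)])
    ultimately show ?thesis by simp
  qed
  show "x + y \<in> df_space s" if "x \<in> df_space s" "y \<in> df_space s" for x y
    using lin[OF that, of 1 1] by simp
  show "c *\<^sub>R x \<in> df_space s" if "x \<in> df_space s" for c x
    using lin[OF that that, of c 0] by simp
  have "(\<lambda>x. 0 :: real^3) \<in> sobolev s"
    unfolding sobolev_vec_iff_components by (simp add: sobolev_real_zero)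
  moreover have "AE \<xi> in lborel. freq_dot \<xi> (fourier_vec (\<lambda>x. 0) \<xi>) = 0"
    using fourier_vec_scaleR[of "\<lambda>x. 0" 0] by (auto simp: freq_dot_def elim: eventually_mono)
  ultimately have "(\<lambda>x. 0) \<in> sobolev_df s" by (simp add: sobolev_df_iff)
  then show "0 \<in> df_space s" using lin[of "sobolev_class s (\<lambda>x. 0)" "sobolev_class s (\<lambda>x. 0)" 0 0] by (simp add: df_space_def)
qed

section \<open>The stretching equation as a quadratic differential equation\<close>

lemma sobolev_measurable:
  fixes v :: "real^3 \<Rightarrow> real^3"
  shows "v \<in> sobolev s \<Longrightarrow> v \<in> borel_measurable borel"
  by (intro square_integrable_measurable) (simp add: sobolev_vec_iff)

lemma sobolev_class_in_df_space: "v \<in> sobolev_df s \<Longrightarrow> sobolev_class s v \<in> df_space s"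
  by (simp add: df_space_def)

lemma sobolev_df_cong_AE:
  assumes v: "v \<in> sobolev_df s" and w: "w \<in> borel_measurable borel" "AE x in lborel. v x = w x"
  shows "w \<in> sobolev_df s" "sobolev_class s w = sobolev_class s v"
proof -
  have vs: "v \<in> sobolev s" using v by (simp add: sobolev_df_iff)
  note c = sobolev_class_cong_AE[OF vs w]
  show "sobolev_class s w = sobolev_class s v" by (rule c)
  have "fourier_vec v = fourier_vec w"
    by (rule fourier_vec_cong_AE[OF sobolev_measurable[OF vs] w])
  then show "w \<in> sobolev_df s" using v c(1) by (simp add: sobolev_df_iff)
qed

lemma has_vector_derivative_iff_quotient:
  fixes f :: "real \<Rightarrow> 'a::real_normed_vector"
  shows "(f has_vector_derivative d) (at t within S) \<longleftrightarrow>
    ((\<lambda>\<tau>. norm ((1 / (\<tau> - t)) *\<^sub>R (f \<tau> - f t) - d)) \<longlongrightarrow> 0) (at t within S)"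
proof -
  have eq: "norm (f \<tau> - f t - (\<tau> - t) *\<^sub>R d) / norm (\<tau> - t) = norm ((1 / (\<tau> - t)) *\<^sub>R (f \<tau> - f t) - d)"
    if "\<tau> \<noteq> t" for \<tau>
  proof -
    have "(1 / (\<tau> - t)) *\<^sub>R (f \<tau> - f t) - d = (1 / (\<tau> - t)) *\<^sub>R (f \<tau> - f t - (\<tau> - t) *\<^sub>R d)"
      using that by (simp add: scaleR_diff_right)
    then show ?thesis by simp
  qed
  show ?thesis
    unfolding has_vector_derivative_def has_derivative_iff_norm
    by (simp add: bounded_linear_scaleR_left, intro filterlim_cong refl) (use eq in \<open>auto simp: eventually_at_filter\<close>)
qed

text \<open>A linear isometry carries difference quotients to difference quotients.\<close>

lemma C1_sobolev_df_iff:
  assumes mem: "\<And>t. t \<in> {0..T} \<Longrightarrow> \<omega> t \<in> sobolev_df s \<and> d t \<in> sobolev_df s"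
  shows "C1_sobolev_df s T \<omega> d \<longleftrightarrow>
    (\<forall>t\<in>{0..T}. ((\<lambda>t. sobolev_class s (\<omega> t)) has_vector_derivative sobolev_class s (d t)) (at t within {0..T}))
    \<and> continuous_on {0..T} (\<lambda>t. sobolev_class s (d t))"
proof -
  have ms: "\<omega> t \<in> sobolev s" "d t \<in> sobolev s" if "t \<in> {0..T}" for t
    using mem[OF that] by (auto simp: sobolev_df_iff)
  have D: "((\<lambda>\<tau>. sobolev_norm s (\<lambda>x. (1 / (\<tau> - t)) *\<^sub>R (\<omega> \<tau> x - \<omega> t x) - d t x)) \<longlongrightarrow> 0) (at t within {0..T})
     \<longleftrightarrow> ((\<lambda>t. sobolev_class s (\<omega> t)) has_vector_derivative sobolev_class s (d t)) (at t within {0..T})"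
    if t: "t \<in> {0..T}" for t
  proof -
    have "sobolev_norm s (\<lambda>x. (1 / (\<tau> - t)) *\<^sub>R (\<omega> \<tau> x - \<omega> t x) - d t x)
       = norm ((1 / (\<tau> - t)) *\<^sub>R (sobolev_class s (\<omega> \<tau>) - sobolev_class s (\<omega> t)) - sobolev_class s (d t))"
      if \<tau>: "\<tau> \<in> {0..T}" for \<tau>
    proof -
      have fun_eq: "(\<lambda>x. (1 / (\<tau> - t)) *\<^sub>R (\<omega> \<tau> x - \<omega> t x) - d t x)
          = (\<lambda>x. 1 *\<^sub>R ((1 / (\<tau> - t)) *\<^sub>R \<omega> \<tau> x + (- (1 / (\<tau> - t))) *\<^sub>R \<omega> t x) + (-1) *\<^sub>R d t x)"
        by (intro ext) (simp add: scaleR_diff_right)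
      note l1 = sobolev_class_lin[OF ms(1)[OF \<tau>] ms(1)[OF t], of "1 / (\<tau> - t)" "- (1 / (\<tau> - t))"]
      note l2 = sobolev_class_lin[OF l1(1) ms(2)[OF t], of 1 "-1"]
      show ?thesis
        unfolding fun_eq norm_sobolev_class[OF l2(1), symmetric] l2(2) l1(2)
        by (simp add: scaleR_diff_right)
    qed
    then have "((\<lambda>\<tau>. sobolev_norm s (\<lambda>x. (1 / (\<tau> - t)) *\<^sub>R (\<omega> \<tau> x - \<omega> t x) - d t x)) \<longlongrightarrow> 0) (at t within {0..T})
       \<longleftrightarrow> ((\<lambda>\<tau>. norm ((1 / (\<tau> - t)) *\<^sub>R (sobolev_class s (\<omega> \<tau>) - sobolev_class s (\<omega> t)) - sobolev_class s (d t))) \<longlongrightarrow> 0) (at t within {0..T})"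
      by (intro filterlim_cong refl) (auto simp: eventually_at_filter)
    also have "\<dots> \<longleftrightarrow> ((\<lambda>t. sobolev_class s (\<omega> t)) has_vector_derivative sobolev_class s (d t)) (at t within {0..T})"
      by (rule has_vector_derivative_iff_quotient[symmetric])
    finally show ?thesis .
  qed
  have E: "((\<lambda>\<tau>. sobolev_norm s (\<lambda>x. d \<tau> x - d t x)) \<longlongrightarrow> 0) (at t within {0..T})
     \<longleftrightarrow> ((\<lambda>\<tau>. sobolev_class s (d \<tau>)) \<longlongrightarrow> sobolev_class s (d t)) (at t within {0..T})"
    if t: "t \<in> {0..T}" for t
  proof -
    have "sobolev_norm s (\<lambda>x. d \<tau> x - d t x) = norm (sobolev_class s (d \<tau>) - sobolev_class s (d t))"
      if \<tau>: "\<tau> \<in> {0..T}" for \<tau>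
      using sobolev_class_lin[OF ms(2)[OF \<tau>] ms(2)[OF t], of 1 "-1"] by (simp add: norm_sobolev_class[symmetric])
    then have "((\<lambda>\<tau>. sobolev_norm s (\<lambda>x. d \<tau> x - d t x)) \<longlongrightarrow> 0) (at t within {0..T})
       \<longleftrightarrow> ((\<lambda>\<tau>. norm (sobolev_class s (d \<tau>) - sobolev_class s (d t))) \<longlongrightarrow> 0) (at t within {0..T})"
      by (intro filterlim_cong refl) (auto simp: eventually_at_filter)
    also have "\<dots> \<longleftrightarrow> ((\<lambda>\<tau>. sobolev_class s (d \<tau>)) \<longlongrightarrow> sobolev_class s (d t)) (at t within {0..T})"
      by (simp add: tendsto_norm_zero_iff LIM_zero_iff)
    finally show ?thesis .
  qed
  show ?thesis
    unfolding C1_sobolev_df_def continuous_on_def using mem D E by blast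
qed

context sobolev_algebra
begin

lemma s_nonneg: "0 \<le> s" using s by simp

text \<open>A divergence free field with a given class, arbitrary outside the range of the isometry.\<close>

definition representative :: "(complex^3) l2 \<Rightarrow> real^3 \<Rightarrow> real^3" where
  "representative y = (SOME v. v \<in> sobolev_df s \<and> sobolev_class s v = y)"

lemma representative:
  assumes "y \<in> df_space s"
  shows "representative y \<in> sobolev_df s" "sobolev_class s (representative y) = y"
proof -
  have "\<exists>v. v \<in> sobolev_df s \<and> sobolev_class s v = y" using assms by (auto simp: df_space_def)
  then have "representative y \<in> sobolev_df s \<and> sobolev_class s (representative y) = y"
    unfolding representative_def by (rule someI_ex)
  then show "representative y \<in> sobolev_df s" "sobolev_class s (representative y) = y" by auto
qed

definition projected_stretch :: "(complex^3) l2 \<Rightarrow> (complex^3) l2 \<Rightarrow> (complex^3) l2" where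
  "projected_stretch y z = sobolev_class s (helmholtz s (stretch (representative y) (representative z)))"

text \<open>Equality of classes is equality almost everywhere, and it determines the velocity exactly.  Hence the
  projected stretching term is a function of classes, whatever representatives are used.\<close>

lemma stretch_class_cong:
  assumes v: "v \<in> sobolev s" "v' \<in> sobolev s" "sobolev_class s v = sobolev_class s v'"
    and w: "w \<in> sobolev s" "w' \<in> sobolev s" "sobolev_class s w = sobolev_class s w'"
  shows "sobolev_class s (helmholtz s (stretch v w)) = sobolev_class s (helmholtz s (stretch v' w'))"
proof (rule helmholtz_cong[OF s_nonneg])
  show S: "stretch v w \<in> sobolev s" "stretch v' w' \<in> sobolev s"
    by (intro stretch_bound v w)+
  have "AE x in lborel. stretch v w x = stretch v' w' x"
    by (intro stretch_cong_AE sobolev_measurable[of _ s] sobolev_class_eq_imp_AE_eq[of _ s] v w)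
  then have "sobolev_class s (stretch v' w') = sobolev_class s (stretch v w)"
    by (rule sobolev_class_cong_AE[OF S(1) sobolev_measurable[OF S(2)]])
  then show "sobolev_class s (stretch v w) = sobolev_class s (stretch v' w')" by simp
qed

lemma projected_stretch_class:
  assumes v: "v \<in> sobolev_df s" and w: "w \<in> sobolev_df s"
  shows "projected_stretch (sobolev_class s v) (sobolev_class s w) = sobolev_class s (helmholtz s (stretch v w))"
  unfolding projected_stretch_def
  using v w representative[OF sobolev_class_in_df_space[OF v]] representative[OF sobolev_class_in_df_space[OF w]]
  by (intro stretch_class_cong) (auto simp: sobolev_df_iff)

lemma df_space_cases:
  assumes "y \<in> df_space s"
  obtains v where "v \<in> sobolev_df s" "v \<in> sobolev s" "y = sobolev_class s v"
  using assms by (auto simp: df_space_def sobolev_df_iff)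

lemma projected_stretch_left:
  assumes x: "x \<in> df_space s" and y: "y \<in> df_space s" and z: "z \<in> df_space s"
  shows "projected_stretch (a *\<^sub>R x + b *\<^sub>R y) z = a *\<^sub>R projected_stretch x z + b *\<^sub>R projected_stretch y z"
proof -
  obtain u where u: "u \<in> sobolev_df s" "u \<in> sobolev s" "x = sobolev_class s u" using x by (rule df_space_cases)
  obtain v where v: "v \<in> sobolev_df s" "v \<in> sobolev s" "y = sobolev_class s v" using y by (rule df_space_cases)
  obtain w where w: "w \<in> sobolev_df s" "w \<in> sobolev s" "z = sobolev_class s w" using z by (rule df_space_cases)
  have "projected_stretch (a *\<^sub>R x + b *\<^sub>R y) z
      = sobolev_class s (helmholtz s (stretch (\<lambda>x. a *\<^sub>R u x + b *\<^sub>R v x) w))"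
    using projected_stretch_class[OF sobolev_df_lin[OF u(1) v(1), of a b] w(1)]
    by (simp add: u(3) v(3) w(3) sobolev_class_lin(2)[OF u(2) v(2)])
  also have "stretch (\<lambda>x. a *\<^sub>R u x + b *\<^sub>R v x) w = (\<lambda>x. a *\<^sub>R stretch u w x + b *\<^sub>R stretch v w x)"
    by (rule ext) (rule stretch_left_linear)
  finally show ?thesis
    by (simp add: helmholtz_lin[OF s_nonneg stretch_bound(1)[OF u(2) w(2)] stretch_bound(1)[OF v(2) w(2)]]
        u(3) v(3) w(3) projected_stretch_class u(1) v(1) w(1))
qed

lemma projected_stretch_right:
  assumes x: "x \<in> df_space s" and y: "y \<in> df_space s" and z: "z \<in> df_space s"
  shows "projected_stretch z (a *\<^sub>R x + b *\<^sub>R y) = a *\<^sub>R projected_stretch z x + b *\<^sub>R projected_stretch z y"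
proof -
  obtain u where u: "u \<in> sobolev_df s" "u \<in> sobolev s" "x = sobolev_class s u" using x by (rule df_space_cases)
  obtain v where v: "v \<in> sobolev_df s" "v \<in> sobolev s" "y = sobolev_class s v" using y by (rule df_space_cases)
  obtain w where w: "w \<in> sobolev_df s" "w \<in> sobolev s" "z = sobolev_class s w" using z by (rule df_space_cases)
  have "projected_stretch z (a *\<^sub>R x + b *\<^sub>R y)
      = sobolev_class s (helmholtz s (stretch w (\<lambda>x. a *\<^sub>R u x + b *\<^sub>R v x)))"
    using projected_stretch_class[OF w(1) sobolev_df_lin[OF u(1) v(1), of a b]]
    by (simp add: u(3) v(3) w(3) sobolev_class_lin(2)[OF u(2) v(2)])
  also have "stretch w (\<lambda>x. a *\<^sub>R u x + b *\<^sub>R v x) = (\<lambda>x. a *\<^sub>R stretch w u x + b *\<^sub>R stretch w v x)"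
    by (rule ext) (rule stretch_right_linear[OF u(2) v(2)])
  finally show ?thesis
    by (simp add: helmholtz_lin[OF s_nonneg stretch_bound(1)[OF w(2) u(2)] stretch_bound(1)[OF w(2) v(2)]]
        u(3) v(3) w(3) projected_stretch_class u(1) v(1) w(1))
qed

sublocale quadratic_ode "df_space s" projected_stretch C
proof
  show "subspace (df_space s)" by (rule subspace_df_space)
  show "closed (df_space s)" by (rule closed_df_space[OF s_nonneg])
  show "0 < C" by (rule C)
  fix x y assume xy: "x \<in> df_space s" "y \<in> df_space s"
  obtain v where v: "v \<in> sobolev_df s" "v \<in> sobolev s" "x = sobolev_class s v" using xy(1) by (rule df_space_cases)
  obtain w where w: "w \<in> sobolev_df s" "w \<in> sobolev s" "y = sobolev_class s w" using xy(2) by (rule df_space_cases)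
  note S = stretch_bound[OF v(2) w(2)]
  show "projected_stretch x y \<in> df_space s"
    unfolding v(3) w(3) projected_stretch_class[OF v(1) w(1)]
    by (intro sobolev_class_in_df_space helmholtz_spec s_nonneg S)
  have "norm (projected_stretch x y) \<le> norm (sobolev_class s (stretch v w))"
    unfolding v(3) w(3) projected_stretch_class[OF v(1) w(1)]
    by (intro norm_helmholtz_le s_nonneg S)
  also have "\<dots> \<le> C * norm x * norm y"
    using S by (simp add: norm_sobolev_class v w)
  finally show "norm (projected_stretch x y) \<le> C * norm x * norm y" .
  show "projected_stretch (c *\<^sub>R x) y = c *\<^sub>R projected_stretch x y" for c
    using projected_stretch_left[OF xy(1) xy(1) xy(2), of c 0] by simp
  show "projected_stretch x (c *\<^sub>R y) = c *\<^sub>R projected_stretch x y" for c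
    using projected_stretch_right[OF xy(2) xy(2) xy(1), of c 0] by simp
  fix z assume z: "z \<in> df_space s"
  show "projected_stretch (x + y) z = projected_stretch x z + projected_stretch y z"
    using projected_stretch_left[OF xy z, of 1 1] by simp
  show "projected_stretch z (x + y) = projected_stretch z x + projected_stretch z y"
    using projected_stretch_right[OF xy z, of 1 1] by simp
qed

lemma strong_solution_upto_imp_solves:
  assumes "strong_solution_upto s T \<omega>"
  shows "solves (\<lambda>t. sobolev_class s (\<omega> t)) T"
proof -
  obtain d where C1: "C1_sobolev_df s T \<omega> d"
    and d: "\<And>t. t \<in> {0..T} \<Longrightarrow> stretching (\<omega> t) \<in> sobolev s"
      "\<And>t. t \<in> {0..T} \<Longrightarrow> AE x in lborel. d t x = helmholtz s (stretching (\<omega> t)) x"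
    using assms unfolding strong_solution_upto_def by blast
  have mem: "\<omega> t \<in> sobolev_df s \<and> d t \<in> sobolev_df s" if "t \<in> {0..T}" for t
    using C1 that unfolding C1_sobolev_df_def by blast
  have rhs: "sobolev_class s (d t) = projected_stretch (sobolev_class s (\<omega> t)) (sobolev_class s (\<omega> t))" if t: "t \<in> {0..T}" for t
  proof -
    have ws: "\<omega> t \<in> sobolev s" using mem[OF t] by (simp add: sobolev_df_iff)
    note h = helmholtz_spec(1)[OF s_nonneg d(1)[OF t]]
    have hs: "helmholtz s (stretching (\<omega> t)) \<in> sobolev s" using h by (simp add: sobolev_df_iff)
    have "sobolev_class s (helmholtz s (stretching (\<omega> t))) = sobolev_class s (d t)"
      using mem[OF t] by (intro sobolev_df_cong_AE(2)[OF _ sobolev_measurable[OF hs] d(2)[OF t]]) simp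
    then show ?thesis
      using mem[OF t] by (simp add: projected_stretch_class stretching_eq_stretch[OF ws])
  qed
  have D: "((\<lambda>t. sobolev_class s (\<omega> t)) has_vector_derivative sobolev_class s (d t)) (at t within {0..T})"
    if "t \<in> {0..T}" for t
    using C1 that C1_sobolev_df_iff[where T = T and s = s and \<omega> = \<omega> and d = d, OF mem] by blast
  show ?thesis
    unfolding solves_def
  proof (intro ballI conjI)
    fix t assume t: "t \<in> {0..T}"
    show "sobolev_class s (\<omega> t) \<in> df_space s" using mem[OF t] by (intro sobolev_class_in_df_space) simp
    show "((\<lambda>t. sobolev_class s (\<omega> t)) has_vector_derivative
        projected_stretch (sobolev_class s (\<omega> t)) (sobolev_class s (\<omega> t))) (at t within {0..T})"
      using D[OF t] unfolding rhs[OF t] .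
  qed
qed

lemma solves_imp_strong_solution_upto:
  assumes y: "solves y T"
  shows "strong_solution_upto s T (\<lambda>t. representative (y t))"
  unfolding strong_solution_upto_def
proof (intro exI conjI ballI)
  let ?w = "\<lambda>t. representative (y t)"
  let ?d = "\<lambda>t. helmholtz s (stretching (?w t))"
  have yX: "y t \<in> df_space s" if "t \<in> {0..T}" for t using y that by (auto simp: solves_def)
  note r = representative[OF yX]
  have rs: "?w t \<in> sobolev s" if "t \<in> {0..T}" for t using r(1)[OF that] by (simp add: sobolev_df_iff)
  show S: "stretching (?w t) \<in> sobolev s" if "t \<in> {0..T}" for t
    unfolding stretching_eq_stretch[OF rs[OF that]] by (intro stretch_bound rs that)
  show "AE x in lborel. ?d t x = helmholtz s (stretching (?w t)) x" for t by simp
  have d: "sobolev_class s (?d t) = projected_stretch (y t) (y t)" if "t \<in> {0..T}" for t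
    unfolding projected_stretch_def stretching_eq_stretch[OF rs[OF that]] ..
  have mem: "?w t \<in> sobolev_df s \<and> ?d t \<in> sobolev_df s" if "t \<in> {0..T}" for t
    using r(1)[OF that] helmholtz_spec(1)[OF s_nonneg S[OF that]] by blast
  have "(\<forall>t\<in>{0..T}. ((\<lambda>t. sobolev_class s (?w t)) has_vector_derivative sobolev_class s (?d t)) (at t within {0..T}))
    \<and> continuous_on {0..T} (\<lambda>t. sobolev_class s (?d t))"
  proof (intro conjI ballI)
    fix t assume t: "t \<in> {0..T}"
    have "(y has_vector_derivative projected_stretch (y t) (y t)) (at t within {0..T})"
      using y t by (simp add: solves_def)
    then show "((\<lambda>t. sobolev_class s (?w t)) has_vector_derivative sobolev_class s (?d t)) (at t within {0..T})"
      unfolding d[OF t]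
      by (rule has_vector_derivative_transform[where f = y and S = "{0..T}", OF t, rotated]) (auto simp: r(2))
  next
    have "continuous_on {0..T} (\<lambda>t. projected_stretch (y t) (y t))"
      unfolding continuous_on_def
    proof
      fix t assume t: "t \<in> {0..T}"
      have yt: "(y \<longlongrightarrow> y t) (at t within {0..T})"
        using solves_continuous[OF y] t by (simp add: continuous_on_def)
      have "((\<lambda>\<tau>. C * (norm (y \<tau>) + norm (y t)) * norm (y \<tau> - y t)) \<longlongrightarrow> C * (norm (y t) + norm (y t)) * norm (y t - y t)) (at t within {0..T})"
        by (intro tendsto_intros yt)
      then have lim0: "((\<lambda>\<tau>. C * (norm (y \<tau>) + norm (y t)) * norm (y \<tau> - y t)) \<longlongrightarrow> 0) (at t within {0..T})" by simp
      have "((\<lambda>\<tau>. projected_stretch (y \<tau>) (y \<tau>) - projected_stretch (y t) (y t)) \<longlongrightarrow> 0) (at t within {0..T})"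
      proof (rule Lim_null_comparison[OF _ lim0])
        show "\<forall>\<^sub>F \<tau> in at t within {0..T}. norm (projected_stretch (y \<tau>) (y \<tau>) - projected_stretch (y t) (y t))
            \<le> C * (norm (y \<tau>) + norm (y t)) * norm (y \<tau> - y t)"
          using norm_B_diff_self yX t by (auto simp: eventually_at_filter)
      qed
      then show "((\<lambda>t. projected_stretch (y t) (y t)) \<longlongrightarrow> projected_stretch (y t) (y t)) (at t within {0..T})"
        by (simp add: LIM_zero_iff)
    qed
    then show "continuous_on {0..T} (\<lambda>t. sobolev_class s (?d t))"
      by (rule continuous_on_eq) (simp add: d)
  qed
  then show "C1_sobolev_df s T ?w ?d"
    using C1_sobolev_df_iff[where T = T and s = s and \<omega> = ?w and d = ?d, OF mem] by blast
qed

lemma strong_solution_imp_solves_below: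
  assumes \<omega>0: "\<omega>0 \<in> sobolev_df s" and sol: "strong_solution s T \<omega>0 \<omega>"
  shows "0 < T" "sobolev_class s (\<omega> 0) = sobolev_class s \<omega>0" "solves_below (\<lambda>t. sobolev_class s (\<omega> t)) T"
proof -
  show T: "0 < T" using sol by (simp add: strong_solution_def)
  show sb: "solves_below (\<lambda>t. sobolev_class s (\<omega> t)) T"
    using sol unfolding solves_below_def strong_solution_def by (blast intro: strong_solution_upto_imp_solves)
  obtain T' where T': "0 < T'" "ereal T' < T"
    using ereal_dense2[OF T] by (auto simp: zero_ereal_def)
  then have "strong_solution_upto s T' \<omega>" using sol by (simp add: strong_solution_def)
  then have "\<omega> 0 \<in> sobolev_df s"
    using T' unfolding strong_solution_upto_def C1_sobolev_df_def by force
  then have "\<omega> 0 \<in> borel_measurable borel" by (intro sobolev_measurable[of _ s]) (simp add: sobolev_df_iff)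
  moreover have "AE x in lborel. \<omega>0 x = \<omega> 0 x"
    using sol by (auto simp: strong_solution_def elim: eventually_mono)
  ultimately show "sobolev_class s (\<omega> 0) = sobolev_class s \<omega>0"
    by (intro sobolev_df_cong_AE(2)[OF \<omega>0])
qed

lemma solves_below_imp_strong_solution:
  assumes \<omega>0: "\<omega>0 \<in> sobolev_df s" and T: "0 < T" and y: "solves_below y T" "y 0 = sobolev_class s \<omega>0"
  shows "strong_solution s T \<omega>0 (\<lambda>t. representative (y t))"
  unfolding strong_solution_def
proof (intro conjI allI impI)
  have r: "representative (y 0) \<in> sobolev_df s" "sobolev_class s (representative (y 0)) = sobolev_class s \<omega>0"
    unfolding y(2) using representative[OF sobolev_class_in_df_space[OF \<omega>0]] by auto
  show "AE x in lborel. representative (y 0) x = \<omega>0 x"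
    using r \<omega>0 by (intro sobolev_class_eq_imp_AE_eq[of _ s]) (auto simp: sobolev_df_iff)
  show "strong_solution_upto s T' (\<lambda>t. representative (y t))" if "0 < T' \<and> ereal T' < T" for T'
    using y(1) that by (intro solves_imp_strong_solution_upto) (simp add: solves_below_def)
qed (rule T)

text \<open>Taking classes maps strong solutions to solutions of the abstract equation, and taking
  representatives goes back.\<close>

lemma max_time_eq_lifespan:
  assumes \<omega>0: "\<omega>0 \<in> sobolev_df s"
  shows "max_time s \<omega>0 = lifespan (sobolev_class s \<omega>0)"
proof -
  have "(\<exists>\<omega>. strong_solution s T \<omega>0 \<omega>) \<longleftrightarrow> 0 < T \<and> (\<exists>y. y 0 = sobolev_class s \<omega>0 \<and> solves_below y T)" for T
  proof
    assume "\<exists>\<omega>. strong_solution s T \<omega>0 \<omega>"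
    then obtain \<omega> where "strong_solution s T \<omega>0 \<omega>" by blast
    from strong_solution_imp_solves_below[OF \<omega>0 this]
    show "0 < T \<and> (\<exists>y. y 0 = sobolev_class s \<omega>0 \<and> solves_below y T)"
      by (intro conjI exI[of _ "\<lambda>t. sobolev_class s (\<omega> t)"])
  next
    assume "0 < T \<and> (\<exists>y. y 0 = sobolev_class s \<omega>0 \<and> solves_below y T)"
    then show "\<exists>\<omega>. strong_solution s T \<omega>0 \<omega>" using solves_below_imp_strong_solution[OF \<omega>0] by blast
  qed
  then show ?thesis by (simp add: max_time_def lifespan_def)
qed

end

theorem theorem1p1:
  fixes s C :: real and \<omega>0 :: "real^3 \<Rightarrow> real^3"
  assumes s: "s > 3 / 2"
    and C: "C > 0"
    and algebra: "\<And>f g :: real^3 \<Rightarrow> real. f \<in> sobolev s \<Longrightarrow> g \<in> sobolev s \<Longrightarrow>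
      (\<lambda>x. f x * g x) \<in> sobolev s \<and>
      sobolev_norm s (\<lambda>x. f x * g x) \<le> C * sobolev_norm s f * sobolev_norm s g"
    and \<omega>0: "\<omega>0 \<in> sobolev_df s"
  shows "max_time s \<omega>0 \<ge> 1 / ereal (2 * C * sobolev_norm s \<omega>0) \<and>
    (\<exists>\<omega>. strong_solution s (max_time s \<omega>0) \<omega>0 \<omega> \<and>
      (\<forall>T v. strong_solution s T \<omega>0 v \<longrightarrow>
         (\<forall>t. 0 \<le> t \<and> ereal t < T \<longrightarrow> (AE x in lborel. v t x = \<omega> t x))) \<and>
      (max_time s \<omega>0 < \<infinity> \<longrightarrow>
         (\<forall>t. 0 \<le> t \<and> ereal t < max_time s \<omega>0 \<longrightarrow>
            sobolev_norm s (\<omega> t) \<ge> 1 / (2 * C * (real_of_ereal (max_time s \<omega>0) - t)))))"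
proof -
  interpret sobolev_algebra s C
    using s C algebra by unfold_locales auto
  let ?y0 = "sobolev_class s \<omega>0"
  let ?T = "max_time s \<omega>0"
  note y0 = sobolev_class_in_df_space[OF \<omega>0] and maxT = max_time_eq_lifespan[OF \<omega>0]
  have \<omega>0s: "\<omega>0 \<in> sobolev s" using \<omega>0 by (simp add: sobolev_df_iff)
  have lower: "1 / ereal (2 * C * sobolev_norm s \<omega>0) \<le> ?T"
    using lifespan_ge[OF y0] by (simp add: maxT norm_sobolev_class \<omega>0s)
  have Tpos: "0 < ?T" unfolding maxT by (rule lifespan_pos[OF y0])
  obtain y where y: "y 0 = ?y0" "solves_below y ?T"
    and blowup: "?T < \<infinity> \<Longrightarrow> 0 \<le> t \<Longrightarrow> ereal t < ?T \<Longrightarrow> 1 / (2 * C * (real_of_ereal ?T - t)) \<le> norm (y t)" for t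
    using maximal_solution[OF y0] unfolding maxT by blast
  let ?w = "\<lambda>t. representative (y t)"
  have later: "\<exists>T'. 0 < T' \<and> t \<le> T' \<and> ereal T' < T" if t: "0 \<le> t" "ereal t < T" for t T
  proof -
    obtain T' where "ereal t < ereal T'" "ereal T' < T" using ereal_dense2[OF t(2)] by blast
    then show ?thesis using t(1) by (intro exI[of _ T']) auto
  qed
  have yX: "y t \<in> df_space s" if "0 \<le> t" "ereal t < ?T" for t
    using later[OF that] y(2) that(1) unfolding solves_below_def solves_def by force
  have "strong_solution s ?T \<omega>0 ?w"
    by (rule solves_below_imp_strong_solution[OF \<omega>0 Tpos y(2) y(1)])
  moreover have "AE x in lborel. v t x = ?w t x"
    if v: "strong_solution s T \<omega>0 v" and t: "0 \<le> t" "ereal t < T" for T v t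
  proof -
    note sv = strong_solution_imp_solves_below[OF \<omega>0 v]
    have "T \<le> ?T" unfolding max_time_def using v by (intro Sup_upper) blast
    obtain T' where T': "0 < T'" "t \<le> T'" "ereal T' < T" using later[OF t] by blast
    have "solves (\<lambda>t. sobolev_class s (v t)) T'" "solves y T'"
      using sv(3) y(2) T' \<open>T \<le> ?T\<close> unfolding solves_below_def by auto
    then have "sobolev_class s (v t) = y t"
      using solves_unique[of "\<lambda>t. sobolev_class s (v t)" T' y t] sv(2) y(1) t T' by simp
    moreover have "v t \<in> sobolev s"
    proof -
      have "strong_solution_upto s T' v" using v T' by (simp add: strong_solution_def)
      then show ?thesis using t T' unfolding strong_solution_upto_def C1_sobolev_df_def sobolev_df_iff by force
    qed
    moreover have "y t \<in> df_space s" using \<open>T \<le> ?T\<close> t by (intro yX) auto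
    ultimately show ?thesis
      using representative[of "y t"] by (intro sobolev_class_eq_imp_AE_eq[of _ s]) (auto simp: sobolev_df_iff)
  qed
  moreover have "1 / (2 * C * (real_of_ereal ?T - t)) \<le> sobolev_norm s (?w t)"
    if "?T < \<infinity>" "0 \<le> t" "ereal t < ?T" for t
    using blowup[OF that] representative[OF yX[OF that(2,3)]] by (simp add: norm_sobolev_class[symmetric] sobolev_df_iff)
  ultimately show ?thesis using lower by blast
qed

end
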